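(* Let $X$ be an $m$-vertex triangulation of a closed connected $n$-manifold. Then $\ddot{\mathrm{H}}^m(X)\cong\mathbb{F}_{(n,0)}$, generated by the fundamental class of $|X|$.
   Context: $\mathbb{F}$ is the field with two elements. For $X$ with vertices $v_1,\dots,v_m$: a colouring $\varepsilon\in\mathbb{Z}_2^m$ colours $v_i$ black if $\varepsilon(i)=1$ and white otherwise; $|\varepsilon|$ is the number of black vertices; the weight of a simplex is its number of white vertices. The horizontal differential $\partial_h^\varepsilon$ on the simplicial chain complex $C(X)$ over $\mathbb{F}$ sends a simplex $\sigma$ to the sum of its faces $\sigma\setminus\{v\}$ over black $v\in\sigma$; $\mathrm{H}^h(X,\varepsilon)$ is its homology, bigraded by (dimension, weight); for the all-black colouring it is the simplicial homology $\mathrm{H}_*(X)$ in weight $0$. For $\varepsilon,\varepsilon'$ differing only at index $i$ with $\varepsilon(i)=0,\varepsilon'(i)=1$, $d_{\varepsilon\to\varepsilon'}:\mathrm{H}^h(X,\varepsilon)\to\mathrm{H}^h(X,\varepsilon')$ sends the class of a cycle $x$ to the class of the sum of the simplices of $x$ not containing $v_i$. The \"uber complex is $\ddot{C}^j(X)=\bigoplus_{|\varepsilon|=j}\mathrm{H}^h(X,\varepsilon)$, $0\le j\le m$, with differential the sum of these maps; its homology is $\ddot{\mathrm{H}}^j(X)$. $\mathbb{F}_{(a,b)}$ is a copy of $\mathbb{F}$ in bidegree (dimension, weight) $=(a,b)$. *)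

theory Defs
  imports
    "HOL-Library.Z2"
    "HOL-Algebra.FiniteProduct"
    "HOL-Algebra.Product_Groups"
    "HOL-Analysis.Analysis"
begin

section \<open>Triangulations of closed connected manifolds\<close>

definition closed_connected_manifold :: "nat \<Rightarrow> 'a topology \<Rightarrow> bool" where
  "closed_connected_manifold n M \<longleftrightarrow>
     Hausdorff_space M \<and> second_countable M \<and>
     (\<forall>x\<in>topspace M. \<exists>U V. openin M U \<and> x \<in> U \<and> openin (Euclidean_space n) V \<and>
        subtopology M U homeomorphic_space subtopology (Euclidean_space n) V) \<and>
     compact_space M \<and> connected_space M \<and> topspace M \<noteq> {}"

text \<open>Finite abstract simplicial complexes. The empty face is not a simplex, and every point
  of \<open>\<Union>X\<close> is a vertex.\<close>

definition finite_complex :: "'v set set \<Rightarrow> bool" where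
  "finite_complex X \<longleftrightarrow>
     finite X \<and> (\<forall>\<sigma>\<in>X. finite \<sigma> \<and> \<sigma> \<noteq> {}) \<and>
     (\<forall>\<sigma>\<in>X. \<forall>\<tau>. \<tau> \<subseteq> \<sigma> \<and> \<tau> \<noteq> {} \<longrightarrow> \<tau> \<in> X)"

definition vertices :: "'v set set \<Rightarrow> 'v set" where
  "vertices X = \<Union>X"

text \<open>The realization, in barycentric coordinates.\<close>

definition realization :: "'v set set \<Rightarrow> ('v \<Rightarrow> real) set" where
  "realization X =
     {t. (\<forall>v. 0 \<le> t v) \<and> {v. t v \<noteq> 0} \<in> X \<and> (\<Sum>v\<in>vertices X. t v) = 1}"

definition triangulates :: "'v set set \<Rightarrow> 'a topology \<Rightarrow> bool" where
  "triangulates X M \<longleftrightarrow>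
     finite_complex X \<and>
     subtopology (powertop_real UNIV) (realization X) homeomorphic_space M"


section \<open>Horizontal homology\<close>

text \<open>A colouring \<open>\<epsilon>\<close> is encoded by its set of black vertices, a subset of \<open>vertices X\<close>, so
  \<open>\<bar>\<epsilon>\<bar>\<close> is \<open>card \<epsilon>\<close> and the weight of \<open>\<sigma>\<close> is \<open>card (\<sigma> - \<epsilon>)\<close>. Chains over the field
  \<^typ>\<open>bit\<close> are functions on simplices. Vector spaces over \<^typ>\<open>bit\<close> are represented by their
  additive groups; scalar multiplication by 0 and 1 carries no further information, and additive
  maps are linear. Indices \<open>k\<close> and \<open>w\<close> stand for dimension and weight throughout.\<close>

type_synonym 'v mod2_chain = "'v set \<Rightarrow> bit"

definition hor_chains :: "'v set set \<Rightarrow> 'v set \<Rightarrow> nat \<Rightarrow> nat \<Rightarrow> 'v mod2_chain monoid" where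
  "hor_chains X \<epsilon> k w =
     \<lparr>carrier = {c. \<forall>\<sigma>. c \<sigma> \<noteq> 0 \<longrightarrow> \<sigma> \<in> X \<and> card \<sigma> = Suc k \<and> card (\<sigma> - \<epsilon>) = w},
      monoid.mult = (\<lambda>c d \<sigma>. c \<sigma> + d \<sigma>),
      one = (\<lambda>\<sigma>. 0)\<rparr>"

text \<open>The coefficient of \<open>\<tau>\<close> in the horizontal differential of \<open>c\<close>. The complex is not
  augmented: a vertex has no face.\<close>

definition hor_diff :: "'v set set \<Rightarrow> 'v set \<Rightarrow> 'v mod2_chain \<Rightarrow> 'v mod2_chain" where
  "hor_diff X \<epsilon> c =
     (\<lambda>\<tau>. \<Sum>\<sigma>\<in>X. \<Sum>v\<in>\<sigma> \<inter> \<epsilon>. if \<tau> \<noteq> {} \<and> \<tau> = \<sigma> - {v} then c \<sigma> else 0)"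

definition hor_cycles :: "'v set set \<Rightarrow> 'v set \<Rightarrow> nat \<Rightarrow> nat \<Rightarrow> 'v mod2_chain set" where
  "hor_cycles X \<epsilon> k w = {c \<in> carrier (hor_chains X \<epsilon> k w). hor_diff X \<epsilon> c = (\<lambda>\<tau>. 0)}"

definition hor_boundaries :: "'v set set \<Rightarrow> 'v set \<Rightarrow> nat \<Rightarrow> nat \<Rightarrow> 'v mod2_chain set" where
  "hor_boundaries X \<epsilon> k w = hor_diff X \<epsilon> ` carrier (hor_chains X \<epsilon> (Suc k) w)"

definition hor_homology ::
  "'v set set \<Rightarrow> 'v set \<Rightarrow> nat \<Rightarrow> nat \<Rightarrow> 'v mod2_chain set monoid" where
  "hor_homology X \<epsilon> k w =
     (hor_chains X \<epsilon> k w)\<lparr>carrier := hor_cycles X \<epsilon> k w\<rparr> Mod hor_boundaries X \<epsilon> k w"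

definition hor_class ::
  "'v set set \<Rightarrow> 'v set \<Rightarrow> nat \<Rightarrow> nat \<Rightarrow> 'v mod2_chain \<Rightarrow> 'v mod2_chain set" where
  "hor_class X \<epsilon> k w c = hor_boundaries X \<epsilon> k w #>\<^bsub>hor_chains X \<epsilon> k w\<^esub> c"


section \<open>The uber complex\<close>

text \<open>The map induced by turning the white vertex \<open>v\<close> of \<open>\<epsilon>\<close> black. The class on the right does
  not depend on the representative \<open>c\<close>, so the image is a singleton.\<close>

definition hor_map ::
  "'v set set \<Rightarrow> 'v set \<Rightarrow> 'v \<Rightarrow> nat \<Rightarrow> nat \<Rightarrow> 'v mod2_chain set \<Rightarrow> 'v mod2_chain set" where
  "hor_map X \<epsilon> v k w \<xi> =
     the_elem ((\<lambda>c. hor_class X (insert v \<epsilon>) k w (\<lambda>\<sigma>. if v \<in> \<sigma> then 0 else c \<sigma>)) ` \<xi>)"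

definition colourings :: "'v set set \<Rightarrow> nat \<Rightarrow> 'v set set" where
  "colourings X j = {\<epsilon>. \<epsilon> \<subseteq> vertices X \<and> card \<epsilon> = j}"

text \<open>For \<open>j\<close> above the number of vertices this is the trivial group.\<close>

definition uber_complex ::
  "'v set set \<Rightarrow> nat \<Rightarrow> nat \<Rightarrow> nat \<Rightarrow> ('v set \<Rightarrow> 'v mod2_chain set) monoid" where
  "uber_complex X j k w = sum_group (colourings X j) (\<lambda>\<epsilon>. hor_homology X \<epsilon> k w)"

definition uber_diff ::
  "'v set set \<Rightarrow> nat \<Rightarrow> nat \<Rightarrow> nat \<Rightarrow>
     ('v set \<Rightarrow> 'v mod2_chain set) \<Rightarrow> ('v set \<Rightarrow> 'v mod2_chain set)" where
  "uber_diff X j k w x =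
     (\<lambda>\<epsilon>\<in>colourings X (Suc j).
        \<Otimes>\<^bsub>hor_homology X \<epsilon> k w\<^esub>v\<in>\<epsilon>. hor_map X (\<epsilon> - {v}) v k w (x (\<epsilon> - {v})))"

definition uber_cocycles ::
  "'v set set \<Rightarrow> nat \<Rightarrow> nat \<Rightarrow> nat \<Rightarrow> ('v set \<Rightarrow> 'v mod2_chain set) set" where
  "uber_cocycles X j k w =
     kernel (uber_complex X j k w) (uber_complex X (Suc j) k w) (uber_diff X j k w)"

definition uber_coboundaries ::
  "'v set set \<Rightarrow> nat \<Rightarrow> nat \<Rightarrow> nat \<Rightarrow> ('v set \<Rightarrow> 'v mod2_chain set) set" where
  "uber_coboundaries X j k w =
     (case j of
        0 \<Rightarrow> {\<one>\<^bsub>uber_complex X 0 k w\<^esub>}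
      | Suc i \<Rightarrow> uber_diff X i k w ` carrier (uber_complex X i k w))"

definition uber_homology ::
  "'v set set \<Rightarrow> nat \<Rightarrow> nat \<Rightarrow> nat \<Rightarrow> ('v set \<Rightarrow> 'v mod2_chain set) set monoid" where
  "uber_homology X j k w =
     (uber_complex X j k w)\<lparr>carrier := uber_cocycles X j k w\<rparr> Mod uber_coboundaries X j k w"

definition uber_class ::
  "'v set set \<Rightarrow> nat \<Rightarrow> nat \<Rightarrow> nat \<Rightarrow>
     ('v set \<Rightarrow> 'v mod2_chain set) \<Rightarrow> ('v set \<Rightarrow> 'v mod2_chain set) set" where
  "uber_class X j k w x = uber_coboundaries X j k w #>\<^bsub>uber_complex X j k w\<^esub> x"


section \<open>Bigraded vector spaces and the fundamental class\<close>

definition F_at :: "nat \<Rightarrow> nat \<Rightarrow> nat \<Rightarrow> nat \<Rightarrow> bit monoid" where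
  "F_at a b k w =
     \<lparr>carrier = (if (k, w) = (a, b) then UNIV else {0}), monoid.mult = (+), one = 0\<rparr>"

definition bigraded_iso ::
  "(nat \<Rightarrow> nat \<Rightarrow> 'a monoid) \<Rightarrow> (nat \<Rightarrow> nat \<Rightarrow> 'b monoid) \<Rightarrow> bool" where
  "bigraded_iso G H \<longleftrightarrow> (\<forall>k w. G k w \<cong> H k w)"

text \<open>The all-black horizontal homology in weight 0 is simplicial homology. The mod 2 fundamental
  class of a closed \<open>n\<close>-manifold is the class in degree \<open>n\<close> whose image in
  \<open>H\<^sub>n(\<bar>X\<bar>, \<bar>X\<bar> - x)\<close>, a copy of the field, is the generator for every point \<open>x\<close>. If \<open>x\<close> is
  interior to the simplex \<open>\<sigma>\<close>, that group is \<open>H\<^sub>n(X, A)\<close> where \<open>A\<close> consists of the simplices not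
  containing \<open>\<sigma>\<close>, and the image of \<open>\<zeta>\<close> vanishes iff some representative of \<open>\<zeta>\<close> lies in \<open>A\<close>.\<close>

definition fundamental_class :: "'v set set \<Rightarrow> nat \<Rightarrow> 'v mod2_chain set" where
  "fundamental_class X n =
     (THE \<zeta>. \<zeta> \<in> carrier (hor_homology X (vertices X) n 0) \<and>
        (\<forall>\<sigma>\<in>X. \<forall>z\<in>\<zeta>. \<exists>\<tau>\<in>X. \<sigma> \<subseteq> \<tau> \<and> z \<tau> \<noteq> 0))"

end

theory Submission
  imports Defs "HOL-Library.Poly_Mapping" "HOL-Homology.Invariance_of_Domain"
begin

text \<open>In top degree only the colourings with one white vertex map to the all-black one, and they
  contribute the images of \<open>H\<^sub>k(X - v)\<close> in \<open>H\<^sub>k(X)\<close>. So the homology is the cokernel of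
  \<open>\<Oplus>\<^sub>v H\<^sub>k(X - v) \<rightarrow> H\<^sub>k(X)\<close>. For \<open>k \<noteq> n\<close> it vanishes because \<open>H\<^sub>k(X, X - v)\<close> is local homology of a
  manifold at a vertex. For \<open>k = n\<close> the \<open>n\<close>-cycles are 0 and the sum of all \<open>n\<close>-simplices, and only the
  former avoids a vertex.

  The simplicial local homology at \<open>\<sigma>\<close> is compared with that of Euclidean space without singular
  homology, by Vietoris chains: formal sums modulo 2 of lists of close points. Fine lists of points
  of the realization give simplices by choosing near vertices; conversely faces are filled by
  arbitrarily fine chains because fine cycles in convex sets bound fine chains.\<close>

section \<open>Chains over the field with two elements\<close>

text \<open>The triangulation is not assumed combinatorial: links need not be spheres, so the local
  homology at a simplex cannot be read off from \<open>X\<close> alone and has to come from the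
  charts of \<open>realization X\<close>. Only an upper bound is carried over: it vanishes off
  degree \<open>n\<close> and embeds in the field in degree \<open>n\<close>. For this it suffices
  to go from the star to the standard simplex and back, the round trip being the identity on
  simplicial chains. That a codimension one face has a second coface, without which the sum of all
  \<open>n\<close>-simplices would not be a cycle, is a lower bound and comes from invariance of
  domain. Local alternatives become global by passing from vertex to vertex along edges. Internal
  boundaries are augmented: the empty list and the empty face are kept. This makes nonempty convex
  sets acyclic in all degrees and is harmless locally, since the empty face contains no nonempty
  \<open>\<sigma>\<close>; it is why cycles of \<open>X\<close> appear with boundary supported in
  \<open>{{}}\<close>. In positive weight the all-black group is 0, so the geometry concerns weight
  0 only.\<close>

type_synonym 'a bit_chain = "'a \<Rightarrow>\<^sub>0 bit"

abbreviation keys :: "('a bit_chain) \<Rightarrow> 'a set" where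
  "keys \<equiv> Poly_Mapping.keys"

abbreviation lookup :: "('a bit_chain) \<Rightarrow> 'a \<Rightarrow> bit" where
  "lookup \<equiv> Poly_Mapping.lookup"

abbreviation gen :: "'a \<Rightarrow> 'a bit_chain" where
  "gen x \<equiv> Poly_Mapping.single x 1"

lemma bit_chain_add_self [simp]: "(c :: 'a bit_chain) + c = 0"
  by (rule poly_mapping_eqI) (simp add: lookup_add)

lemma bit_chain_add_self_left [simp]: "(c :: 'a bit_chain) + (c + d) = d"
  by (simp flip: add.assoc)

lemma bit_chain_add_eq_0_iff: "(c :: 'a bit_chain) + d = 0 \<longleftrightarrow> c = d"
  by (metis add.right_neutral bit_chain_add_self bit_chain_add_self_left)

lemma in_keys_bit_iff: "x \<in> keys (c :: 'a bit_chain) \<longleftrightarrow> lookup c x = 1"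
  by (simp add: in_keys_iff)

lemma keys_add_subset:
  fixes c d :: "'a bit_chain"
  assumes "keys c \<subseteq> S" "keys d \<subseteq> S"
  shows "keys (c + d) \<subseteq> S"
  using assms keys_add [of c d] by blast

definition linext :: "('a \<Rightarrow> 'b bit_chain) \<Rightarrow> ('a bit_chain) \<Rightarrow> ('b bit_chain)" where
  "linext f c = (\<Sum>x\<in>keys c. f x)"

lemma linext_superset:
  assumes "finite S" "keys c \<subseteq> S"
  shows "linext f c = (\<Sum>x\<in>S. if lookup c x = 1 then f x else 0)"
  unfolding linext_def
  by (rule sum.mono_neutral_cong_left) (use assms in \<open>auto simp: in_keys_iff\<close>)

lemma linext_0 [simp]: "linext f 0 = 0"
  by (simp add: linext_def)

lemma linext_gen [simp]: "linext f (gen x) = f x"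
  by (simp add: linext_def)

lemma linext_add [simp]:
  "linext f (c + d) = linext f c + linext f d"
proof -
  let ?S = "keys c \<union> keys d"
  have "linext f (c + d) = (\<Sum>x\<in>?S. if lookup (c + d) x = 1 then f x else 0)"
    using keys_add [of c d] by (intro linext_superset) auto
  also have "\<dots> = (\<Sum>x\<in>?S. (if lookup c x = 1 then f x else 0) + (if lookup d x = 1 then f x else 0))"
    by (intro sum.cong) (auto simp: lookup_add)
  also have "\<dots> = linext f c + linext f d"
    by (simp add: sum.distrib linext_superset [of ?S])
  finally show ?thesis .
qed

lemma linext_sum [simp]:
  "linext f (\<Sum>i\<in>I. c i) = (\<Sum>i\<in>I. linext f (c i))"
  by (induction I rule: infinite_finite_induct) auto

lemma linext_compose:
  "linext f (linext g c) = linext (\<lambda>x. linext f (g x)) c"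
  by (simp add: linext_def [of g] linext_def [of "\<lambda>x. linext f (g x)"])

lemma linext_cong:
  "(\<And>x. x \<in> keys c \<Longrightarrow> f x = g x) \<Longrightarrow> linext f c = linext g c"
  by (simp add: linext_def)

lemma linext_ident [simp]: "linext gen c = c"
proof (rule poly_mapping_eqI)
  fix x
  have "lookup (linext gen c) x = (\<Sum>y\<in>keys c. if y = x then 1 else 0)"
    unfolding linext_def lookup_sum by (intro sum.cong) (auto simp: lookup_single when_def)
  also have "\<dots> = lookup c x"
    by (auto simp: in_keys_iff)
  finally show "lookup (linext gen c) x = lookup c x" .
qed

lemma linext_add_fun:
  "linext (\<lambda>x. f x + g x) c = linext f c + linext g c"
  by (simp add: linext_def sum.distrib)

lemma linext_zero_fun [simp]: "linext (\<lambda>x. 0) c = 0"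
  by (simp add: linext_def)

lemma keys_linext_subset:
  assumes "\<And>x. x \<in> keys c \<Longrightarrow> keys (f x) \<subseteq> S"
  shows "keys (linext f c) \<subseteq> S"
  using keys_sum [of f "keys c"] assms by (force simp: linext_def)

section \<open>The augmented complex of point lists, induced maps and prisms\<close>

definition cone :: "'a \<Rightarrow> ('a list bit_chain) \<Rightarrow> ('a list bit_chain)" where
  "cone x = linext (\<lambda>l. gen (x # l))"

lemma cone_simps [simp]:
  "cone x 0 = 0" "cone x (gen l) = gen (x # l)" "cone x (c + d) = cone x c + cone x d"
  by (simp_all add: cone_def)

text \<open>The empty list is a simplex of dimension \<open>- 1\<close>, so this complex is augmented.\<close>

primrec list_bd :: "'a list \<Rightarrow> 'a list bit_chain" where
  "list_bd [] = 0"
| "list_bd (x # l) = gen l + cone x (list_bd l)"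

definition bd :: "('a list bit_chain) \<Rightarrow> ('a list bit_chain)" where
  "bd = linext list_bd"

lemma bd_simps [simp]: "bd 0 = 0" "bd (gen l) = list_bd l" "bd (c + d) = bd c + bd d"
  by (simp_all add: bd_def)

lemma bd_cone [simp]: "bd (cone x c) = c + cone x (bd c)"
proof -
  have "bd (cone x c) = linext (\<lambda>l. gen l + cone x (list_bd l)) c"
    by (simp add: bd_def cone_def linext_compose)
  also have "\<dots> = c + cone x (bd c)"
    by (simp add: linext_add_fun bd_def cone_def linext_compose)
  finally show ?thesis .
qed

lemma bd_list_bd [simp]: "bd (list_bd l) = 0"
  by (induction l) (simp_all)

lemma keys_cone_subset: "keys (cone x c) \<subseteq> (#) x ` keys c"
  unfolding cone_def by (rule keys_linext_subset) auto

lemma keys_list_bd_subset: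
  "keys (list_bd l) \<subseteq> {l'. Suc (length l') = length l \<and> set l' \<subseteq> set l}"
proof (induction l)
  case (Cons x l)
  have "keys (gen l) \<subseteq> {l'. Suc (length l') = length (x # l) \<and> set l' \<subseteq> set (x # l)}"
    by auto
  moreover have "keys (cone x (list_bd l)) \<subseteq> {l'. Suc (length l') = length (x # l) \<and> set l' \<subseteq> set (x # l)}"
    using keys_cone_subset [of x "list_bd l"] Cons by fastforce
  ultimately show ?case
    unfolding list_bd.simps by (rule keys_add_subset)
qed simp

definition push :: "('a \<Rightarrow> 'b) \<Rightarrow> ('a list bit_chain) \<Rightarrow> ('b list bit_chain)" where
  "push f = linext (\<lambda>l. gen (map f l))"

lemma push_simps [simp]:
  "push f 0 = 0" "push f (gen l) = gen (map f l)" "push f (c + d) = push f c + push f d"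
  by (simp_all add: push_def)

lemma push_cone: "push f (cone x c) = cone (f x) (push f c)"
  by (simp add: push_def cone_def linext_compose)

lemma push_push: "push f (push g c) = push (f \<circ> g) c"
  by (simp add: push_def linext_compose)

lemma bd_map: "list_bd (map f l) = push f (list_bd l)"
  by (induction l) (simp_all add: push_cone)

lemma bd_push: "bd (push f c) = push f (bd c)"
  by (simp add: bd_def push_def linext_compose bd_map [unfolded push_def])

lemma keys_push_subset: "keys (push f c) \<subseteq> map f ` keys c"
  unfolding push_def by (rule keys_linext_subset) auto

text \<open>The prism operator without signs: for a list x0, ..., xk it is the sum over i of the
  lists f x0, ..., f xi, g xi, ..., g xk. Splitting off the term i = 0 gives the recursion.\<close>

primrec list_prism :: "('a \<Rightarrow> 'b) \<Rightarrow> ('a \<Rightarrow> 'b) \<Rightarrow> 'a list \<Rightarrow> 'b list bit_chain" where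
  "list_prism f g [] = 0"
| "list_prism f g (x # l) = gen (f x # g x # map g l) + cone (f x) (list_prism f g l)"

definition prism :: "('a \<Rightarrow> 'b) \<Rightarrow> ('a \<Rightarrow> 'b) \<Rightarrow> ('a list bit_chain) \<Rightarrow> ('b list bit_chain)" where
  "prism f g = linext (list_prism f g)"

lemma prism_cone:
  "prism f g (cone x c) = cone (f x) (cone (g x) (push g c)) + cone (f x) (prism f g c)"
  by (simp add: prism_def cone_def push_def linext_compose linext_add_fun)

lemma bd_list_prism:
  "bd (list_prism f g l) = gen (map f l) + gen (map g l) + prism f g (list_bd l)"
proof (induction l)
  case (Cons x l)
  have [simp]: "prism f g (gen l) = list_prism f g l"
    by (simp add: prism_def)
  have [simp]: "prism f g (a + b) = prism f g a + prism f g b" for a b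
    by (simp add: prism_def)
  show ?case
    by (simp add: Cons prism_cone bd_map ac_simps)
qed (simp add: prism_def)

lemma bd_prism: "bd (prism f g c) = push f c + push g c + prism f g (bd c)"
proof -
  have "bd (prism f g c) = linext (\<lambda>l. bd (list_prism f g l)) c"
    by (simp add: bd_def prism_def linext_compose)
  also have "\<dots> = push f c + push g c + linext (\<lambda>l. prism f g (list_bd l)) c"
    by (simp add: bd_list_prism linext_add_fun push_def)
  also have "linext (\<lambda>l. prism f g (list_bd l)) c = prism f g (bd c)"
    by (simp add: bd_def prism_def linext_compose)
  finally show ?thesis .
qed

lemma keys_list_prism_subset:
  "keys (list_prism f g l) \<subseteq> {l'. length l' = Suc (length l) \<and> set l' \<subseteq> f ` set l \<union> g ` set l}"
proof (induction l)
  case (Cons x l)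
  let ?S = "{l'. length l' = Suc (length (x # l)) \<and> set l' \<subseteq> f ` set (x # l) \<union> g ` set (x # l)}"
  have "keys (gen (f x # g x # map g l)) \<subseteq> ?S"
    by auto
  moreover have "keys (cone (f x) (list_prism f g l)) \<subseteq> ?S"
    using keys_cone_subset [of "f x" "list_prism f g l"] Cons by fastforce
  ultimately show ?case
    unfolding list_prism.simps by (rule keys_add_subset)
qed simp

text \<open>For the colouring with black vertices \<open>E\<close>; the empty set is kept as a face.\<close>

definition face_bd :: "'v set \<Rightarrow> 'v set \<Rightarrow> 'v set bit_chain" where
  "face_bd E \<sigma> = (\<Sum>v\<in>\<sigma> \<inter> E. gen (\<sigma> - {v}))"

definition set_bd :: "'v set \<Rightarrow> ('v set bit_chain) \<Rightarrow> ('v set bit_chain)" where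
  "set_bd E = linext (face_bd E)"

lemma set_bd_simps [simp]:
  "set_bd E 0 = 0" "set_bd E (gen \<sigma>) = face_bd E \<sigma>" "set_bd E (c + d) = set_bd E c + set_bd E d"
  by (simp_all add: set_bd_def)

text \<open>A simplex already containing \<open>x\<close> goes to 0, in agreement with
  \<open>unordered\<close>, which kills the list with \<open>x\<close> repeated.\<close>

definition set_cone :: "'v \<Rightarrow> ('v set bit_chain) \<Rightarrow> ('v set bit_chain)" where
  "set_cone x = linext (\<lambda>\<sigma>. if x \<in> \<sigma> then 0 else gen (insert x \<sigma>))"

lemma set_cone_simps [simp]:
  "set_cone x 0 = 0" "set_cone x (gen \<sigma>) = (if x \<in> \<sigma> then 0 else gen (insert x \<sigma>))"
  "set_cone x (c + d) = set_cone x c + set_cone x d"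
  "set_cone x (\<Sum>i\<in>I. f i) = (\<Sum>i\<in>I. set_cone x (f i))"
  by (simp_all add: set_cone_def)

lemma face_bd_insert:
  assumes "finite \<sigma>" "x \<notin> \<sigma>"
  shows "face_bd E (insert x \<sigma>) = (if x \<in> E then gen \<sigma> else 0) + set_cone x (face_bd E \<sigma>)"
proof -
  have "(\<Sum>v\<in>\<sigma> \<inter> E. gen (insert x \<sigma> - {v})) = set_cone x (face_bd E \<sigma>)"
    unfolding face_bd_def set_cone_simps
    by (rule sum.cong) (use assms in \<open>auto simp: insert_Diff_if\<close>)
  then show ?thesis
    using assms by (simp add: face_bd_def)
qed

lemma set_cone_face_bd:
  assumes "finite \<sigma>" "x \<in> \<sigma>"
  shows "set_cone x (face_bd E \<sigma>) = (if x \<in> E then gen \<sigma> else 0)"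
proof -
  have "set_cone x (face_bd E \<sigma>) = (\<Sum>v\<in>\<sigma> \<inter> E. if v = x then gen \<sigma> else 0)"
    unfolding face_bd_def set_cone_simps
    by (rule sum.cong) (use assms in \<open>auto simp: insert_absorb\<close>)
  also have "\<dots> = (if x \<in> E then gen \<sigma> else 0)"
    using assms by simp
  finally show ?thesis .
qed

text \<open>On simplices without \<open>x\<close> this is the usual cone formula. A simplex
  containing \<open>x\<close> has cone 0, and on the right it cancels if \<open>x\<close> is black:
  the cone sends its face opposite \<open>x\<close> back to the simplex and all other faces to
  0.\<close>

lemma set_bd_set_cone:
  assumes "\<And>\<sigma>. \<sigma> \<in> keys c \<Longrightarrow> finite \<sigma>"
  shows "set_bd E (set_cone x c) = (if x \<in> E then c else 0) + set_cone x (set_bd E c)"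
proof -
  have "set_bd E (set_cone x c) =
      linext (\<lambda>\<sigma>. (if x \<in> E then gen \<sigma> else 0) + set_cone x (face_bd E \<sigma>)) c"
    unfolding set_cone_def [of x] set_bd_def linext_compose
    by (rule linext_cong)
       (use assms in \<open>auto simp: face_bd_insert set_cone_face_bd simp flip: set_cone_def\<close>)
  also have "\<dots> = (if x \<in> E then c else 0) + set_cone x (set_bd E c)"
    by (simp add: linext_add_fun set_bd_def set_cone_def linext_compose)
  finally show ?thesis .
qed

lemma keys_face_bd_subset: "keys (face_bd E \<sigma>) \<subseteq> (\<lambda>v. \<sigma> - {v}) ` (\<sigma> \<inter> E)"
  using keys_sum [of "\<lambda>v. gen (\<sigma> - {v})" "\<sigma> \<inter> E"] by (force simp: face_bd_def)

lemma keys_set_bd_subset: "keys (set_bd E c) \<subseteq> {\<sigma> - {v} |\<sigma> v. \<sigma> \<in> keys c \<and> v \<in> \<sigma> \<inter> E}"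
  unfolding set_bd_def
proof (rule keys_linext_subset)
  fix \<sigma> assume "\<sigma> \<in> keys c"
  show "keys (face_bd E \<sigma>) \<subseteq> {\<sigma> - {v} |\<sigma> v. \<sigma> \<in> keys c \<and> v \<in> \<sigma> \<inter> E}"
  proof
    fix \<tau> assume "\<tau> \<in> keys (face_bd E \<sigma>)"
    then obtain v where "v \<in> \<sigma> \<inter> E" "\<tau> = \<sigma> - {v}"
      using keys_face_bd_subset [of E \<sigma>] by blast
    then show "\<tau> \<in> {\<sigma> - {v} |\<sigma> v. \<sigma> \<in> keys c \<and> v \<in> \<sigma> \<inter> E}"
      using \<open>\<sigma> \<in> keys c\<close> by blast
  qed
qed

lemma set_bd_face_bd [simp]:
  assumes "finite \<sigma>"
  shows "set_bd E (face_bd E \<sigma>) = 0"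
  using assms
proof (induction \<sigma> rule: finite_induct)
  case empty
  then show ?case by (simp add: face_bd_def)
next
  case (insert x \<sigma>)
  have "finite \<tau>" if "\<tau> \<in> keys (face_bd E \<sigma>)" for \<tau>
    using that keys_face_bd_subset [of E \<sigma>] insert by auto
  then show ?case
    using insert by (simp add: face_bd_insert set_bd_set_cone)
qed

lemma set_bd_set_bd:
  assumes "\<And>\<sigma>. \<sigma> \<in> keys c \<Longrightarrow> finite \<sigma>"
  shows "set_bd E (set_bd E c) = 0"
proof -
  have "set_bd E (set_bd E c) = linext (\<lambda>\<sigma>. set_bd E (face_bd E \<sigma>)) c"
    by (simp add: set_bd_def linext_compose)
  also have "\<dots> = linext (\<lambda>\<sigma>. 0) c"
    by (rule linext_cong) (use assms in auto)
  finally show ?thesis by simp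
qed

text \<open>Lists with a repeated vertex go to 0. This is a chain map because the two faces omitting one copy
  of the repeated vertex cancel modulo 2.\<close>

definition unordered :: "('v list bit_chain) \<Rightarrow> ('v set bit_chain)" where
  "unordered = linext (\<lambda>l. if distinct l then gen (set l) else 0)"

lemma unordered_simps [simp]:
  "unordered 0 = 0" "unordered (gen l) = (if distinct l then gen (set l) else 0)"
  "unordered (c + d) = unordered c + unordered d"
  by (simp_all add: unordered_def)

lemma unordered_cone: "unordered (cone x c) = set_cone x (unordered c)"
  unfolding unordered_def cone_def set_cone_def linext_compose
  by (rule linext_cong) auto

lemma keys_unordered_subset: "keys (unordered c) \<subseteq> {set l |l. l \<in> keys c \<and> distinct l}"
  unfolding unordered_def by (rule keys_linext_subset) auto

lemma unordered_list_bd: "unordered (list_bd l) = set_bd UNIV (unordered (gen l))"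
proof (induction l)
  case Nil
  then show ?case by (simp add: face_bd_def)
next
  case (Cons x l)
  have "unordered (list_bd (x # l)) = unordered (gen l) + set_cone x (set_bd UNIV (unordered (gen l)))"
    by (simp only: list_bd.simps unordered_simps(3) unordered_cone Cons)
  also have "\<dots> = set_bd UNIV (set_cone x (unordered (gen l)))"
    by (subst set_bd_set_cone) (auto split: if_splits)
  also have "set_cone x (unordered (gen l)) = unordered (gen (x # l))"
    using unordered_cone [of x "gen l"] by simp
  finally show ?case .
qed

lemma set_bd_unordered: "set_bd UNIV (unordered c) = unordered (bd c)"
proof -
  have "unordered (bd c) = linext (\<lambda>l. unordered (list_bd l)) c"
    by (simp add: unordered_def bd_def linext_compose)
  also have "\<dots> = linext (\<lambda>l. set_bd UNIV (unordered (gen l))) c"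
    by (simp only: unordered_list_bd)
  also have "\<dots> = set_bd UNIV (unordered c)"
    by (simp add: unordered_def set_bd_def linext_compose)
  finally show ?thesis by simp
qed

section \<open>Fine chains in convex sets\<close>

definition l1_dist :: "'i set \<Rightarrow> ('i \<Rightarrow> real) \<Rightarrow> ('i \<Rightarrow> real) \<Rightarrow> real" where
  "l1_dist I x y = (\<Sum>i\<in>I. \<bar>x i - y i\<bar>)"

lemma l1_dist_nonneg: "0 \<le> l1_dist I x y"
  by (simp add: l1_dist_def sum_nonneg)

lemma l1_dist_commute: "l1_dist I x y = l1_dist I y x"
  by (simp add: l1_dist_def abs_minus_commute)

lemma l1_dist_triangle: "l1_dist I x z \<le> l1_dist I x y + l1_dist I y z"
  unfolding l1_dist_def sum.distrib [symmetric] by (intro sum_mono) linarith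

lemma abs_coord_le_l1_dist:
  assumes "finite I" "i \<in> I"
  shows "\<bar>x i - y i\<bar> \<le> l1_dist I x y"
  unfolding l1_dist_def using assms
  by (intro member_le_sum) auto

definition coord_convex :: "('i \<Rightarrow> real) set \<Rightarrow> bool" where
  "coord_convex C \<longleftrightarrow>
     (\<forall>x\<in>C. \<forall>y\<in>C. \<forall>t. 0 \<le> t \<and> t \<le> 1 \<longrightarrow> (\<lambda>i. (1 - t) * x i + t * y i) \<in> C)"

text \<open>The Vietoris simplices of size below \<open>e\<close>. The bound is strict so that each
  finite chain has slack; \<open>k\<close> counts entries, so it is the dimension plus 1.\<close>

definition fine_lists :: "'i set \<Rightarrow> real \<Rightarrow> ('i \<Rightarrow> real) set \<Rightarrow> nat \<Rightarrow> ('i \<Rightarrow> real) list set" where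
  "fine_lists I e C k =
     {l. length l = k \<and> set l \<subseteq> C \<and> (\<forall>x\<in>set l. \<forall>y\<in>set l. l1_dist I x y < e)}"

lemma bd_sum: "bd (\<Sum>j\<in>J. c j) = (\<Sum>j\<in>J. bd (c j))"
  by (simp add: bd_def)

lemma telescope_bit_chain:
  fixes g :: "nat \<Rightarrow> 'a bit_chain"
  shows "(\<Sum>j<n. g j + g (Suc j)) = g 0 + g n"
  by (induction n) (simp_all add: ac_simps)

text \<open>The straight-line contraction to a point is cut into steps so small that the prisms over them
  stay fine; no fineness is lost because a finite chain has slack.\<close>

lemma convex_acyclic:
  fixes C :: "('i \<Rightarrow> real) set"
  assumes conv: "coord_convex C" and p: "p \<in> C" and e: "0 < e"
    and z: "keys z \<subseteq> fine_lists I e C k" and cyc: "bd z = 0"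
  shows "\<exists>b. keys b \<subseteq> fine_lists I e C (Suc k) \<and> bd b = z"
proof -
  \<comment> \<open>The finitely many pairs of points occurring together in \<open>z\<close>. Each
    is strictly closer than \<open>e\<close>, so one \<open>h > 0\<close> leaves room in all of them
    for moving a point by the fraction \<open>h\<close> of its distance to \<open>p\<close>.\<close>
  let ?S = "\<Union>l\<in>keys z. set l \<times> set l"
  have S: "x \<in> C" "y \<in> C" "l1_dist I x y < e" if "(x, y) \<in> ?S" for x y
    using that z by (fastforce simp: fine_lists_def)+
  have "\<forall>\<^sub>F h in at_right 0. l1_dist I (fst s) (snd s) + h * l1_dist I (snd s) p < e"
    if "s \<in> ?S" for s
  proof -
    have "((\<lambda>h. l1_dist I (fst s) (snd s) + h * l1_dist I (snd s) p) \<longlongrightarrow>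
        l1_dist I (fst s) (snd s) + 0 * l1_dist I (snd s) p) (at_right 0)"
      by (intro tendsto_intros)
    then show ?thesis
      by (rule order_tendstoD) (use S [of "fst s" "snd s"] that in simp)
  qed
  then have "\<forall>\<^sub>F h in at_right 0. \<forall>s\<in>?S. l1_dist I (fst s) (snd s) + h * l1_dist I (snd s) p < e"
    by (intro eventually_ball_finite) auto
  then obtain b where b: "b > 0"
    "\<And>h s. 0 < h \<Longrightarrow> h < b \<Longrightarrow> s \<in> ?S \<Longrightarrow> l1_dist I (fst s) (snd s) + h * l1_dist I (snd s) p < e"
    unfolding eventually_at_right_field by blast
  obtain m where m: "inverse (real (Suc m)) < b"
    using reals_Archimedean [OF b(1)] by blast
  define N where "N = Suc m"
  have N: "N > 0" "1 / real N < b"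
    using m by (simp_all add: N_def divide_inverse)
  have small: "l1_dist I x y + l1_dist I y p / N < e" if "(x, y) \<in> ?S" for x y
    using b(2) [of "1 / N" "(x, y)"] N that by simp
  define f where "f j x = (\<lambda>i. (1 - real j / N) * x i + (real j / N) * p i)" for j x
  have fC: "f j x \<in> C" if "x \<in> C" "j \<le> N" for j x
  proof -
    have "0 \<le> real j / N" "real j / N \<le> 1"
      using that N by auto
    then show ?thesis
      using conv p that(1) unfolding coord_convex_def f_def by blast
  qed
  have d1: "l1_dist I (f j x) (f j y) \<le> l1_dist I x y" if "j \<le> N" for j x y
  proof -
    have "l1_dist I (f j x) (f j y) = (\<Sum>i\<in>I. (1 - real j / N) * \<bar>x i - y i\<bar>)"
      unfolding l1_dist_def
    proof (intro sum.cong refl)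
      fix i
      have "f j x i - f j y i = (1 - real j / N) * (x i - y i)"
        by (simp add: f_def algebra_simps diff_divide_distrib)
      then show "\<bar>f j x i - f j y i\<bar> = (1 - real j / N) * \<bar>x i - y i\<bar>"
        using that N by (simp add: abs_mult)
    qed
    also have "\<dots> \<le> (\<Sum>i\<in>I. \<bar>x i - y i\<bar>)"
      by (intro sum_mono mult_left_le_one_le) (use that N in auto)
    finally show ?thesis by (simp add: l1_dist_def)
  qed
  have d2: "l1_dist I (f j y) (f (Suc j) y) = l1_dist I y p / N" for j y
  proof -
    have "\<bar>f j y i - f (Suc j) y i\<bar> = \<bar>y i - p i\<bar> / N" for i
    proof -
      have "f j y i - f (Suc j) y i = (y i - p i) / N"
        using N by (simp add: f_def field_simps)
      then show ?thesis by simp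
    qed
    then show ?thesis by (simp add: l1_dist_def sum_divide_distrib)
  qed
  have d3: "l1_dist I (f j x) (f (Suc j) y) < e" if "(x, y) \<in> ?S" "j < N" for j x y
    using l1_dist_triangle [of I "f j x" "f (Suc j) y" "f j y"] d1 [of j x y] d2 [of j y]
      small [OF that(1)] that(2) by simp
  have d4: "l1_dist I (f j x) (f j y) < e" if "(x, y) \<in> ?S" "j \<le> N" for j x y
    using d1 [OF that(2), of x y] S(3) [OF that(1)] by simp
  have pr: "keys (prism (f j) (f (Suc j)) z) \<subseteq> fine_lists I e C (Suc k)" if j: "j < N" for j
    unfolding prism_def
  proof (rule keys_linext_subset)
    fix l assume l: "l \<in> keys z"
    have ll: "length l = k" using l z by (auto simp: fine_lists_def)
    have inS: "(x, y) \<in> ?S" if "x \<in> set l" "y \<in> set l" for x y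
      using that l by blast
    have pairs: "l1_dist I a c < e" if "a \<in> f j ` set l \<union> f (Suc j) ` set l"
      "c \<in> f j ` set l \<union> f (Suc j) ` set l" for a c
    proof -
      obtain x y where xy: "x \<in> set l" "y \<in> set l" and
        "a = f j x \<or> a = f (Suc j) x" "c = f j y \<or> c = f (Suc j) y"
        using \<open>a \<in> _\<close> \<open>c \<in> _\<close> by blast
      then show ?thesis
        using d3 [OF inS [OF xy] j] d3 [OF inS [OF xy(2,1)] j] d4 [OF inS [OF xy], of j]
          d4 [OF inS [OF xy], of "Suc j"] j
        by (auto simp: l1_dist_commute)
    qed
    have inC: "f j ` set l \<union> f (Suc j) ` set l \<subseteq> C"
    proof -
      have "set l \<subseteq> C" using l z by (auto simp: fine_lists_def)
      then show ?thesis using j by (auto intro!: fC)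
    qed
    show "keys (list_prism (f j) (f (Suc j)) l) \<subseteq> fine_lists I e C (Suc k)"
    proof
      fix l' assume "l' \<in> keys (list_prism (f j) (f (Suc j)) l)"
      then have l': "length l' = Suc k" "set l' \<subseteq> f j ` set l \<union> f (Suc j) ` set l"
        using keys_list_prism_subset [of "f j" "f (Suc j)" l] ll by auto
      have "l1_dist I a c < e" if "a \<in> set l'" "c \<in> set l'" for a c
        by (rule pairs) (use that l'(2) in auto)
      moreover have "set l' \<subseteq> C"
        using l'(2) inC by (rule subset_trans)
      ultimately show "l' \<in> fine_lists I e C (Suc k)"
        unfolding fine_lists_def using l'(1) by simp
    qed
  qed
  define b1 where "b1 = (\<Sum>j<N. prism (f j) (f (Suc j)) z)"
  have f0: "f 0 = id" and fN: "f N = (\<lambda>_. p)"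
    using N by (auto simp: f_def fun_eq_iff)
  have [simp]: "push id z = z"
    by (simp add: push_def)
  have "bd b1 = (\<Sum>j<N. push (f j) z + push (f (Suc j)) z)"
    by (simp add: b1_def bd_sum bd_prism cyc) (simp add: prism_def)
  also have "\<dots> = z + push (f N) z"
    using telescope_bit_chain [of "\<lambda>j. push (f j) z" N] by (simp add: f0)
  finally have b1: "bd b1 = z + push (f N) z" .
  have kb1: "keys b1 \<subseteq> fine_lists I e C (Suc k)"
    unfolding b1_def using keys_sum [of "\<lambda>j. prism (f j) (f (Suc j)) z" "{..<N}"] pr by blast
  \<comment> \<open>At the last stage every point has become \<open>p\<close>. The remaining cycle
    consists of constant lists and is coned off from \<open>p\<close>; the cone is fine because
    \<open>e\<close> is positive.\<close>
  define b2 where "b2 = cone p (push (f N) z)"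
  have "bd b2 = push (f N) z"
    by (simp add: b2_def bd_push cyc)
  then have "bd (b1 + b2) = z"
    by (simp add: b1 ac_simps)
  moreover have "keys b2 \<subseteq> fine_lists I e C (Suc k)"
  proof
    fix l' assume "l' \<in> keys b2"
    then obtain l where "l \<in> keys z" "l' = p # map (f N) l"
      using keys_cone_subset [of p "push (f N) z"] keys_push_subset [of "f N" z]
      unfolding b2_def by blast
    then show "l' \<in> fine_lists I e C (Suc k)"
      using z p e by (auto simp: fine_lists_def fN l1_dist_def)
  qed
  ultimately show ?thesis
    using keys_add_subset [OF kb1] by blast
qed

text \<open>The method of acyclic carriers: degree by degree,
  \<open>T x + linext G (\<beta> x)\<close> is a cycle in \<open>Q x\<close> and is filled inside
  \<open>P x\<close>. With \<open>T = 0\<close> this constructs chain maps; with \<open>T\<close>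
  the sum of two chain maps it constructs a homotopy between them. The carriers \<open>P\<close> and
  \<open>Q\<close> are separate because the lists of a filling have one entry more than those of the
  cycle.\<close>

lemma acyclic_carrier:
  fixes B :: "'b set" and deg :: "'b \<Rightarrow> nat" and \<beta> :: "'b \<Rightarrow> 'b bit_chain"
    and T :: "'b \<Rightarrow> 'a list bit_chain" and P Q :: "'b \<Rightarrow> 'a list set"
  assumes face: "\<And>x y. x \<in> B \<Longrightarrow> y \<in> keys (\<beta> x) \<Longrightarrow> y \<in> B \<and> Suc (deg y) = deg x \<and> P y \<subseteq> Q x"
    and T: "\<And>x. x \<in> B \<Longrightarrow> keys (T x) \<subseteq> Q x"
    and bdT: "\<And>x. x \<in> B \<Longrightarrow> bd (T x) = linext T (\<beta> x)"
    and \<beta>\<beta>: "\<And>x. x \<in> B \<Longrightarrow> linext \<beta> (\<beta> x) = 0"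
    and base: "\<And>x. x \<in> B \<Longrightarrow> deg x = 0 \<Longrightarrow> \<beta> x = 0 \<and> T x = 0 \<and> keys g\<^sub>0 \<subseteq> P x" "bd g\<^sub>0 = 0"
    and acyc: "\<And>x z. x \<in> B \<Longrightarrow> 0 < deg x \<Longrightarrow> keys z \<subseteq> Q x \<Longrightarrow> bd z = 0 \<Longrightarrow>
      \<exists>b. keys b \<subseteq> P x \<and> bd b = z"
  shows "\<exists>G. \<forall>x\<in>B. keys (G x) \<subseteq> P x \<and> bd (G x) = T x + linext G (\<beta> x) \<and>
    (deg x = 0 \<longrightarrow> G x = g\<^sub>0)"
proof -
  \<comment> \<open>Recursion on the degree: \<open>H k\<close> is meaningful only on elements of
    degree \<open>k\<close>, and \<open>G\<close> selects the stage by the degree of its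
    argument.\<close>
  define H where "H = rec_nat (\<lambda>x. g\<^sub>0)
    (\<lambda>k h x. SOME b. keys b \<subseteq> P x \<and> bd b = T x + linext h (\<beta> x))"
  have H_Suc: "H (Suc k) x =
    (SOME b. keys b \<subseteq> P x \<and> bd b = T x + linext (H k) (\<beta> x))" for k x
    by (simp add: H_def)
  define G where "G x = H (deg x) x" for x
  have "keys (G x) \<subseteq> P x \<and> bd (G x) = T x + linext G (\<beta> x) \<and> (deg x = 0 \<longrightarrow> G x = g\<^sub>0)"
    if "x \<in> B" for x
    using that
  proof (induction "deg x" arbitrary: x)
    case 0
    have "G x = g\<^sub>0" by (simp add: G_def H_def 0(1) [symmetric])
    moreover have "\<beta> x = 0 \<and> T x = 0 \<and> keys g\<^sub>0 \<subseteq> P x"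
      using base(1) [OF 0(2)] 0(1) by simp
    ultimately show ?case using base(2) by simp
  next
    case (Suc k)
    have eq: "linext (H k) (\<beta> x) = linext G (\<beta> x)"
    proof (rule linext_cong)
      fix y assume "y \<in> keys (\<beta> x)"
      then have "deg y = k" using face [OF Suc.prems] Suc.hyps(2) by fastforce
      then show "H k y = G y" by (simp add: G_def)
    qed
    have IH: "keys (G y) \<subseteq> P y" "bd (G y) = T y + linext G (\<beta> y)" if "y \<in> keys (\<beta> x)" for y
      using Suc.hyps face [OF Suc.prems that] by auto
    have "keys (linext G (\<beta> x)) \<subseteq> Q x"
      by (rule keys_linext_subset) (use IH(1) face [OF Suc.prems] in blast)
    then have k: "keys (T x + linext G (\<beta> x)) \<subseteq> Q x"
      using T [OF Suc.prems] by (rule keys_add_subset [rotated])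
    have "bd (linext G (\<beta> x)) = linext (\<lambda>y. bd (G y)) (\<beta> x)"
      by (simp add: bd_def linext_compose)
    also have "\<dots> = linext (\<lambda>y. T y + linext G (\<beta> y)) (\<beta> x)"
      by (rule linext_cong) (rule IH)
    also have "\<dots> = linext T (\<beta> x) + linext G (linext \<beta> (\<beta> x))"
      by (simp add: linext_add_fun linext_compose)
    also have "\<dots> = linext T (\<beta> x)"
      using \<beta>\<beta> [OF Suc.prems] by simp
    finally have "bd (T x + linext G (\<beta> x)) = 0"
      using bdT [OF Suc.prems] by simp
    then have "\<exists>b. keys b \<subseteq> P x \<and> bd b = T x + linext G (\<beta> x)"
      using acyc [OF Suc.prems _ k] Suc.hyps(2) by simp
    then have "keys (H (Suc k) x) \<subseteq> P x \<and> bd (H (Suc k) x) = T x + linext G (\<beta> x)"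
      unfolding H_Suc eq by (rule someI_ex)
    then show ?case
      using Suc.hyps(2) by (simp add: G_def)
  qed
  then show ?thesis by blast
qed

section \<open>Geometric simplices and nearest vertices\<close>

text \<open>Empty when \<open>\<tau>\<close> is empty or infinite, since the sum is then 0.
  Finiteness of the vertex set is recovered from a member in this way.\<close>

definition geom_simplex :: "'v set \<Rightarrow> ('v \<Rightarrow> real) set" where
  "geom_simplex \<tau> = {y. (\<forall>v. 0 \<le> y v) \<and> (\<forall>v. v \<notin> \<tau> \<longrightarrow> y v = 0) \<and> (\<Sum>v\<in>\<tau>. y v) = 1}"

lemma geom_simplex_subset_iff:
  assumes "finite V" "\<tau> \<subseteq> V"
  shows "y \<in> geom_simplex \<tau> \<longleftrightarrow> y \<in> geom_simplex V \<and> {v. y v \<noteq> 0} \<subseteq> \<tau>"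
proof (cases "{v. y v \<noteq> 0} \<subseteq> \<tau>")
  case True
  then have "(\<Sum>v\<in>\<tau>. y v) = (\<Sum>v\<in>V. y v)"
    using assms by (intro sum.mono_neutral_left) auto
  then show ?thesis
    using True assms by (auto simp: geom_simplex_def)
qed (use assms in \<open>auto simp: geom_simplex_def\<close>)

lemma geom_simplex_mono: "finite V \<Longrightarrow> \<tau> \<subseteq> V \<Longrightarrow> geom_simplex \<tau> \<subseteq> geom_simplex V"
  using geom_simplex_subset_iff by blast

lemma coord_convex_geom_simplex: "coord_convex (geom_simplex \<tau>)"
  by (auto simp: coord_convex_def geom_simplex_def sum.distrib simp flip: sum_distrib_left)

lemma vertex_in_geom_simplex:
  assumes "finite \<tau>" "v \<in> \<tau>"
  shows "(\<lambda>u. if u = v then 1 else 0) \<in> geom_simplex \<tau>"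
  using assms by (auto simp: geom_simplex_def)

section \<open>Simplicial approximation by near vertices\<close>

definition near_vertex :: "'v set \<Rightarrow> ('v \<Rightarrow> real) \<Rightarrow> 'v" where
  "near_vertex V y = (SOME v. v \<in> V \<and> 1 / card V \<le> y v)"

text \<open>The coordinates cannot all lie below their average \<open>1 / card V\<close>. The choice
  among the vertices reaching it is arbitrary; what matters is the uniform lower bound, which a
  nearby point cannot undercut down to 0.\<close>

lemma near_vertex:
  assumes "y \<in> geom_simplex V"
  shows "near_vertex V y \<in> V" "1 / card V \<le> y (near_vertex V y)" "0 < y (near_vertex V y)"
proof -
  have V: "finite V" "V \<noteq> {}"
    using assms by (auto simp: geom_simplex_def intro: ccontr)
  have "\<exists>v. v \<in> V \<and> 1 / card V \<le> y v"
  proof (rule ccontr)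
    assume "\<not> ?thesis"
    then have "(\<Sum>v\<in>V. y v) < (\<Sum>v\<in>V. 1 / card V)"
      using V by (intro sum_strict_mono) (auto simp: not_le)
    then show False using assms V by (simp add: geom_simplex_def)
  qed
  then have "near_vertex V y \<in> V \<and> 1 / card V \<le> y (near_vertex V y)"
    unfolding near_vertex_def by (rule someI_ex)
  moreover have "0 < 1 / real (card V)"
    using V by (simp add: card_gt_0_iff)
  ultimately show "near_vertex V y \<in> V" "1 / card V \<le> y (near_vertex V y)" "0 < y (near_vertex V y)"
    by linarith+
qed

text \<open>Hence the near vertices of a list of points at mutual distance below \<open>1 / card V\<close> all lie in the
  support of each of these points.\<close>

lemma near_vertex_support:
  assumes "y \<in> geom_simplex V" "y' \<in> geom_simplex V" "l1_dist V y y' < 1 / card V"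
  shows "y (near_vertex V y') \<noteq> 0"
proof -
  have "finite V"
    using assms(1) by (auto simp: geom_simplex_def intro: ccontr)
  then show ?thesis
    using abs_coord_le_l1_dist [of V "near_vertex V y'" y y'] near_vertex [OF assms(2)] assms(3)
    by auto
qed

definition vertex_chain :: "'v set \<Rightarrow> (('v \<Rightarrow> real) list bit_chain) \<Rightarrow> ('v set bit_chain)" where
  "vertex_chain V c = unordered (push (near_vertex V) c)"

lemma vertex_chain_simps [simp]:
  "vertex_chain V 0 = 0" "vertex_chain V (c + d) = vertex_chain V c + vertex_chain V d"
  by (simp_all add: vertex_chain_def)

lemma set_bd_vertex_chain: "set_bd UNIV (vertex_chain V c) = vertex_chain V (bd c)"
  by (simp add: vertex_chain_def set_bd_unordered bd_push)

lemma keys_vertex_chain: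
  assumes "\<rho> \<in> keys (vertex_chain V c)"
  obtains l where "l \<in> keys c" "\<rho> = near_vertex V ` set l" "card \<rho> = length l"
proof -
  obtain l' where "l' \<in> keys (push (near_vertex V) c)" "\<rho> = set l'" "distinct l'"
    using assms keys_unordered_subset unfolding vertex_chain_def by blast
  moreover then obtain l where "l \<in> keys c" "l' = map (near_vertex V) l"
    using keys_push_subset by blast
  ultimately show thesis
    using that by (metis distinct_card length_map list.set_map)
qed

lemma vertex_chain_linext:
  "vertex_chain V (linext D c) = linext (\<lambda>x. vertex_chain V (D x)) c"
  by (simp add: vertex_chain_def unordered_def push_def linext_compose)

lemma push_linext:
  "push f (linext D c) = linext (\<lambda>x. push f (D x)) c"
  by (simp add: push_def linext_compose)

lemma bd_linext:
  "bd (linext D c) = linext (\<lambda>x. bd (D x)) c"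
  by (simp add: bd_def linext_compose)

text \<open>Chain maps of this kind replace iterated barycentric subdivision.\<close>

definition subdivides :: "'v set \<Rightarrow> real \<Rightarrow> ('v set \<Rightarrow> ('v \<Rightarrow> real) list bit_chain) \<Rightarrow> bool" where
  "subdivides V e D \<longleftrightarrow> D {} = gen [] \<and>
     (\<forall>\<tau>\<subseteq>V. keys (D \<tau>) \<subseteq> fine_lists V e (geom_simplex \<tau>) (card \<tau>) \<and>
       bd (D \<tau>) = linext D (face_bd UNIV \<tau>))"

text \<open>Acyclic carriers with \<open>T = 0\<close>, graded by cardinality: the closed simplex on
  a nonempty face is convex, so the refined boundary of the face bounds a fine chain in it. The
  value \<open>gen []\<close> on the empty face is the normalization from which all multiplicities
  follow.\<close>

lemma ex_subdivides:
  fixes V :: "'v set"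
  assumes V: "finite V" and e: "0 < e"
  shows "\<exists>D. subdivides V e D"
proof -
  let ?P = "\<lambda>\<tau>. fine_lists V e (geom_simplex \<tau>) (card \<tau>)"
  let ?Q = "\<lambda>\<tau>. fine_lists V e (geom_simplex \<tau>) (card \<tau> - 1)"
  have "\<exists>D. \<forall>\<tau>\<in>Pow V. keys (D \<tau>) \<subseteq> ?P \<tau> \<and> bd (D \<tau>) = 0 + linext D (face_bd UNIV \<tau>) \<and>
      (card \<tau> = 0 \<longrightarrow> D \<tau> = gen [])"
  proof (rule acyclic_carrier [where Q = ?Q and T = "\<lambda>_. 0"])
    fix \<tau> \<rho> assume \<tau>: "\<tau> \<in> Pow V" and \<rho>: "\<rho> \<in> keys (face_bd UNIV \<tau>)"
    obtain v where v: "v \<in> \<tau>" "\<rho> = \<tau> - {v}"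
      using \<rho> keys_face_bd_subset [of UNIV \<tau>] by auto
    have fin: "finite \<tau>" using \<tau> V finite_subset by auto
    then have "Suc (card \<rho>) = card \<tau>"
      using v by (metis card_Suc_Diff1)
    moreover have "geom_simplex \<rho> \<subseteq> geom_simplex \<tau>"
      using v fin by (intro geom_simplex_mono) auto
    ultimately show "\<rho> \<in> Pow V \<and> Suc (card \<rho>) = card \<tau> \<and> ?P \<rho> \<subseteq> ?Q \<tau>"
      using v \<tau> by (auto simp: fine_lists_def)
  next
    fix \<tau> assume "\<tau> \<in> Pow V"
    then have "finite \<tau>" using V finite_subset by auto
    then show "linext (face_bd UNIV) (face_bd UNIV \<tau>) = 0"
      using set_bd_face_bd [of \<tau> UNIV] by (simp add: set_bd_def)
  next
    fix \<tau> assume "\<tau> \<in> Pow V" "card \<tau> = 0"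
    then have "\<tau> = {}" using V finite_subset by (metis PowD card_0_eq)
    then show "face_bd UNIV \<tau> = 0 \<and> 0 = (0 :: ('v \<Rightarrow> real) list bit_chain) \<and> keys (gen []) \<subseteq> ?P \<tau>"
      by (auto simp: face_bd_def fine_lists_def)
  next
    fix \<tau> and z :: "('v \<Rightarrow> real) list bit_chain"
    assume \<tau>: "\<tau> \<in> Pow V" "0 < card \<tau>" and z: "keys z \<subseteq> ?Q \<tau>" "bd z = 0"
    then obtain v where v: "v \<in> \<tau>" "finite \<tau>"
      by (metis card_gt_0_iff ex_in_conv)
    show "\<exists>b. keys b \<subseteq> ?P \<tau> \<and> bd b = z"
      using convex_acyclic [OF coord_convex_geom_simplex vertex_in_geom_simplex [OF v(2,1)] e z] \<tau>
      by simp
  qed auto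
  then show ?thesis
    using V unfolding subdivides_def by (metis Pow_iff add_0 card.empty empty_subsetI)
qed

text \<open>Sperner's lemma in chain form, by induction on dimension. Near vertices of points of the
  simplex on \<open>\<tau>\<close> lie in \<open>\<tau>\<close>, so no other simplex can occur; and
  \<open>\<tau>\<close> does occur, because the boundary of the chain is by induction that of
  \<open>\<tau>\<close>, which is not 0. The map \<open>f\<close> is later the composite of
  \<open>p\<close> and \<open>q\<close>.\<close>

lemma vertex_chain_subdivides:
  fixes V :: "'v set"
  assumes V: "finite V" and D: "subdivides V e D"
    and \<T>: "\<And>\<tau>. \<tau> \<in> \<T> \<Longrightarrow> \<tau> \<subseteq> V" "\<And>\<tau> \<rho>. \<tau> \<in> \<T> \<Longrightarrow> \<rho> \<subseteq> \<tau> \<Longrightarrow> \<rho> \<in> \<T>"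
    and f: "\<And>\<tau>. \<tau> \<in> \<T> \<Longrightarrow> f ` geom_simplex \<tau> \<subseteq> geom_simplex \<tau>"
    and \<tau>: "\<tau> \<in> \<T>"
  shows "vertex_chain V (push f (D \<tau>)) = gen \<tau>"
  using \<tau>
proof (induction "card \<tau>" arbitrary: \<tau>)
  case 0
  then have "\<tau> = {}" using V \<T>(1) finite_subset by (metis card_0_eq)
  then show ?case using D by (simp add: subdivides_def vertex_chain_def)
next
  case (Suc k)
  let ?c = "vertex_chain V (push f (D \<tau>))"
  have \<tau>V: "\<tau> \<subseteq> V" and fin: "finite \<tau>" using Suc.prems \<T>(1) V finite_subset by blast+
  have "keys ?c \<subseteq> {\<tau>}"
  proof
    fix \<rho> assume "\<rho> \<in> keys ?c"
    then obtain l' where l': "l' \<in> keys (push f (D \<tau>))" "\<rho> = near_vertex V ` set l'" "card \<rho> = length l'"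
      by (rule keys_vertex_chain)
    then obtain l where l: "l \<in> keys (D \<tau>)" "l' = map f l"
      using keys_push_subset by blast
    then have l2: "length l = card \<tau>" "set l \<subseteq> geom_simplex \<tau>"
      using D \<tau>V by (auto simp: subdivides_def fine_lists_def)
    have "near_vertex V y \<in> \<tau>" if "y \<in> geom_simplex \<tau>" for y
    proof -
      have "0 < y (near_vertex V y)"
        using near_vertex(3) that geom_simplex_mono [OF V \<tau>V] by blast
      then show ?thesis
        using that unfolding geom_simplex_def by (metis (mono_tags, lifting) less_irrefl mem_Collect_eq)
    qed
    then have "\<rho> \<subseteq> \<tau>"
      using l' l l2 f [OF Suc.prems] by auto
    then show "\<rho> \<in> {\<tau>}"
      using l' l l2 fin by (simp add: card_subset_eq)
  qed
  moreover have "?c \<noteq> 0"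
  proof
    assume "?c = 0"
    then have "vertex_chain V (push f (bd (D \<tau>))) = 0"
      using set_bd_vertex_chain [of V "push f (D \<tau>)"] by (simp add: bd_push)
    moreover have "vertex_chain V (push f (bd (D \<tau>))) =
        linext (\<lambda>\<rho>. vertex_chain V (push f (D \<rho>))) (face_bd UNIV \<tau>)"
      using D \<tau>V by (simp add: subdivides_def push_linext vertex_chain_linext)
    moreover have "\<dots> = linext gen (face_bd UNIV \<tau>)"
    proof (rule linext_cong)
      fix \<rho> assume "\<rho> \<in> keys (face_bd UNIV \<tau>)"
      then obtain v where v: "v \<in> \<tau>" "\<rho> = \<tau> - {v}"
        using keys_face_bd_subset [of UNIV \<tau>] by auto
      then have "card \<rho> = k" using Suc.hyps(2) fin by (simp add: card_Diff_singleton)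
      moreover have "\<rho> \<in> \<T>" using v \<T>(2) Suc.prems by blast
      ultimately show "vertex_chain V (push f (D \<rho>)) = gen \<rho>"
        using Suc.hyps(1) by blast
    qed
    ultimately have *: "face_bd UNIV \<tau> = 0" by simp
    obtain v where v: "v \<in> \<tau>" using Suc.hyps(2) by fastforce
    have "lookup (face_bd UNIV \<tau>) (\<tau> - {v}) = (\<Sum>u\<in>\<tau>. if u = v then 1 else 0)"
      unfolding face_bd_def lookup_sum
      by (intro sum.cong) (use v in \<open>auto simp: lookup_single when_def\<close>)
    also have "\<dots> = 1" using v fin by simp
    finally show False using * by simp
  qed
  ultimately have "keys ?c = {\<tau>}"
    by (metis keys_eq_empty subset_singletonD)
  then have "?c = linext gen ?c" "linext gen ?c = gen \<tau>"
    by (simp, simp only: linext_def) simp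
  then show ?case by simp
qed

section \<open>Comparison with the local homology of a geometric simplex\<close>

text \<open>For \<open>\<sigma>\<close> in \<open>X\<close> this contains the empty set, as
  augmented chains require. Its members not containing \<open>\<sigma>\<close> form the part
  relative to which local homology is taken.\<close>

definition star_closed :: "'v set set \<Rightarrow> 'v set \<Rightarrow> 'v set set" where
  "star_closed X \<sigma> = {\<tau>. \<tau> \<union> \<sigma> \<in> X}"

lemma keys_vertex_chain_push:
  assumes "\<rho> \<in> keys (vertex_chain V (push q c))"
  obtains l where "l \<in> keys c" "\<rho> = near_vertex V ` q ` set l" "card \<rho> = length l"
proof -
  obtain l' where l': "l' \<in> keys (push q c)" "\<rho> = near_vertex V ` set l'" "card \<rho> = length l'"
    using assms by (rule keys_vertex_chain)
  then obtain l where "l \<in> keys c" "l' = map q l"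
    using keys_push_subset [of q c] by blast
  then show thesis
    using that l' by simp
qed

lemma keys_linextE:
  assumes "y \<in> keys (linext f c)"
  obtains x where "x \<in> keys c" "y \<in> keys (f x)"
  using assms keys_linext_subset [of c f "\<Union>x\<in>keys c. keys (f x)"] by blast

lemma subdividesD:
  assumes "subdivides V e D" "\<tau> \<subseteq> V"
  shows "l \<in> keys (D \<tau>) \<Longrightarrow> l \<in> fine_lists V e (geom_simplex \<tau>) (card \<tau>)"
    and "bd (D \<tau>) = linext D (face_bd UNIV \<tau>)"
  using assms unfolding subdivides_def by blast+

text \<open>An upper bound on local homology at \<open>\<sigma>\<close> in terms of chains, where
  \<open>b\<close> is a filling modulo simplices not containing \<open>\<sigma>\<close>: every local
  cycle is filled in degrees other than \<open>n\<close>, and \<open>\<Lambda>\<close> is injective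
  on classes in degree \<open>n\<close>. It is not claimed to be onto.\<close>

definition local_functional ::
  "'v set set \<Rightarrow> nat \<Rightarrow> 'v set \<Rightarrow> (('v set bit_chain) \<Rightarrow> bit) \<Rightarrow> bool" where
  "local_functional X n \<sigma> \<Lambda> \<longleftrightarrow> (\<forall>a b. \<Lambda> (a + b) = \<Lambda> a + \<Lambda> b) \<and>
    (\<forall>k c. keys c \<subseteq> {\<tau> \<in> star_closed X \<sigma>. card \<tau> = Suc k} \<longrightarrow>
      (\<forall>\<rho>\<in>keys (set_bd UNIV c). \<not> \<sigma> \<subseteq> \<rho>) \<longrightarrow> (k = n \<longrightarrow> \<Lambda> c = 0) \<longrightarrow>
      (\<exists>b. keys b \<subseteq> {\<tau> \<in> X. card \<tau> = Suc (Suc k)} \<and> (\<forall>\<rho>\<in>keys (c + set_bd UNIV b). \<not> \<sigma> \<subseteq> \<rho>)))"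

text \<open>\<open>p\<close> and \<open>q\<close> compare the star of \<open>\<sigma>\<close>, relative to its part avoiding \<open>\<sigma>\<close>, with the
  standard \<open>n\<close>-simplex relative to the complement of its barycentre. A local cycle \<open>c\<close> is
  refined, pushed by \<open>p\<close>, compared there with a refined simplicial chain of the standard simplex
  along the convex carriers \<open>C\<close>, and pushed back by \<open>q\<close>. The functional \<open>\<Lambda>\<close> is
  the coefficient at the \<open>n\<close>-simplex itself.\<close>

lemma local_functional_of_comparison:
  fixes X :: "'v set set" and p :: "('v \<Rightarrow> real) \<Rightarrow> nat \<Rightarrow> real" and q :: "(nat \<Rightarrow> real) \<Rightarrow> 'v \<Rightarrow> real"
  assumes X: "finite_complex X" and V: "V = vertices X" and \<sigma>: "\<sigma> \<in> X"
    and p: "\<And>\<tau> y. \<tau> \<in> star_closed X \<sigma> \<Longrightarrow> y \<in> geom_simplex \<tau> \<Longrightarrow> p y \<in> geom_simplex {..n}"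
    and q: "\<And>z. z \<in> geom_simplex {..n} \<Longrightarrow> q z \<in> geom_simplex V \<and> {v. q z v \<noteq> 0} \<in> X"
    and pcont: "\<And>e. 0 < e \<Longrightarrow> \<exists>d>0. \<forall>\<tau>\<in>star_closed X \<sigma>. \<forall>y\<in>geom_simplex \<tau>. \<forall>y'\<in>geom_simplex \<tau>.
      l1_dist V y y' < d \<longrightarrow> l1_dist {..n} (p y) (p y') < e"
    and qcont: "\<And>e. 0 < e \<Longrightarrow> \<exists>d>0. \<forall>z\<in>geom_simplex {..n}. \<forall>z'\<in>geom_simplex {..n}.
      l1_dist {..n} z z' < d \<longrightarrow> l1_dist V (q z) (q z') < e"
    and qp: "\<And>\<tau> y. \<tau> \<in> star_closed X \<sigma> \<Longrightarrow> y \<in> geom_simplex \<tau> \<Longrightarrow> {v. q (p y) v \<noteq> 0} \<subseteq> \<tau>"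
    and pout: "\<And>\<tau> y. \<tau> \<in> star_closed X \<sigma> \<Longrightarrow> \<not> \<sigma> \<subseteq> \<tau> \<Longrightarrow> y \<in> geom_simplex \<tau> \<Longrightarrow> \<exists>i\<le>n. p y i \<le> d\<^sub>1"
    and qout: "\<And>z i. z \<in> geom_simplex {..n} \<Longrightarrow> i \<le> n \<Longrightarrow> z i < d\<^sub>0 \<Longrightarrow> \<exists>v\<in>\<sigma>. q z v = 0"
    and d: "d\<^sub>1 < d\<^sub>0" "d\<^sub>0 < 1 / (real n + 1)" "0 < d\<^sub>0"
  shows "\<exists>\<Lambda>. local_functional X n \<sigma> \<Lambda>"
proof -
  let ?m = "1 / real (card V)"
  let ?N = "{..n}" let ?\<Delta> = "geom_simplex {..n}"
  have XV: "\<tau> \<subseteq> V" if "\<tau> \<in> X" for \<tau>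
    using that by (auto simp: V vertices_def)
  have finV: "finite V"
    using X by (simp add: V vertices_def finite_complex_def)
  have \<sigma>V: "\<sigma> \<subseteq> V" "\<sigma> \<noteq> {}"
    using XV [OF \<sigma>] \<sigma> X unfolding finite_complex_def by blast+
  have "card V > 0" using finV \<sigma>V card_gt_0_iff by blast
  then have m: "0 < ?m" by simp
  have starV: "\<tau> \<subseteq> V" if "\<tau> \<in> star_closed X \<sigma>" for \<tau>
    using that XV [of "\<tau> \<union> \<sigma>"] by (auto simp: star_closed_def)
  have star_down: "\<rho> \<in> star_closed X \<sigma>" if "\<tau> \<in> star_closed X \<sigma>" "\<rho> \<subseteq> \<tau>" for \<tau> \<rho>
  proof -
    have "\<rho> \<union> \<sigma> \<subseteq> \<tau> \<union> \<sigma>" "\<rho> \<union> \<sigma> \<noteq> {}" using that \<sigma>V by auto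
    then show ?thesis using X that(1) unfolding star_closed_def finite_complex_def by blast
  qed
  have sub: "\<rho> \<in> X" if "\<tau> \<in> X" "\<rho> \<subseteq> \<tau>" "\<rho> \<noteq> {}" for \<tau> \<rho>
    using X that unfolding finite_complex_def by blast

  obtain e\<^sub>1 where e1: "0 < e\<^sub>1" and qc: "\<And>z z'. z \<in> ?\<Delta> \<Longrightarrow> z' \<in> ?\<Delta> \<Longrightarrow> l1_dist ?N z z' < e\<^sub>1 \<Longrightarrow>
      l1_dist V (q z) (q z') < ?m"
    using qcont [OF m] by blast
  \<comment> \<open>Below \<open>e\<^sub>1\<close>, near vertices of \<open>q\<close>-images lie in
    each other's supports by \<open>near_vertex_support\<close>. Below
    \<open>d\<^sub>0 - d\<^sub>1\<close>, a coordinate that is at most \<open>d\<^sub>1\<close> at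
    one point of a fine list is below \<open>d\<^sub>0\<close> at all of them.\<close>
  define e where "e = min (min e\<^sub>1 (d\<^sub>0 - d\<^sub>1)) d\<^sub>0"
  have e: "0 < e" "e \<le> e\<^sub>1" "e \<le> d\<^sub>0 - d\<^sub>1" "e \<le> d\<^sub>0"
    using e1 d by (auto simp: e_def)
  obtain h where h: "0 < h" and pc: "\<And>\<tau> y y'. \<tau> \<in> star_closed X \<sigma> \<Longrightarrow> y \<in> geom_simplex \<tau> \<Longrightarrow>
      y' \<in> geom_simplex \<tau> \<Longrightarrow> l1_dist V y y' < h \<Longrightarrow> l1_dist ?N (p y) (p y') < e"
    using pcont [OF e(1)] by blast
  obtain D where D: "subdivides V h D"
    using ex_subdivides [OF finV h] by blast
  obtain D' where D': "subdivides ?N e D'"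
    using ex_subdivides [OF _ e(1)] by blast

  \<comment> \<open>Coordinates below \<open>d\<^sub>0\<close> throughout the list must stay below
    it. These conditions are convex, and each of them excludes the barycentre, as
    \<open>d\<^sub>0 < 1 / (n + 1)\<close>.\<close>
  define C where "C l = {z \<in> ?\<Delta>. \<forall>i\<le>n. (\<forall>y\<in>set l. y i < d\<^sub>0) \<longrightarrow> z i < d\<^sub>0}" for l :: "(nat \<Rightarrow> real) list"
  define B where "B = {l. set l \<subseteq> ?\<Delta> \<and> (\<forall>x\<in>set l. \<forall>y\<in>set l. l1_dist ?N x y < e)}"
  have C_mono: "C l' \<subseteq> C l" if "set l' \<subseteq> set l" for l l'
    using that by (auto simp: C_def subset_iff)
  have C_self: "set l \<subseteq> C l" if "l \<in> B" for l
    using that by (auto simp: C_def B_def)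
  have C_conv: "coord_convex (C l)" for l
    unfolding coord_convex_def
  proof (intro ballI allI impI)
    fix x y :: "nat \<Rightarrow> real" and t :: real assume x: "x \<in> C l" and y: "y \<in> C l" and t: "0 \<le> t \<and> t \<le> 1"
    let ?w = "\<lambda>i. (1 - t) * x i + t * y i"
    have "?w \<in> ?\<Delta>"
      using coord_convex_geom_simplex x y t unfolding coord_convex_def C_def by blast
    moreover have "?w i < d\<^sub>0" if "i \<le> n" "\<forall>y\<in>set l. y i < d\<^sub>0" for i
      using convex_bound_lt [of "x i" d\<^sub>0 "y i" "1 - t" t] x y t that by (auto simp: C_def)
    ultimately show "?w \<in> C l" by (auto simp: C_def)
  qed
  \<comment> \<open>A near vertex has coordinate at least \<open>1 / (n + 1)\<close>, which exceeds
    \<open>d\<^sub>0\<close>, so an index that is small throughout the list is never chosen. This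
    keeps the approximation inside the carrier.\<close>
  have near_small: "near_vertex ?N ` set l \<subseteq> ?N - {i. \<forall>y\<in>set l. y i < d\<^sub>0}" if "l \<in> B" for l
  proof
    fix i assume "i \<in> near_vertex ?N ` set l"
    then obtain y where y: "y \<in> set l" "i = near_vertex ?N y" by blast
    then have "i \<le> n" "1 / (real n + 1) \<le> y i"
      using near_vertex [of y ?N] that by (auto simp: B_def add.commute)
    then have "\<not> y i < d\<^sub>0" using d by linarith
    then show "i \<in> ?N - {i. \<forall>y\<in>set l. y i < d\<^sub>0}"
      using y(1) \<open>i \<le> n\<close> by auto
  qed

  \<comment> \<open>Approximate by a simplex of the standard simplex and refine that again. On fine
    lists this is a chain map with the same carrier as the identity.\<close>
  define R where "R l = linext D' (vertex_chain ?N (gen l))" for l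
  have keysR: "l' \<in> fine_lists ?N e (C l) (length l)" if l: "l \<in> B" and l': "l' \<in> keys (R l)" for l l'
  proof -
    obtain \<rho> where \<rho>: "\<rho> \<in> keys (vertex_chain ?N (gen l))" "l' \<in> keys (D' \<rho>)"
      using l'
      unfolding R_def by (rule keys_linextE)
    obtain l2 where "l2 \<in> keys (gen l)" "\<rho> = near_vertex ?N ` set l2" "card \<rho> = length l2"
      using \<rho>(1) by (rule keys_vertex_chain)
    then have \<rho>l: "\<rho> = near_vertex ?N ` set l" "card \<rho> = length l"
      by simp_all
    have \<rho>N: "\<rho> \<subseteq> ?N - {i. \<forall>y\<in>set l. y i < d\<^sub>0}"
      using near_small [OF l] \<rho>l by simp
    then have f: "l' \<in> fine_lists ?N e (geom_simplex \<rho>) (length l)"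
      using subdividesD(1) [OF D' _ \<rho>(2)] \<rho>l(2) by auto
    have "geom_simplex \<rho> \<subseteq> C l"
    proof
      fix z assume z: "z \<in> geom_simplex \<rho>"
      have "z \<in> ?\<Delta>" using z geom_simplex_mono [of ?N \<rho>] \<rho>N by blast
      moreover have "z i < d\<^sub>0" if "\<forall>y\<in>set l. y i < d\<^sub>0" for i
      proof -
        have "i \<notin> \<rho>" using \<rho>N that by auto
        then show ?thesis using z d by (simp add: geom_simplex_def)
      qed
      ultimately show "z \<in> C l" by (simp add: C_def)
    qed
    then show ?thesis using f by (auto simp: fine_lists_def)
  qed
  have bdR: "bd (linext R a) = linext R (bd a)" if "keys a \<subseteq> B" for a
  proof -
    have 1: "linext R a = linext D' (vertex_chain ?N a)" for a
      by (simp add: R_def [abs_def] flip: linext_compose vertex_chain_linext)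
    have "bd (linext D' c) = linext D' (set_bd UNIV c)" if "keys c \<subseteq> Pow ?N" for c
    proof -
      have "bd (linext D' c) = linext (\<lambda>\<rho>. linext D' (face_bd UNIV \<rho>)) c"
        unfolding bd_linext
        by (rule linext_cong) (use that subdividesD(2) [OF D'] in blast)
      then show ?thesis by (simp add: set_bd_def linext_compose)
    qed
    moreover have "keys (vertex_chain ?N a) \<subseteq> Pow ?N"
    proof
      fix \<rho> assume "\<rho> \<in> keys (vertex_chain ?N a)"
      then obtain l where "l \<in> keys a" "\<rho> = near_vertex ?N ` set l" by (rule keys_vertex_chain)
      then show "\<rho> \<in> Pow ?N" using near_small that by blast
    qed
    ultimately show ?thesis by (simp add: 1 set_bd_vertex_chain)
  qed

  have "\<exists>H. \<forall>l\<in>B. keys (H l) \<subseteq> fine_lists ?N e (C l) (Suc (length l)) \<and>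
      bd (H l) = (gen l + R l) + linext H (list_bd l) \<and> (length l = 0 \<longrightarrow> H l = 0)"
  \<comment> \<open>The homotopy between the identity and \<open>R\<close>. The two agree on the
    empty list, so the homotopy starts with 0.\<close>
  proof (rule acyclic_carrier [where Q = "\<lambda>l. fine_lists ?N e (C l) (length l)"])
    fix l l' assume "l \<in> B" "l' \<in> keys (list_bd l)"
    then have "Suc (length l') = length l" "set l' \<subseteq> set l"
      using keys_list_bd_subset [of l] by auto
    then show "l' \<in> B \<and> Suc (length l') = length l \<and>
        fine_lists ?N e (C l') (Suc (length l')) \<subseteq> fine_lists ?N e (C l) (length l)"
      using \<open>l \<in> B\<close> C_mono [of l' l] unfolding B_def fine_lists_def by (simp add: subset_iff)
  next
    fix l assume l: "l \<in> B"
    show "keys (gen l + R l) \<subseteq> fine_lists ?N e (C l) (length l)"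
    proof (rule keys_add_subset)
      show "keys (gen l) \<subseteq> fine_lists ?N e (C l) (length l)"
        using l C_self [OF l] by (simp add: fine_lists_def B_def)
    qed (use keysR [OF l] in blast)
    have "bd (linext R (gen l)) = linext R (bd (gen l))"
      by (rule bdR) (use l in auto)
    then show "bd (gen l + R l) = linext (\<lambda>l. gen l + R l) (list_bd l)"
      by (simp add: linext_add_fun)
    show "linext list_bd (list_bd l) = 0"
      using bd_list_bd [of l] by (simp add: bd_def)
  next
    fix l assume "l \<in> B" "length l = 0"
    moreover have "R [] = gen []"
      using D' by (simp add: R_def vertex_chain_def subdivides_def)
    ultimately show "list_bd l = 0 \<and> gen l + R l = 0 \<and>
        keys (0 :: (nat \<Rightarrow> real) list bit_chain) \<subseteq> fine_lists ?N e (C l) (Suc (length l))"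
      by simp
  next
    fix l z assume l: "l \<in> B" "0 < length l" and z: "keys z \<subseteq> fine_lists ?N e (C l) (length l)" "bd z = 0"
    then have "hd l \<in> C l" using C_self [of l] hd_in_set [of l] by auto
    then show "\<exists>b. keys b \<subseteq> fine_lists ?N e (C l) (Suc (length l)) \<and> bd b = z"
      using convex_acyclic [OF C_conv _ e(1) z] by blast
  qed simp
  then obtain H where H: "\<And>l. l \<in> B \<Longrightarrow> keys (H l) \<subseteq> fine_lists ?N e (C l) (Suc (length l))"
    "\<And>l. l \<in> B \<Longrightarrow> bd (H l) = gen l + R l + linext H (list_bd l)"
    "\<And>l. l \<in> B \<Longrightarrow> length l = 0 \<Longrightarrow> H l = 0"
    by blast

  define A where "A c = push p (linext D c)" for c
  define \<Lambda> where "\<Lambda> c = lookup (vertex_chain ?N (A c)) ?N" for c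
  have "\<Lambda> (a + b) = \<Lambda> a + \<Lambda> b" for a b
    by (simp add: \<Lambda>_def A_def lookup_add)
  moreover have "\<exists>b. keys b \<subseteq> {\<tau> \<in> X. card \<tau> = Suc (Suc k)} \<and> (\<forall>\<rho>\<in>keys (c + set_bd UNIV b). \<not> \<sigma> \<subseteq> \<rho>)"
    if c: "keys c \<subseteq> {\<tau> \<in> star_closed X \<sigma>. card \<tau> = Suc k}"
      and local: "\<forall>\<rho>\<in>keys (set_bd UNIV c). \<not> \<sigma> \<subseteq> \<rho>" and kn: "k = n \<longrightarrow> \<Lambda> c = 0" for k c
  proof -
    have keysA: "\<exists>\<tau>\<in>keys c'. \<exists>l'. l' \<in> fine_lists V h (geom_simplex \<tau>) (card \<tau>) \<and> l = map p l'"
      if c': "keys c' \<subseteq> star_closed X \<sigma>" and l: "l \<in> keys (A c')" for c' l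
    proof -
      obtain l' where l': "l' \<in> keys (linext D c')" "l = map p l'"
        using keys_push_subset l unfolding A_def by blast
      obtain \<tau> where \<tau>: "\<tau> \<in> keys c'" "l' \<in> keys (D \<tau>)"
        using l'(1) by (rule keys_linextE)
      then have "l' \<in> fine_lists V h (geom_simplex \<tau>) (card \<tau>)"
        using subdividesD(1) [OF D starV] c' by blast
      then show ?thesis using \<tau> l' by blast
    qed
    have AB: "keys (A c') \<subseteq> B" if c': "keys c' \<subseteq> star_closed X \<sigma>" for c'
    proof
      fix l assume "l \<in> keys (A c')"
      then obtain \<tau> l' where "\<tau> \<in> keys c'" "l' \<in> fine_lists V h (geom_simplex \<tau>) (card \<tau>)" "l = map p l'"
        using keysA [OF c'] by blast
      then show "l \<in> B"
        using c' p pc by (auto simp: B_def fine_lists_def subset_iff)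
    qed
    have c_star: "keys c \<subseteq> star_closed X \<sigma>" using c by blast
    have bdc_star: "keys (set_bd UNIV c) \<subseteq> star_closed X \<sigma>"
    proof
      fix \<rho> assume "\<rho> \<in> keys (set_bd UNIV c)"
      then obtain \<tau> v where "\<tau> \<in> keys c" "\<rho> = \<tau> - {v}"
        using keys_set_bd_subset [of UNIV c] by blast
      then show "\<rho> \<in> star_closed X \<sigma>" using star_down [of \<tau> \<rho>] c_star by blast
    qed
    have bdA: "bd (A c) = A (set_bd UNIV c)"
    proof -
      have "bd (linext D c) = linext (\<lambda>\<tau>. linext D (face_bd UNIV \<tau>)) c"
        unfolding bd_linext
        by (rule linext_cong) (use c_star subdividesD(2) [OF D starV] in blast)
      then show ?thesis
        by (simp add: A_def bd_push set_bd_def linext_compose)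
    qed
    \<comment> \<open>The boundary of \<open>a\<close> is \<open>A c\<close> with two error terms:
      the refined approximation of \<open>A c\<close>, and \<open>s\<close>, which lies over the
      boundary of \<open>c\<close>. Under \<open>q\<close> and near vertices \<open>A c\<close>
      returns to \<open>c\<close>, while both errors end up away from
      \<open>\<sigma>\<close>.\<close>
    define a where "a = linext H (A c)"
    define r where "r = vertex_chain ?N (A c)"
    define s where "s = linext H (A (set_bd UNIV c))"
    have bda: "bd a = A c + linext D' r + s"
    proof -
      have "bd a = linext (\<lambda>l. gen l + R l + linext H (list_bd l)) (A c)"
        unfolding a_def bd_linext
        by (rule linext_cong) (use H(2) AB [OF c_star] in blast)
      also have "\<dots> = A c + linext R (A c) + linext H (bd (A c))"
        by (simp add: linext_add_fun bd_def linext_compose)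
      also have "linext R (A c) = linext D' r"
        unfolding r_def by (simp add: R_def [abs_def] flip: linext_compose vertex_chain_linext)
      finally show ?thesis by (simp add: bdA s_def)
    qed
    define b where "b = vertex_chain V (push q a)"
    have fineq: "near_vertex V ` q ` set l \<subseteq> {v. q z v \<noteq> 0}"
      if l: "l \<in> fine_lists ?N e ?\<Delta> j" and z: "z \<in> set l" for l j z
    proof
      fix v assume "v \<in> near_vertex V ` q ` set l"
      then obtain z' where z': "z' \<in> set l" "v = near_vertex V (q z')" by blast
      have zz: "z \<in> ?\<Delta>" "z' \<in> ?\<Delta>" "l1_dist ?N z z' < e\<^sub>1"
        using l z z'(1) e unfolding fine_lists_def by fastforce+
      show "v \<in> {v. q z v \<noteq> 0}"
        using near_vertex_support [OF _ _ qc [OF zz]] q zz z'(2) by blast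
    qed
    have C\<Delta>: "C l \<subseteq> ?\<Delta>" for l by (auto simp: C_def)
    have "set_bd UNIV b = vertex_chain V (push q (A c)) + vertex_chain V (push q (linext D' r)) +
        vertex_chain V (push q s)"
      by (simp add: b_def set_bd_vertex_chain bd_push bda)
    \<comment> \<open>By \<open>qp\<close> the composite of \<open>p\<close> and \<open>q\<close>
      preserves every simplex of the star, so the Sperner argument applies to the refinement pushed
      along it.\<close>
    moreover have "vertex_chain V (push q (A c)) = c"
    proof -
      have "vertex_chain V (push q (A c)) = linext (\<lambda>\<tau>. vertex_chain V (push (q \<circ> p) (D \<tau>))) c"
        by (simp add: A_def push_push push_linext vertex_chain_linext)
      also have "\<dots> = linext gen c"
      proof (rule linext_cong)
        fix \<tau> assume "\<tau> \<in> keys c"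
        then have \<tau>: "\<tau> \<in> star_closed X \<sigma>" using c_star by blast
        show "vertex_chain V (push (q \<circ> p) (D \<tau>)) = gen \<tau>"
        proof (rule vertex_chain_subdivides [OF finV D _ _ _ \<tau>])
          fix \<rho> assume \<rho>: "\<rho> \<in> star_closed X \<sigma>"
          then show "\<rho> \<subseteq> V" by (rule starV)
          show "(q \<circ> p) ` geom_simplex \<rho> \<subseteq> geom_simplex \<rho>"
            using p [OF \<rho>] q qp [OF \<rho>] geom_simplex_subset_iff [OF finV starV [OF \<rho>]] by auto
        qed (rule star_down)
      qed
      finally show ?thesis by simp
    qed
    ultimately have cb: "c + set_bd UNIV b = vertex_chain V (push q (linext D' r)) + vertex_chain V (push q s)"
      by (simp add: add.assoc)
    \<comment> \<open>One small coordinate at one point \<open>z\<close> of the list is enough: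
      \<open>q z\<close> then vanishes at a vertex of \<open>\<sigma>\<close>, and all near vertices
      of the list lie in the support of \<open>q z\<close>.\<close>
    have avoid: "\<not> \<sigma> \<subseteq> \<rho>" if l: "l \<in> fine_lists ?N e ?\<Delta> j" "z \<in> set l" "i \<le> n" "z i < d\<^sub>0"
      and \<rho>: "\<rho> = near_vertex V ` q ` set l" for l j z i \<rho>
      using fineq [OF l(1,2)] qout [of z i] l \<rho> unfolding fine_lists_def by blast
    have 1: "\<not> \<sigma> \<subseteq> \<rho>" if \<rho>: "\<rho> \<in> keys (vertex_chain V (push q (linext D' r)))" for \<rho>
    proof -
      obtain l where l: "l \<in> keys (linext D' r)" "\<rho> = near_vertex V ` q ` set l"
        using \<rho> by (rule keys_vertex_chain_push)
      then obtain \<omega> where \<omega>: "\<omega> \<in> keys r" "l \<in> keys (D' \<omega>)"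
        using keys_linext_subset [of r D' "\<Union>\<rho>\<in>keys r. keys (D' \<rho>)"] by blast
      obtain l2 where l2: "l2 \<in> keys (A c)" "\<omega> = near_vertex ?N ` set l2" "card \<omega> = length l2"
        using \<omega>(1) unfolding r_def by (rule keys_vertex_chain)
      have \<omega>N: "\<omega> \<subseteq> ?N"
        using l2 near_small [of l2] AB [OF c_star] by blast
      have card\<omega>: "card \<omega> = Suc k"
        using keysA [OF c_star l2(1)] l2(3) c by (auto simp: fine_lists_def)
      \<comment> \<open>The full simplex has \<open>n + 1\<close> vertices, so it can occur only for
        \<open>k = n\<close>, where its coefficient is \<open>\<Lambda> c = 0\<close>. Any other
        \<open>\<omega>\<close> misses an index, and that coordinate is 0 on all of its
        refinement.\<close>
      have "\<omega> \<noteq> ?N"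
      proof
        assume "\<omega> = ?N"
        then have "k = n" using card\<omega> by simp
        then have "lookup r \<omega> = 0" using kn \<open>\<omega> = ?N\<close> by (simp add: \<Lambda>_def r_def)
        then show False using \<omega>(1) by (simp add: in_keys_iff)
      qed
      then obtain i where i: "i \<le> n" "i \<notin> \<omega>" using \<omega>N by auto
      have lf: "l \<in> fine_lists ?N e (geom_simplex \<omega>) (Suc k)"
        using subdividesD(1) [OF D' \<omega>N \<omega>(2)] card\<omega> by simp
      then have "l \<noteq> []" by (auto simp: fine_lists_def)
      then have z: "hd l \<in> set l" "hd l \<in> geom_simplex \<omega>" using lf by (auto simp: fine_lists_def)
      have "hd l i < d\<^sub>0" using z i d by (simp add: geom_simplex_def)
      moreover have "l \<in> fine_lists ?N e ?\<Delta> (Suc k)"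
        using lf geom_simplex_mono [OF _ \<omega>N] by (auto simp: fine_lists_def)
      ultimately show ?thesis
        using avoid z(1) i(1) l(2) by blast
    qed
    have 2: "\<not> \<sigma> \<subseteq> \<rho>" if \<rho>: "\<rho> \<in> keys (vertex_chain V (push q s))" for \<rho>
    proof -
      obtain l where l: "l \<in> keys s" "\<rho> = near_vertex V ` q ` set l"
        using \<rho> by (rule keys_vertex_chain_push)
      then obtain l2 where l2: "l2 \<in> keys (A (set_bd UNIV c))" "l \<in> keys (H l2)"
        using keys_linext_subset [of "A (set_bd UNIV c)" H "\<Union>l\<in>keys (A (set_bd UNIV c)). keys (H l)"]
        unfolding s_def by blast
      have l2B: "l2 \<in> B" using l2 AB [OF bdc_star] by blast
      have lf: "l \<in> fine_lists ?N e (C l2) (Suc (length l2))"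
        using H(1) l2B l2(2) by blast
      have "l2 \<noteq> []" using H(3) [OF l2B] l2(2) by auto
      obtain \<tau> l3 where \<tau>: "\<tau> \<in> keys (set_bd UNIV c)" "l3 \<in> fine_lists V h (geom_simplex \<tau>) (card \<tau>)" "l2 = map p l3"
        using keysA [OF bdc_star l2(1)] by blast
      then have \<tau>2: "\<tau> \<in> star_closed X \<sigma>" "\<not> \<sigma> \<subseteq> \<tau>" using local bdc_star by auto
      have "hd l3 \<in> geom_simplex \<tau>"
        using \<tau> \<open>l2 \<noteq> []\<close> by (auto simp: fine_lists_def)
      \<comment> \<open>The boundary of \<open>c\<close> avoids \<open>\<sigma>\<close>, so
        \<open>pout\<close> yields one small coordinate at one point. The choice of \<open>e\<close>
        spreads it over the list \<open>l2\<close>, and the carrier \<open>C l2\<close> over the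
        chain \<open>H l2\<close>.\<close>
      then obtain i where i: "i \<le> n" "p (hd l3) i \<le> d\<^sub>1" using pout [OF \<tau>2] by blast
      have "y i < d\<^sub>0" if y: "y \<in> set l2" for y
      proof -
        have "p (hd l3) \<in> set l2" using \<tau>(3) \<open>l2 \<noteq> []\<close> by auto
        then have "l1_dist ?N y (p (hd l3)) < e" using l2B y by (auto simp: B_def)
        then have "\<bar>y i - p (hd l3) i\<bar> < e"
          using abs_coord_le_l1_dist [of ?N i y "p (hd l3)"] i(1) by auto
        then show ?thesis using i(2) e by linarith
      qed
      then have Ci: "z i < d\<^sub>0" if "z \<in> C l2" for z using that i(1) by (auto simp: C_def)
      have "l \<noteq> []" using lf by (auto simp: fine_lists_def)
      then have z: "hd l \<in> set l" "hd l \<in> C l2" using lf by (auto simp: fine_lists_def)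
      have "l \<in> fine_lists ?N e ?\<Delta> (Suc (length l2))"
        using lf C\<Delta> [of l2] by (auto simp: fine_lists_def)
      then show ?thesis
        using avoid z(1) i(1) l(2) Ci [OF z(2)] by blast
    qed
    have "\<not> \<sigma> \<subseteq> \<rho>" if "\<rho> \<in> keys (c + set_bd UNIV b)" for \<rho>
    proof -
      have "\<rho> \<in> keys (vertex_chain V (push q (linext D' r))) \<or> \<rho> \<in> keys (vertex_chain V (push q s))"
        using that keys_add unfolding cb by (rule rev_subsetD [THEN UnE]) auto
      then show ?thesis using 1 2 by blast
    qed
    moreover have "keys b \<subseteq> {\<tau> \<in> X. card \<tau> = Suc (Suc k)}"
    proof
      fix \<rho> assume "\<rho> \<in> keys b"
      then obtain l where l: "l \<in> keys a" "\<rho> = near_vertex V ` q ` set l" "card \<rho> = length l"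
        unfolding b_def by (rule keys_vertex_chain_push)
      then obtain l2 where l2: "l2 \<in> keys (A c)" "l \<in> keys (H l2)"
        using keys_linext_subset [of "A c" H "\<Union>l\<in>keys (A c). keys (H l)"]
        unfolding a_def by blast
      have l2B: "l2 \<in> B" using l2 AB [OF c_star] by blast
      have "length l2 = Suc k"
        using keysA [OF c_star l2(1)] c by (auto simp: fine_lists_def)
      then have lf: "l \<in> fine_lists ?N e (C l2) (Suc (Suc k))"
        using H(1) [OF l2B] l2(2) by auto
      then have lf': "l \<in> fine_lists ?N e ?\<Delta> (Suc (Suc k))"
        using C\<Delta> [of l2] by (auto simp: fine_lists_def)
      have z: "hd l \<in> set l" using lf by (cases l) (auto simp: fine_lists_def)
      have "\<rho> \<subseteq> {v. q (hd l) v \<noteq> 0}"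
        using fineq [OF lf' z] l by simp
      moreover have "hd l \<in> ?\<Delta>" using lf' z by (auto simp: fine_lists_def)
      moreover have card\<rho>: "card \<rho> = Suc (Suc k)" using l lf by (simp add: fine_lists_def)
      moreover then have "\<rho> \<noteq> {}" by auto
      ultimately show "\<rho> \<in> {\<tau> \<in> X. card \<tau> = Suc (Suc k)}"
        using sub q by blast
    qed
    ultimately show ?thesis by blast
  qed
  ultimately show ?thesis
    unfolding local_functional_def by (intro exI [of _ \<Lambda>] conjI allI impI)
qed

section \<open>Charts around the barycentre of a simplex\<close>

lemma coordinate_neighbourhood:
  fixes a :: "'i \<Rightarrow> real"
  assumes "openin (top_of_set S) W" "a \<in> W"
  obtains F e where "finite F" "0 < e" "\<forall>w\<in>S. (\<forall>i\<in>F. \<bar>w i - a i\<bar> < e) \<longrightarrow> w \<in> W"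
proof -
  obtain T where T: "open T" "W = S \<inter> T"
    using assms(1) by (auto simp: openin_open)
  then have "openin (product_topology (\<lambda>i. euclidean) UNIV) T" "a \<in> T"
    using assms(2) by (auto simp: euclidean_product_topology)
  then obtain U where U: "a \<in> (\<Pi>\<^sub>E i\<in>UNIV. U i)" "\<And>i. open (U i)" "finite {i. U i \<noteq> UNIV}"
    "(\<Pi>\<^sub>E i\<in>UNIV. U i) \<subseteq> T"
    using product_topology_open_contains_basis [of "\<lambda>i. euclidean" UNIV T a] by auto
  have "\<exists>r>0. ball (a i) r \<subseteq> U i" for i
    using U(1,2) open_contains_ball by (metis PiE_mem UNIV_I)
  then obtain r where r: "\<And>i. r i > 0" "\<And>i. ball (a i) (r i) \<subseteq> U i"
    by metis
  define F where "F = {i. U i \<noteq> UNIV}"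
  define e where "e = Min (insert 1 (r ` F))"
  have fin: "finite (insert 1 (r ` F))" using U(3) by (simp add: F_def)
  have "0 < e"
    unfolding e_def using fin r(1) by (subst Min_gr_iff) auto
  moreover have "w \<in> W" if "w \<in> S" "\<And>i. i \<in> F \<Longrightarrow> \<bar>w i - a i\<bar> < e" for w
  proof -
    have "w i \<in> U i" for i
    proof (cases "i \<in> F")
      case True
      have "e \<le> r i" unfolding e_def using fin True by (intro Min_le) auto
      then have "w i \<in> ball (a i) (r i)"
        using that(2) [OF True] by (simp add: dist_real_def abs_minus_commute)
      then show ?thesis using r(2) by blast
    qed (simp add: F_def)
    then show ?thesis using U(4) T that(1) by auto
  qed
  moreover have "finite F" using U(3) by (simp add: F_def)
  ultimately show thesis
    by (intro that [of F e]) auto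
qed

lemma continuous_on_coordinate: "continuous_on S (\<lambda>x :: 'i \<Rightarrow> real. x i)"
  by (rule continuous_on_product_then_coordinatewise [OF continuous_on_id])

section \<open>Compactness estimates\<close>

lemma continuous_on_l1_dist [continuous_intros]:
  fixes f g :: "'a :: topological_space \<Rightarrow> 'i \<Rightarrow> real"
  assumes "continuous_on S f" "continuous_on S g"
  shows "continuous_on S (\<lambda>x. l1_dist I (f x) (g x))"
  unfolding l1_dist_def
  by (intro continuous_on_sum continuous_on_rabs continuous_on_diff
      continuous_on_product_then_coordinatewise [OF assms(1)]
      continuous_on_product_then_coordinatewise [OF assms(2)])

lemma compact_sublevel:
  fixes f :: "'a :: topological_space \<Rightarrow> real"
  assumes "compact K" "continuous_on K f"
  shows "compact {x \<in> K. f x \<le> c}" "compact {x \<in> K. c \<le> f x}"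
proof -
  have "closedin (top_of_set K) (K \<inter> f -` {..c})" "closedin (top_of_set K) (K \<inter> f -` {c..})"
    using assms(2) by (intro continuous_closedin_preimage; simp)+
  moreover have "K \<inter> f -` {..c} = {x \<in> K. f x \<le> c}" "K \<inter> f -` {c..} = {x \<in> K. c \<le> f x}"
    by auto
  ultimately show "compact {x \<in> K. f x \<le> c}" "compact {x \<in> K. c \<le> f x}"
    using closedin_compact [OF assms(1)] by auto
qed

lemma compact_positive_lower_bound:
  fixes f :: "'a :: topological_space \<Rightarrow> real"
  assumes "compact K" "continuous_on K f" "\<And>x. x \<in> K \<Longrightarrow> 0 < f x"
  obtains d where "0 < d" "\<And>x. x \<in> K \<Longrightarrow> d \<le> f x"
proof (cases "K = {}")
  case False
  then obtain x where "x \<in> K" "\<forall>y\<in>K. f x \<le> f y"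
    using continuous_attains_inf [OF assms(1) _ assms(2)] by blast
  then show thesis using that assms(3) by blast
qed (use that [of 1] in auto)

text \<open>The pairs with images at distance at least \<open>e\<close> form a compact set on which
  the distance of the arguments is positive, hence bounded below. The hypothesis \<open>sep\<close>
  is there because \<open>l1_dist I\<close> sees only the coordinates in \<open>I\<close>.\<close>

lemma l1_uniformly_continuous:
  fixes f :: "('i \<Rightarrow> real) \<Rightarrow> 'j \<Rightarrow> real"
  assumes K: "compact K" and f: "continuous_on K f" and fin: "finite I"
    and sep: "\<And>x y. x \<in> K \<Longrightarrow> y \<in> K \<Longrightarrow> (\<And>i. i \<in> I \<Longrightarrow> x i = y i) \<Longrightarrow> x = y"
    and e: "0 < e"
  shows "\<exists>d>0. \<forall>x\<in>K. \<forall>y\<in>K. l1_dist I x y < d \<longrightarrow> l1_dist J (f x) (f y) < e"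
proof -
  let ?P = "{s \<in> K \<times> K. e \<le> l1_dist J (f (fst s)) (f (snd s))}"
  have "continuous_on (K \<times> K) (\<lambda>s. l1_dist J (f (fst s)) (f (snd s)))"
    by (intro continuous_intros continuous_on_compose2 [OF f]) auto
  then have P: "compact ?P"
    using compact_sublevel(2) [OF compact_Times [OF K K]] by blast
  have cont: "continuous_on ?P (\<lambda>s. l1_dist I (fst s) (snd s))"
    by (intro continuous_intros)
  have "0 < l1_dist I (fst s) (snd s)" if s: "s \<in> ?P" for s
  proof -
    have "fst s \<noteq> snd s" using s e by (auto simp: l1_dist_def)
    then obtain i where "i \<in> I" "fst s i \<noteq> snd s i"
      using sep [of "fst s" "snd s"] s unfolding mem_Collect_eq mem_Times_iff by blast
    then show ?thesis
      using abs_coord_le_l1_dist [OF fin, of i "fst s" "snd s"] by linarith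
  qed
  then obtain d where "0 < d" "\<And>s. s \<in> ?P \<Longrightarrow> d \<le> l1_dist I (fst s) (snd s)"
    using compact_positive_lower_bound [OF P cont] by blast
  then show ?thesis
    by (intro exI [of _ d]) (force simp: not_le)
qed

lemma compact_geom_simplex:
  assumes "finite \<tau>"
  shows "compact (geom_simplex \<tau>)"
proof -
  let ?K = "\<Pi>\<^sub>E v\<in>UNIV. if v \<in> \<tau> then {0..1} else {0} :: real set"
  have "compactin (product_topology (\<lambda>i. euclidean) UNIV) ?K"
    unfolding compactin_PiE by simp
  then have K: "compact ?K"
    by (simp add: euclidean_product_topology)
  have c: "continuous_on ?K (\<lambda>y. \<Sum>v\<in>\<tau>. y v)"
    by (intro continuous_intros continuous_on_coordinate)
  have "geom_simplex \<tau> = {y \<in> {y \<in> ?K. (\<Sum>v\<in>\<tau>. y v) \<le> 1}. 1 \<le> (\<Sum>v\<in>\<tau>. y v)}" (is "_ = ?R")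
  proof
    show "geom_simplex \<tau> \<subseteq> ?R"
    proof
      fix y assume y: "y \<in> geom_simplex \<tau>"
      then have "y v \<le> 1" if "v \<in> \<tau>" for v
        using member_le_sum [of v \<tau> y] assms that by (auto simp: geom_simplex_def)
      then show "y \<in> ?R" using y by (auto simp: geom_simplex_def)
    qed
    show "?R \<subseteq> geom_simplex \<tau>"
    proof
      fix y assume y: "y \<in> ?R"
      then have *: "y v \<in> (if v \<in> \<tau> then {0..1} else {0})" for v
        unfolding PiE_UNIV_domain Pi_iff by blast
      have "0 \<le> y v" "v \<notin> \<tau> \<longrightarrow> y v = 0" for v using * [of v] by (auto split: if_splits)
      then show "y \<in> geom_simplex \<tau>" using y by (auto simp: geom_simplex_def)
    qed
  qed
  moreover have "compact ?R"
    by (intro compact_sublevel K c continuous_on_subset [OF c]) auto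
  ultimately show ?thesis by simp
qed

lemma continuous_on_Min_coordinates:
  assumes "finite A" "A \<noteq> {}"
  shows "continuous_on S (\<lambda>y :: 'v \<Rightarrow> real. Min (y ` A))"
  using assms
proof (induction A rule: finite_ne_induct)
  case (insert v A)
  then have "(\<lambda>y :: 'v \<Rightarrow> real. Min (y ` insert v A)) = (\<lambda>y. min (y v) (Min (y ` A)))"
    by auto
  then show ?case
    using insert by (auto intro!: continuous_intros continuous_on_coordinate)
qed (auto intro: continuous_on_coordinate)

lemma finite_complexD:
  assumes "finite_complex X"
  shows "finite X" and "finite (vertices X)" and "\<sigma> \<in> X \<Longrightarrow> finite \<sigma>" and "\<sigma> \<in> X \<Longrightarrow> \<sigma> \<noteq> {}"
    and "\<sigma> \<in> X \<Longrightarrow> \<sigma> \<subseteq> vertices X" and "\<sigma> \<in> X \<Longrightarrow> \<tau> \<subseteq> \<sigma> \<Longrightarrow> \<tau> \<noteq> {} \<Longrightarrow> \<tau> \<in> X"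
proof -
  show fin: "finite X" "\<sigma> \<in> X \<Longrightarrow> finite \<sigma>" "\<sigma> \<in> X \<Longrightarrow> \<sigma> \<noteq> {}" for \<sigma>
    using assms unfolding finite_complex_def by blast+
  show "finite (vertices X)"
    unfolding vertices_def using fin(1,2) finite_Union [of X] by blast
  show "\<sigma> \<in> X \<Longrightarrow> \<sigma> \<subseteq> vertices X"
    unfolding vertices_def by (rule Union_upper)
  show "\<sigma> \<in> X \<Longrightarrow> \<tau> \<subseteq> \<sigma> \<Longrightarrow> \<tau> \<noteq> {} \<Longrightarrow> \<tau> \<in> X"
    using assms unfolding finite_complex_def by blast
qed

lemma mem_realization_iff:
  assumes "finite_complex X"
  shows "y \<in> realization X \<longleftrightarrow> y \<in> geom_simplex (vertices X) \<and> {v. y v \<noteq> 0} \<in> X"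
  by (auto simp: realization_def geom_simplex_def vertices_def)

lemma geom_simplex_subset_realization:
  assumes "finite_complex X" "\<tau> \<in> X"
  shows "geom_simplex \<tau> \<subseteq> realization X"
proof
  fix y assume y: "y \<in> geom_simplex \<tau>"
  have V: "finite (vertices X)" "\<tau> \<subseteq> vertices X"
    using finite_complexD [OF assms(1)] assms(2) by blast+
  have s: "y \<in> geom_simplex (vertices X)" "{v. y v \<noteq> 0} \<subseteq> \<tau>"
    using y geom_simplex_subset_iff [OF V] by auto
  have "{v. y v \<noteq> 0} \<noteq> {}"
  proof
    assume "{v. y v \<noteq> 0} = {}"
    then have "\<And>v. y v = 0" by blast
    then show False using y by (simp add: geom_simplex_def)
  qed
  then have "{v. y v \<noteq> 0} \<in> X"
    using finite_complexD(6) [OF assms] s(2) by blast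
  then show "y \<in> realization X"
    using s assms(1) by (simp add: mem_realization_iff)
qed

section \<open>Transport of manifold charts to the realization\<close>

definition locally_euclidean_at :: "nat \<Rightarrow> ('i \<Rightarrow> real) set \<Rightarrow> ('i \<Rightarrow> real) \<Rightarrow> bool" where
  "locally_euclidean_at n R x \<longleftrightarrow>
     (\<exists>U W h g. openin (top_of_set R) U \<and> x \<in> U \<and>
        openin (top_of_set {w :: nat \<Rightarrow> real. \<forall>i\<ge>n. w i = 0}) W \<and> homeomorphism U W h g)"

lemma locally_euclidean_at_realization:
  assumes M: "closed_connected_manifold n M" and X: "triangulates X M" and x: "x \<in> realization X"
  shows "locally_euclidean_at n (realization X) x"
proof -
  let ?R = "top_of_set (realization X)" and ?E = "{w :: nat \<Rightarrow> real. \<forall>i\<ge>n. w i = 0}"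
  have E: "Euclidean_space n = top_of_set ?E"
    by (simp add: Euclidean_space_def euclidean_product_topology)
  obtain F G where FG: "homeomorphic_maps ?R M F G"
    using X by (auto simp: triangulates_def homeomorphic_space_def euclidean_product_topology)
  have Fx: "F x \<in> topspace M"
    using FG x by (auto simp: homeomorphic_maps_def continuous_map_def)
  then obtain U\<^sub>0 W where U0: "openin M U\<^sub>0" "F x \<in> U\<^sub>0" and W: "openin (top_of_set ?E) W"
    and hom: "subtopology M U\<^sub>0 homeomorphic_space subtopology (top_of_set ?E) W"
    using M Fx unfolding closed_connected_manifold_def E by blast
  obtain f g where fg: "homeomorphic_maps (subtopology M U\<^sub>0) (subtopology (top_of_set ?E) W) f g"
    using hom by (auto simp: homeomorphic_space_def)
  define U where "U = {y \<in> realization X. F y \<in> U\<^sub>0}"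
  have U: "openin ?R U"
    using FG U0 openin_continuous_map_preimage [of ?R M F U\<^sub>0]
    by (auto simp: homeomorphic_maps_def U_def)
  have FU: "F ` (topspace ?R \<inter> U) = topspace M \<inter> U\<^sub>0"
  proof -
    have "F ` (topspace ?R \<inter> U) \<subseteq> topspace M \<inter> U\<^sub>0"
      using FG by (auto simp: homeomorphic_maps_def continuous_map_def U_def)
    moreover have "m \<in> F ` (topspace ?R \<inter> U)" if "m \<in> topspace M \<inter> U\<^sub>0" for m
    proof -
      have "F (G m) = m" "G m \<in> realization X"
        using FG that by (auto simp: homeomorphic_maps_def continuous_map_def)
      then show ?thesis using that by (intro image_eqI [of _ _ "G m"]) (auto simp: U_def)
    qed
    ultimately show ?thesis by blast
  qed
  have "homeomorphic_maps (subtopology ?R U) (subtopology (top_of_set ?E) W) (f \<circ> F) (G \<circ> g)"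
    using homeomorphic_maps_compose [OF conjI [OF homeomorphic_maps_subtopologies [OF FG FU] fg]] .
  moreover have "subtopology ?R U = top_of_set U" "subtopology (top_of_set ?E) W = top_of_set W"
    using openin_imp_subset [OF U] openin_imp_subset [OF W]
    by (simp_all add: subtopology_subtopology Int_absorb1)
  ultimately have "homeomorphic_maps (top_of_set U) (top_of_set W) (f \<circ> F) (G \<circ> g)"
    by simp
  then have "homeomorphism U W (f \<circ> F) (G \<circ> g)"
    by (auto simp: homeomorphic_maps_def homeomorphism_def continuous_map_in_subtopology
        image_subset_iff intro!: image_eqI)
  then show ?thesis
    unfolding locally_euclidean_at_def using U W x U0 by (auto simp: U_def)
qed

text \<open>Deviations from the average \<open>c\<close> sum to 0, so the negative ones make up half
  of the distance, at least \<open>\<eta> / 2\<close>. One of the \<open>n + 1\<close> coordinates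
  carries at least an equal share of it.\<close>

lemma low_coordinate:
  fixes z :: "nat \<Rightarrow> real" and c :: real
  assumes z: "z \<in> geom_simplex {..n}" and c: "c = 1 / (real n + 1)" and \<eta>: "0 < \<eta>"
    and far: "\<eta> \<le> l1_dist {..n} z (\<lambda>_. c)"
  shows "\<exists>i\<le>n. z i \<le> c - \<eta> / (2 * (real n + 1))"
proof (rule ccontr)
  assume "\<not> ?thesis"
  then have lt: "c - \<eta> / (2 * (real n + 1)) < z i" if "i \<le> n" for i
    using that by (meson not_le)
  have "\<bar>z i - c\<bar> < (z i - c) + \<eta> / (real n + 1)" if "i \<in> {..n}" for i
  proof -
    define h where "h = \<eta> / (real n + 1)"
    have "0 < h" using \<eta> by (simp add: h_def)
    moreover have "c - h / 2 < z i" using lt [of i] that by (simp add: h_def field_simps)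
    ultimately show ?thesis unfolding h_def [symmetric] by linarith
  qed
  then have "l1_dist {..n} z (\<lambda>_. c) < (\<Sum>i\<le>n. (z i - c) + \<eta> / (real n + 1))"
    unfolding l1_dist_def by (intro sum_strict_mono) auto
  also have "\<dots> = (\<Sum>i\<le>n. z i) - (real n + 1) * c + \<eta>"
    by (simp add: sum.distrib sum_subtractf add.commute)
  also have "\<dots> = \<eta>" using z by (simp add: geom_simplex_def c)
  finally show False using far by simp
qed

section \<open>Affine comparison of the standard simplex with a chart\<close>

definition simplex_to_chart :: "nat \<Rightarrow> (nat \<Rightarrow> real) \<Rightarrow> real \<Rightarrow> (nat \<Rightarrow> real) \<Rightarrow> nat \<Rightarrow> real" where
  "simplex_to_chart n a r z =
     (\<lambda>i. if i < n then a i + r * (z i - 1 / (real n + 1)) else 0)"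

definition chart_to_simplex :: "nat \<Rightarrow> (nat \<Rightarrow> real) \<Rightarrow> real \<Rightarrow> (nat \<Rightarrow> real) \<Rightarrow> nat \<Rightarrow> real" where
  "chart_to_simplex n a r w =
     (\<lambda>i. if i < n then 1 / (real n + 1) + (w i - a i) / r
          else if i = n then 1 - (\<Sum>j<n. 1 / (real n + 1) + (w j - a j) / r) else 0)"

text \<open>Each of the first \<open>n\<close> coordinates deviates from \<open>1 / (n + 1)\<close>
  by at most \<open>1 / (n + 1)\<^sup>2\<close>, and together they deviate by less than
  \<open>1 / (n + 1)\<close>. So neither they nor the last coordinate, which absorbs the total,
  becomes negative.\<close>

lemma chart_to_simplex_in_simplex:
  assumes r: "0 < r" and w: "\<And>i. i < n \<Longrightarrow> \<bar>w i - a i\<bar> \<le> r / (real n + 1)\<^sup>2"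
  shows "chart_to_simplex n a r w \<in> geom_simplex {..n}"
proof -
  let ?N = "real n + 1"
  have dev: "\<bar>(w i - a i) / r\<bar> \<le> 1 / ?N\<^sup>2" if "i < n" for i
    using w [OF that] r by (simp add: field_simps)
  have N: "1 / ?N\<^sup>2 \<le> 1 / ?N"
    by (intro divide_left_mono) (auto simp: power2_eq_square)
  have "(\<Sum>j<n. 1 / ?N + (w j - a j) / r) \<le> (\<Sum>j<n. 1 / ?N + 1 / ?N\<^sup>2)"
  proof (intro sum_mono add_left_mono)
    fix j assume "j \<in> {..<n}"
    then show "(w j - a j) / r \<le> 1 / ?N\<^sup>2" using abs_le_D1 [OF dev [of j]] by simp
  qed
  also have "\<dots> \<le> 1"
  proof -
    have "real n / ?N\<^sup>2 \<le> ?N / ?N\<^sup>2" by (intro divide_right_mono) auto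
    also have "?N / ?N\<^sup>2 = 1 / ?N" by (simp add: power2_eq_square)
    also have "1 / ?N = 1 - real n / ?N" by (simp add: field_simps)
    finally show ?thesis by (simp add: distrib_left)
  qed
  finally have last: "(\<Sum>j<n. 1 / ?N + (w j - a j) / r) \<le> 1" .
  have "0 \<le> chart_to_simplex n a r w i" for i
  proof (cases "i < n")
    case True
    then have "0 \<le> 1 / ?N + (w i - a i) / r" using dev [OF True] N by linarith
    then show ?thesis using True by (simp add: chart_to_simplex_def)
  qed (use last in \<open>auto simp: chart_to_simplex_def\<close>)
  moreover have "(\<Sum>i\<le>n. chart_to_simplex n a r w i) = 1"
  proof -
    have "(\<Sum>i\<le>n. chart_to_simplex n a r w i) =
        (\<Sum>i<n. chart_to_simplex n a r w i) + chart_to_simplex n a r w n"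
      by (metis lessThan_Suc_atMost sum.lessThan_Suc)
    also have "(\<Sum>i<n. chart_to_simplex n a r w i) = (\<Sum>j<n. 1 / ?N + (w j - a j) / r)"
      by (intro sum.cong) (auto simp: chart_to_simplex_def)
    finally show ?thesis by (simp add: chart_to_simplex_def)
  qed
  ultimately show ?thesis
    by (auto simp: geom_simplex_def chart_to_simplex_def)
qed

lemma simplex_to_chart_inverse:
  assumes "0 < r" "\<And>i. n \<le> i \<Longrightarrow> w i = 0"
  shows "simplex_to_chart n a r (chart_to_simplex n a r w) = w"
  using assms by (auto simp: simplex_to_chart_def chart_to_simplex_def fun_eq_iff)

lemma simplex_to_chart_centre:
  assumes r: "0 < r" and z: "z \<in> geom_simplex {..n}" and a: "simplex_to_chart n a r z = a"
    and i: "i \<le> n"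
  shows "z i = 1 / (real n + 1)"
proof -
  have lt: "z i = 1 / (real n + 1)" if "i < n" for i
    using fun_cong [OF a, of i] that r by (simp add: simplex_to_chart_def)
  have "1 = (\<Sum>i<n. z i) + z n"
    using z by (simp add: geom_simplex_def flip: lessThan_Suc_atMost)
  also have "(\<Sum>i<n. z i) = real n / (real n + 1)"
    using lt by simp
  finally have "z n = 1 / (real n + 1)" by (simp add: field_simps)
  then show ?thesis using lt i by (cases "i = n") auto
qed

lemma continuous_on_simplex_to_chart: "continuous_on S (simplex_to_chart n a r)"
proof (rule continuous_on_coordinatewise_then_product)
  fix i
  show "continuous_on S (\<lambda>z. simplex_to_chart n a r z i)"
    unfolding simplex_to_chart_def
    by (cases "i < n") (auto intro!: continuous_on_add continuous_on_mult continuous_on_diff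
        continuous_on_coordinate continuous_on_const)
qed

lemma continuous_on_chart_to_simplex:
  "r \<noteq> 0 \<Longrightarrow> continuous_on S (chart_to_simplex n a r)"
proof (rule continuous_on_coordinatewise_then_product)
  fix i assume "r \<noteq> 0"
  then show "continuous_on S (\<lambda>z. chart_to_simplex n a r z i)"
    unfolding chart_to_simplex_def
    by (cases "i < n"; cases "i = n") (auto intro!: continuous_on_add continuous_on_divide continuous_on_diff
        continuous_on_coordinate continuous_on_const continuous_on_sum)
qed

section \<open>Radial maps about the barycentre of a simplex\<close>

definition barycentre :: "'v set \<Rightarrow> 'v \<Rightarrow> real" where
  "barycentre \<sigma> = (\<lambda>v. if v \<in> \<sigma> then 1 / card \<sigma> else 0)"

lemma barycentre_in_geom_simplex:
  assumes "finite \<sigma>" "\<sigma> \<noteq> {}"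
  shows "barycentre \<sigma> \<in> geom_simplex \<sigma>"
  using assms by (auto simp: barycentre_def geom_simplex_def)

text \<open>The differences \<open>y v - barycentre \<sigma> v\<close> are nonnegative and sum to
  0.\<close>

lemma eq_barycentre:
  assumes "finite V" "\<sigma> \<subseteq> V" "\<sigma> \<noteq> {}" "y \<in> geom_simplex V" "\<And>v. v \<in> \<sigma> \<Longrightarrow> 1 / card \<sigma> \<le> y v"
  shows "y = barycentre \<sigma>"
proof -
  have fin: "finite \<sigma>" using assms finite_subset by blast
  have x: "barycentre \<sigma> \<in> geom_simplex V"
    using barycentre_in_geom_simplex [OF fin assms(3)] geom_simplex_mono [OF assms(1,2)] by blast
  have ge: "barycentre \<sigma> v \<le> y v" for v
    using assms(4,5) by (auto simp: barycentre_def geom_simplex_def)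
  have "(\<Sum>v\<in>V. y v - barycentre \<sigma> v) = 0"
    using x assms(4) by (simp add: sum_subtractf geom_simplex_def)
  then have "y v = barycentre \<sigma> v" if "v \<in> V" for v
    using sum_nonneg_eq_0_iff [of V "\<lambda>v. y v - barycentre \<sigma> v"] ge assms(1) that by simp
  moreover have "y v = barycentre \<sigma> v" if "v \<notin> V" for v
    using that x assms(4) by (simp add: geom_simplex_def)
  ultimately show ?thesis by blast
qed

text \<open>The radial coordinate \<open>depth \<sigma>\<close> vanishes exactly at the barycentre of \<open>\<sigma>\<close> and is 1 exactly outside
  the open star; \<open>expand \<sigma> t\<close> pushes \<open>depth \<sigma> y \<ge> t\<close> radially out of the open star.\<close>

definition depth :: "'v set \<Rightarrow> ('v \<Rightarrow> real) \<Rightarrow> real" where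
  "depth \<sigma> y = 1 - real (card \<sigma>) * Min (y ` \<sigma>)"

definition expand :: "'v set \<Rightarrow> real \<Rightarrow> ('v \<Rightarrow> real) \<Rightarrow> 'v \<Rightarrow> real" where
  "expand \<sigma> t y = (\<lambda>v. barycentre \<sigma> v + (y v - barycentre \<sigma> v) / max t (depth \<sigma> y))"

definition contract :: "'v set \<Rightarrow> real \<Rightarrow> ('v \<Rightarrow> real) \<Rightarrow> 'v \<Rightarrow> real" where
  "contract \<sigma> t y = (\<lambda>v. barycentre \<sigma> v + t * (y v - barycentre \<sigma> v))"

lemma continuous_on_depth: "finite \<sigma> \<Longrightarrow> \<sigma> \<noteq> {} \<Longrightarrow> continuous_on S (depth \<sigma>)"
  unfolding depth_def
  by (intro continuous_on_diff continuous_on_mult continuous_on_const continuous_on_Min_coordinates)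

lemma continuous_on_expand:
  assumes "finite \<sigma>" "\<sigma> \<noteq> {}" "0 < t"
  shows "continuous_on S (expand \<sigma> t)"
proof (rule continuous_on_coordinatewise_then_product)
  fix v
  have "max t (depth \<sigma> y) \<noteq> 0" for y using assms(3) by (simp add: max_def)
  then show "continuous_on S (\<lambda>y. expand \<sigma> t y v)"
    unfolding expand_def
    by (intro continuous_on_add continuous_on_const continuous_on_divide continuous_on_diff
        continuous_on_coordinate continuous_on_max continuous_on_depth assms) auto
qed

lemma continuous_on_contract: "continuous_on S (contract \<sigma> t)"
proof (rule continuous_on_coordinatewise_then_product)
  fix v
  show "continuous_on S (\<lambda>y. contract \<sigma> t y v)"
    unfolding contract_def
    by (intro continuous_on_add continuous_on_const continuous_on_mult continuous_on_diff continuous_on_coordinate)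
qed

context
  fixes X :: "'v set set" and V \<sigma> :: "'v set"
  assumes X: "finite_complex X" and V: "V = vertices X" and \<sigma>: "\<sigma> \<in> X"
begin

lemma centre_facts: "finite V" "finite \<sigma>" "\<sigma> \<noteq> {}" "\<sigma> \<subseteq> V" "0 < card \<sigma>"
  using finite_complexD [OF X] \<sigma> unfolding V card_gt_0_iff by blast+

lemma Min_coord:
  obtains v where "v \<in> \<sigma>" "y v = (1 - depth \<sigma> y) / card \<sigma>" "\<And>u. u \<in> \<sigma> \<Longrightarrow> (1 - depth \<sigma> y) / card \<sigma> \<le> y u"
proof -
  have fin: "finite (y ` \<sigma>)" "y ` \<sigma> \<noteq> {}" using centre_facts by auto
  have eq: "(1 - depth \<sigma> y) / card \<sigma> = Min (y ` \<sigma>)"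
    using centre_facts by (simp add: depth_def)
  have "Min (y ` \<sigma>) \<in> y ` \<sigma>" by (rule Min_in [OF fin])
  then obtain v where "v \<in> \<sigma>" "y v = Min (y ` \<sigma>)" by auto
  then show thesis using that [of v] Min_le [OF fin(1)] by (simp add: eq)
qed

lemma depth_pos:
  assumes "y \<in> geom_simplex V" "y \<noteq> barycentre \<sigma>"
  shows "0 < depth \<sigma> y"
proof (rule ccontr)
  assume "\<not> 0 < depth \<sigma> y"
  then have le: "1 / card \<sigma> \<le> (1 - depth \<sigma> y) / card \<sigma>"
    by (simp add: divide_right_mono)
  obtain v where "\<And>u. u \<in> \<sigma> \<Longrightarrow> (1 - depth \<sigma> y) / card \<sigma> \<le> y u"
    using Min_coord [of y] by blast
  then have "1 / card \<sigma> \<le> y u" if "u \<in> \<sigma>" for u using le that by fastforce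
  then show False
    using eq_barycentre [OF centre_facts(1,4,3) assms(1)] assms(2) by blast
qed

text \<open>The smallest coordinate on \<open>\<sigma>\<close> falls short of the barycentric value
  by the depth over \<open>card \<sigma>\<close>, so dividing deviations by at least the depth
  leaves it nonnegative. The support does not grow: at depth below 1 it already contains
  \<open>\<sigma>\<close>, and at depth 1 the divisor is 1 and the point is fixed.\<close>

lemma expand_in_realization:
  assumes y: "y \<in> realization X" and t: "0 < t" "t \<le> 1"
  shows "expand \<sigma> t y \<in> realization X"
proof -
  let ?m = "max t (depth \<sigma> y)" and ?x = "barycentre \<sigma>"
  have yV: "y \<in> geom_simplex V" "{v. y v \<noteq> 0} \<in> X"
    using y mem_realization_iff [OF X] by (auto simp: V)
  have xV: "?x \<in> geom_simplex V"
    using barycentre_in_geom_simplex geom_simplex_mono centre_facts by blast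
  have m: "0 < ?m" using t by simp
  obtain v where v: "v \<in> \<sigma>" "y v = (1 - depth \<sigma> y) / card \<sigma>"
    "\<And>u. u \<in> \<sigma> \<Longrightarrow> (1 - depth \<sigma> y) / card \<sigma> \<le> y u"
    using Min_coord [of y] by metis
  have nonneg: "0 \<le> expand \<sigma> t y u" for u
  proof (cases "u \<in> \<sigma>")
    case True
    have "- (depth \<sigma> y / card \<sigma>) \<le> y u - ?x u"
      using v(3) [OF True] True by (simp add: barycentre_def diff_divide_distrib)
    then have "- (depth \<sigma> y / card \<sigma>) / ?m \<le> (y u - ?x u) / ?m"
      using m by (intro divide_right_mono) auto
    moreover have "depth \<sigma> y / card \<sigma> / ?m \<le> 1 / card \<sigma>"
    proof -
      have "depth \<sigma> y / ?m \<le> 1" using m by (simp add: divide_le_eq)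
      then have "depth \<sigma> y / ?m / card \<sigma> \<le> 1 / card \<sigma>" by (intro divide_right_mono) auto
      then show ?thesis by (simp add: mult.commute)
    qed
    ultimately show ?thesis using True by (simp add: expand_def barycentre_def)
  next
    case False
    then show ?thesis using yV(1) m by (simp add: expand_def barycentre_def geom_simplex_def)
  qed
  have out: "expand \<sigma> t y u = 0" if "u \<notin> V" for u
    using that xV yV(1) by (simp add: expand_def geom_simplex_def)
  have "(\<Sum>u\<in>V. expand \<sigma> t y u) = (\<Sum>u\<in>V. ?x u) + ((\<Sum>u\<in>V. y u) - (\<Sum>u\<in>V. ?x u)) / ?m"
    by (simp add: expand_def sum.distrib sum_subtractf flip: sum_divide_distrib)
  also have "\<dots> = 1" using xV yV(1) by (simp add: geom_simplex_def)
  finally have sum1: "(\<Sum>u\<in>V. expand \<sigma> t y u) = 1" .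
  then have geom: "expand \<sigma> t y \<in> geom_simplex V"
    using nonneg out by (simp add: geom_simplex_def)
  have "{u. expand \<sigma> t y u \<noteq> 0} \<in> X"
  proof (cases "depth \<sigma> y < 1")
    case True
    then have "0 < (1 - depth \<sigma> y) / card \<sigma>" using centre_facts(5) by simp
    then have "y u \<noteq> 0" if "u \<in> \<sigma>" for u using v(3) [OF that] by linarith
    then have "{u. expand \<sigma> t y u \<noteq> 0} \<subseteq> {u. y u \<noteq> 0}"
      by (auto simp: expand_def barycentre_def)
    moreover have "{u. expand \<sigma> t y u \<noteq> 0} \<noteq> {}"
    proof
      assume "{u. expand \<sigma> t y u \<noteq> 0} = {}"
      then have "\<And>u. expand \<sigma> t y u = 0" by blast
      then show False using sum1 by simp
    qed
    ultimately show ?thesis using finite_complexD(6) [OF X yV(2)] by blast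
  next
    case False
    have "0 \<le> y v" using yV(1) by (simp add: geom_simplex_def)
    then have "depth \<sigma> y \<le> 1" using v(2) centre_facts(5) by (simp add: zero_le_divide_iff)
    then have "?m = 1" using False t by simp
    then have "expand \<sigma> t y = y" by (simp add: expand_def)
    then show ?thesis using yV(2) by simp
  qed
  then show ?thesis using geom mem_realization_iff [OF X] by (simp add: V)
qed

text \<open>The divisor is here the depth itself, and with it the smallest coordinate on
  \<open>\<sigma>\<close> reaches exactly 0.\<close>

lemma expand_avoids:
  assumes "t \<le> depth \<sigma> y" "0 < t"
  shows "\<exists>v\<in>\<sigma>. expand \<sigma> t y v = 0"
proof -
  obtain v where v: "v \<in> \<sigma>" "y v = (1 - depth \<sigma> y) / card \<sigma>"
    using Min_coord [of y] by metis
  have "expand \<sigma> t y v = 1 / card \<sigma> + ((1 - depth \<sigma> y) / card \<sigma> - 1 / card \<sigma>) / depth \<sigma> y"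
    using v assms by (simp add: expand_def barycentre_def)
  also have "(1 - depth \<sigma> y) / card \<sigma> - 1 / card \<sigma> = - (1 / card \<sigma>) * depth \<sigma> y"
    by (simp add: diff_divide_distrib)
  finally have "expand \<sigma> t y v = 0" using assms by simp
  then show ?thesis using v(1) by blast
qed

lemma contract_in_realization:
  assumes \<tau>: "\<tau> \<in> star_closed X \<sigma>" and y: "y \<in> geom_simplex \<tau>" and t: "0 \<le> t" "t \<le> 1"
  shows "contract \<sigma> t y \<in> realization X"
proof -
  have \<tau>X: "\<tau> \<union> \<sigma> \<in> X" using \<tau> by (simp add: star_closed_def)
  then have fin: "finite (\<tau> \<union> \<sigma>)" using finite_complexD(3) [OF X] by blast
  have yx: "y \<in> geom_simplex (\<tau> \<union> \<sigma>)" "barycentre \<sigma> \<in> geom_simplex (\<tau> \<union> \<sigma>)"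
    using y barycentre_in_geom_simplex centre_facts geom_simplex_mono [OF fin] by blast+
  have "contract \<sigma> t y = (\<lambda>i. (1 - t) * barycentre \<sigma> i + t * y i)"
    by (simp add: contract_def fun_eq_iff algebra_simps)
  then have "contract \<sigma> t y \<in> geom_simplex (\<tau> \<union> \<sigma>)"
    using coord_convex_geom_simplex yx t unfolding coord_convex_def by metis
  then show ?thesis using geom_simplex_subset_realization [OF X \<tau>X] by blast
qed

text \<open>Outside \<open>\<sigma>\<close> both maps only rescale the coordinate. If a vertex of
  \<open>\<sigma>\<close> is missing from \<open>\<tau>\<close>, then \<open>y\<close> vanishes
  there, the contracted point has depth exactly \<open>t\<close>, and since
  \<open>t' \<le> t\<close> the expansion divides by \<open>t\<close>, undoing the
  contraction.\<close>

lemma expand_contract_support: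
  assumes \<tau>: "\<tau> \<in> star_closed X \<sigma>" and y: "y \<in> geom_simplex \<tau>" and t: "0 < t" "t' \<le> t" "t \<le> 1"
  shows "{v. expand \<sigma> t' (contract \<sigma> t y) v \<noteq> 0} \<subseteq> \<tau>"
proof -
  have "expand \<sigma> t' (contract \<sigma> t y) v = 0" if v: "v \<notin> \<tau>" for v
  proof (cases "v \<in> \<sigma>")
    case False
    then show ?thesis using y v by (simp add: expand_def contract_def barycentre_def geom_simplex_def)
  next
    case True
    have yv: "y v = 0" using y v by (simp add: geom_simplex_def)
    have "Min (contract \<sigma> t y ` \<sigma>) = (1 - t) / card \<sigma>"
    proof (rule Min_eqI)
      show "finite (contract \<sigma> t y ` \<sigma>)" using centre_facts by simp
      show "(1 - t) / card \<sigma> \<in> contract \<sigma> t y ` \<sigma>"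
        using True yv by (intro image_eqI [of _ _ v]) (simp_all add: contract_def barycentre_def diff_divide_distrib)
      fix u assume "u \<in> contract \<sigma> t y ` \<sigma>"
      then obtain w where w: "w \<in> \<sigma>" "u = contract \<sigma> t y w" by blast
      have "0 \<le> t * y w" using y t by (simp add: geom_simplex_def)
      then show "(1 - t) / card \<sigma> \<le> u"
        using w by (simp add: contract_def barycentre_def diff_divide_distrib right_diff_distrib)
    qed
    then have "depth \<sigma> (contract \<sigma> t y) = t"
      using centre_facts(5) by (simp add: depth_def)
    then have "max t' (depth \<sigma> (contract \<sigma> t y)) = t" using t by simp
    then show ?thesis using yv t by (simp add: expand_def contract_def)
  qed
  then show ?thesis by blast
qed

end

text \<open>A neighbourhood of the barycentre of \<open>\<sigma>\<close> is charted; \<open>p\<close> contracts the star into it and \<open>q\<close>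
  expands a small Euclidean simplex around the image of the barycentre back over the star.\<close>

theorem locally_euclidean_local_functional:
  fixes X :: "'v set set"
  assumes X: "finite_complex X" and \<sigma>: "\<sigma> \<in> X"
    and chart: "locally_euclidean_at n (realization X) (barycentre \<sigma>)"
  shows "\<exists>\<Lambda>. local_functional X n \<sigma> \<Lambda>"
proof -
  let ?V = "vertices X" and ?R = "realization X" and ?x = "barycentre \<sigma>"
  let ?E = "{w :: nat \<Rightarrow> real. \<forall>i\<ge>n. w i = 0}" and ?\<Delta> = "geom_simplex {..n}"
  let ?St = "\<Union>\<tau>\<in>star_closed X \<sigma>. geom_simplex \<tau>"
  define c where "c = 1 / (real n + 1)"
  have c: "0 < c" by (simp add: c_def)
  note sf = centre_facts [OF X refl \<sigma>]
  obtain U W h g where U: "openin (top_of_set ?R) U" "?x \<in> U" and W: "openin (top_of_set ?E) W"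
    and hg: "homeomorphism U W h g"
    using chart unfolding locally_euclidean_at_def by blast
  have UR: "U \<subseteq> ?R" and WE: "W \<subseteq> ?E"
    using U W openin_imp_subset by blast+
  have h: "continuous_on U h" "\<And>y. y \<in> U \<Longrightarrow> h y \<in> W" "\<And>y. y \<in> U \<Longrightarrow> g (h y) = y"
    and g: "continuous_on W g" "\<And>w. w \<in> W \<Longrightarrow> g w \<in> U" "\<And>w. w \<in> W \<Longrightarrow> h (g w) = w"
    using hg unfolding homeomorphism_def by blast+
  define a where "a = h ?x"
  have aW: "a \<in> W" using h(2) U(2) by (simp add: a_def)
  then have a0: "a i = 0" if "n \<le> i" for i using WE that by blast
  obtain F e\<^sub>0 where "finite F" and e0: "0 < e\<^sub>0" and "\<forall>w\<in>?E. (\<forall>i\<in>F. \<bar>w i - a i\<bar> < e\<^sub>0) \<longrightarrow> w \<in> W"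
    by (rule coordinate_neighbourhood [OF W aW])
  then have FW: "w \<in> W" if "w \<in> ?E" "\<And>i. \<bar>w i - a i\<bar> < e\<^sub>0" for w
    using that by blast
  \<comment> \<open>Coordinates in the standard simplex differ from \<open>c\<close> by at most 1,
    so with a scale below \<open>e\<^sub>0\<close> the map \<open>L\<close> stays in the box
    contained in \<open>W\<close>.\<close>
  define r where "r = e\<^sub>0 / 2"
  have r: "0 < r" "r < e\<^sub>0" using e0 by (simp_all add: r_def)
  define L where "L = simplex_to_chart n a r"
  define L' where "L' = chart_to_simplex n a r"
  have LW: "L z \<in> W" if z: "z \<in> ?\<Delta>" for z
  proof (rule FW)
    show "L z \<in> ?E" by (simp add: L_def simplex_to_chart_def)
    fix i
    show "\<bar>L z i - a i\<bar> < e\<^sub>0"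
    proof (cases "i < n")
      case True
      have zi: "0 \<le> z i" "z i \<le> 1"
        using z member_le_sum [of i "{..n}" z] True by (auto simp: geom_simplex_def)
      have "c \<le> 1" by (simp add: c_def)
      then have "\<bar>z i - c\<bar> \<le> 1" using zi c by (simp add: abs_le_iff)
      then have "r * \<bar>z i - c\<bar> \<le> r * 1" using r by (intro mult_left_mono) auto
      then have "r * \<bar>z i - c\<bar> < e\<^sub>0" using r by linarith
      then show ?thesis using True r by (simp add: L_def simplex_to_chart_def abs_mult flip: c_def)
    next
      case False
      then show ?thesis using a0 e0 by (simp add: L_def simplex_to_chart_def)
    qed
  qed
  \<comment> \<open>The radius within which \<open>chart_to_simplex\<close> lands in the standard
    simplex. The set \<open>N\<close> is the neighbourhood of the barycentre that \<open>h\<close>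
    sends into this box.\<close>
  define \<eta> where "\<eta> = r / (real n + 1)\<^sup>2"
  have \<eta>: "0 < \<eta>" using r by (simp add: \<eta>_def)
  define N where "N = U \<inter> h -` (\<Inter>i<n. {w. \<bar>w i - a i\<bar> < \<eta>})"
  have "open (\<Inter>i<n. {w :: nat \<Rightarrow> real. \<bar>w i - a i\<bar> < \<eta>})"
  proof (intro open_INT ballI)
    fix i
    have "continuous_on UNIV (\<lambda>w :: nat \<Rightarrow> real. \<bar>w i - a i\<bar>)"
      by (intro continuous_on_rabs continuous_on_diff continuous_on_coordinate continuous_on_const)
    then show "open {w :: nat \<Rightarrow> real. \<bar>w i - a i\<bar> < \<eta>}"
      by (intro open_Collect_less continuous_on_const)
  qed simp
  then have "openin (top_of_set U) N"
    unfolding N_def by (intro continuous_openin_preimage_gen h(1))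
  then have "openin (top_of_set ?R) N" using U(1) openin_trans by blast
  moreover have "?x \<in> N" using U(2) \<eta> by (simp add: N_def a_def)
  ultimately obtain F' e' where "finite F'" and e': "0 < e'" and "\<forall>y\<in>?R. (\<forall>v\<in>F'. \<bar>y v - ?x v\<bar> < e') \<longrightarrow> y \<in> N"
    by (rule coordinate_neighbourhood)
  then have FN: "y \<in> N" if "y \<in> ?R" "\<And>v. \<bar>y v - ?x v\<bar> < e'" for y
    using that by blast
  \<comment> \<open>Coordinates of points of a simplex differ by at most 1, so contracting by a
    factor below \<open>e'\<close> brings the whole closed star into \<open>N\<close>.\<close>
  define t where "t = min 1 e' / 2"
  have t: "0 < t" "t \<le> 1" "t < e'" using e' by (auto simp: t_def min_def)
  have contrN: "contract \<sigma> t y \<in> N" if "y \<in> ?St" for y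
  proof -
    obtain \<tau> where \<tau>: "\<tau> \<in> star_closed X \<sigma>" "y \<in> geom_simplex \<tau>" using \<open>y \<in> ?St\<close> by blast
    have y01: "0 \<le> z v \<and> z v \<le> 1" if "z \<in> geom_simplex (\<tau> \<union> \<sigma>)" for z v
    proof -
      have "finite (\<tau> \<union> \<sigma>)" using \<tau>(1) finite_complexD(3) [OF X] by (auto simp: star_closed_def)
      then show ?thesis
        using that member_le_sum [of v "\<tau> \<union> \<sigma>" z] by (cases "v \<in> \<tau> \<union> \<sigma>") (auto simp: geom_simplex_def)
    qed
    have fin: "finite (\<tau> \<union> \<sigma>)" using \<tau>(1) finite_complexD(3) [OF X] by (auto simp: star_closed_def)
    have mem: "y \<in> geom_simplex (\<tau> \<union> \<sigma>)" "?x \<in> geom_simplex (\<tau> \<union> \<sigma>)"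
      using \<tau>(2) barycentre_in_geom_simplex [OF sf(2,3)] geom_simplex_mono [OF fin] by blast+
    show ?thesis
    proof (rule FN)
      show "contract \<sigma> t y \<in> ?R"
        using contract_in_realization [OF X refl \<sigma> \<tau>] t by simp
      fix v
      have "\<bar>y v - ?x v\<bar> \<le> 1" using y01 [OF mem(1), of v] y01 [OF mem(2), of v] by (simp add: abs_le_iff)
      then have "t * \<bar>y v - ?x v\<bar> \<le> t * 1" using t by (intro mult_left_mono) auto
      then have "t * \<bar>y v - ?x v\<bar> < e'" using t by linarith
      then show "\<bar>contract \<sigma> t y v - ?x v\<bar> < e'" using t by (simp add: contract_def abs_mult)
    qed
  qed
  then have contrU: "contract \<sigma> t y \<in> U" if "y \<in> ?St" for y using that by (auto simp: N_def)
  define p where "p y = L' (h (contract \<sigma> t y))" for y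
  have p\<Delta>: "p y \<in> ?\<Delta>" if "y \<in> ?St" for y
    unfolding p_def L'_def
    by (rule chart_to_simplex_in_simplex [OF r(1)])
       (use contrN [OF that] in \<open>auto simp: N_def \<eta>_def intro: less_imp_le\<close>)
  have Lp: "L (p y) = h (contract \<sigma> t y)" if "y \<in> ?St" for y
    unfolding p_def L_def L'_def
    by (rule simplex_to_chart_inverse [OF r(1)]) (use h(2) [OF contrU [OF that]] WE in blast)
  have star: "finite (star_closed X \<sigma>)" "\<And>\<tau>. \<tau> \<in> star_closed X \<sigma> \<Longrightarrow> finite \<tau> \<and> \<tau> \<subseteq> ?V"
  proof -
    show *: "finite \<tau> \<and> \<tau> \<subseteq> ?V" if "\<tau> \<in> star_closed X \<sigma>" for \<tau>
      using that finite_complexD(3,5) [OF X, of "\<tau> \<union> \<sigma>"] by (auto simp: star_closed_def)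
    show "finite (star_closed X \<sigma>)"
      by (rule finite_subset [of _ "Pow ?V"]) (use * sf in auto)
  qed
  have St: "compact ?St"
    by (intro compact_UN star compact_geom_simplex) (use star in blast)
  have pc: "continuous_on ?St p"
    unfolding p_def
    by (rule continuous_on_compose2 [OF continuous_on_chart_to_simplex [of r UNIV n a, folded L'_def]])
       (use r in \<open>auto intro!: continuous_on_compose2 [OF h(1) continuous_on_contract] contrU\<close>)
  have centre: "z i = c" if "z \<in> ?\<Delta>" "L z = a" "i \<le> n" for z i
    using simplex_to_chart_centre [OF r(1) that(1) _ that(3)] that(2) by (simp add: L_def c_def)

  \<comment> \<open>The closed star minus the open star. It does not contain the barycentre of
    \<open>\<sigma>\<close>, and \<open>L\<close> after \<open>p\<close> is \<open>h\<close> after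
    the contraction, which is injective; so \<open>p\<close> misses the centre of the standard
    simplex, uniformly by compactness.\<close>
  let ?K1 = "\<Union>\<tau>\<in>{\<tau> \<in> star_closed X \<sigma>. \<not> \<sigma> \<subseteq> \<tau>}. geom_simplex \<tau>"
  have K1: "compact ?K1"
    by (intro compact_UN compact_geom_simplex) (use star in auto)
  have K1c: "continuous_on ?K1 (\<lambda>y. l1_dist {..n} (p y) (\<lambda>_. c))"
    by (intro continuous_on_l1_dist continuous_on_const continuous_on_subset [OF pc]) auto
  have K1pos: "0 < l1_dist {..n} (p y) (\<lambda>_. c)" if y: "y \<in> ?K1" for y
  proof (rule ccontr)
    assume "\<not> ?thesis"
    then have "l1_dist {..n} (p y) (\<lambda>_. c) = 0" using l1_dist_nonneg [of "{..n}" "p y" "\<lambda>_. c"] by linarith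
    then have pe: "p y i = c" if "i \<le> n" for i
      using abs_coord_le_l1_dist [of "{..n}" i "p y" "\<lambda>_. c"] that by simp
    obtain \<tau> v where \<tau>: "\<tau> \<in> star_closed X \<sigma>" "y \<in> geom_simplex \<tau>" "v \<in> \<sigma>" "v \<notin> \<tau>" using y by blast
    then have ySt: "y \<in> ?St" by blast
    have "L (p y) = a"
      using pe a0 by (auto simp: L_def simplex_to_chart_def fun_eq_iff c_def)
    then have "h (contract \<sigma> t y) = h ?x"
      unfolding Lp [OF ySt] a_def .
    then have "contract \<sigma> t y = ?x"
      using h(3) [OF contrU [OF ySt]] h(3) [OF U(2)] by argo
    then have "contract \<sigma> t y v = ?x v" by simp
    then have "y v = ?x v" using t by (simp add: contract_def)
    then show False using \<tau> sf by (simp add: geom_simplex_def barycentre_def)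
  qed
  obtain \<eta>\<^sub>1 where \<eta>1: "0 < \<eta>\<^sub>1" "\<And>y. y \<in> ?K1 \<Longrightarrow> \<eta>\<^sub>1 \<le> l1_dist {..n} (p y) (\<lambda>_. c)"
    using compact_positive_lower_bound [OF K1 K1c K1pos] by blast
  \<comment> \<open>The gap provided by \<open>low_coordinate\<close>. The next constant is placed
    strictly between \<open>c - \<delta>\<close> and \<open>c\<close>, the term \<open>c / 2\<close>
    keeping it positive.\<close>
  define \<delta> where "\<delta> = \<eta>\<^sub>1 / (2 * (real n + 1))"
  have \<delta>: "0 < \<delta>" using \<eta>1 by (simp add: \<delta>_def)
  define d\<^sub>0 where "d\<^sub>0 = c - min (c / 2) (\<delta> / 2)"
  have d0: "c - \<delta> < d\<^sub>0" "d\<^sub>0 < c" "0 < d\<^sub>0" using c \<delta> by (auto simp: d\<^sub>0_def min_def)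

  \<comment> \<open>The centre has all coordinates equal to \<open>c > d\<^sub>0\<close>, so it is
    not in this set, and the depth of the corresponding points of the realization has a positive
    lower bound \<open>t\<^sub>0\<close>.\<close>
  let ?K2 = "\<Union>i\<in>{..n}. {z \<in> ?\<Delta>. z i \<le> d\<^sub>0}"
  have gL: "g (L z) \<in> ?R" if "z \<in> ?\<Delta>" for z using g(2) LW [OF that] UR by blast
  have gLc: "continuous_on ?\<Delta> (\<lambda>z. g (L z))"
    by (rule continuous_on_compose2 [OF g(1) continuous_on_simplex_to_chart [of _ n a r, folded L_def]])
       (use LW in auto)
  have K2: "compact ?K2"
    by (intro compact_UN compact_sublevel compact_geom_simplex continuous_on_coordinate) auto
  have K2c: "continuous_on ?K2 (\<lambda>z. depth \<sigma> (g (L z)))"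
    by (rule continuous_on_compose2 [OF continuous_on_depth [OF sf(2,3), of UNIV] continuous_on_subset [OF gLc]]) auto
  have K2pos: "0 < depth \<sigma> (g (L z))" if z: "z \<in> ?K2" for z
  proof (rule depth_pos [OF X refl \<sigma>])
    have z\<Delta>: "z \<in> ?\<Delta>" using z by blast
    show "g (L z) \<in> geom_simplex ?V" using gL [OF z\<Delta>] mem_realization_iff [OF X] by blast
    show "g (L z) \<noteq> ?x"
    proof
      assume "g (L z) = ?x"
      then have "L z = a" using g(3) [OF LW [OF z\<Delta>]] by (simp add: a_def)
      then show False using centre [OF z\<Delta>] z d0(2) by fastforce
    qed
  qed
  obtain t\<^sub>0 where t0: "0 < t\<^sub>0" "\<And>z. z \<in> ?K2 \<Longrightarrow> t\<^sub>0 \<le> depth \<sigma> (g (L z))"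
    using compact_positive_lower_bound [OF K2 K2c K2pos] by blast
  \<comment> \<open>At most \<open>t\<^sub>0\<close>, so that \<open>q\<close> moves all of
    \<open>?K2\<close> out of the open star; at most \<open>t\<close>, so that expanding undoes the
    contraction in \<open>p\<close>.\<close>
  define t' where "t' = min t t\<^sub>0"
  have t': "0 < t'" "t' \<le> t" "t' \<le> t\<^sub>0" "t' \<le> 1" using t t0 by (auto simp: t'_def)
  define q where "q z = expand \<sigma> t' (g (L z))" for z
  have qR: "q z \<in> ?R" if "z \<in> ?\<Delta>" for z
    unfolding q_def using expand_in_realization [OF X refl \<sigma> gL [OF that]] t' by blast
  have qc: "continuous_on ?\<Delta> q"
    unfolding q_def
    by (rule continuous_on_compose2 [OF continuous_on_expand [OF sf(2,3) t'(1), of UNIV] gLc]) auto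

  show ?thesis
  proof (rule local_functional_of_comparison [OF X refl \<sigma>, of p n q "c - \<delta>" d\<^sub>0])
    show "p y \<in> ?\<Delta>" if "\<tau> \<in> star_closed X \<sigma>" "y \<in> geom_simplex \<tau>" for \<tau> y
      using p\<Delta> that by blast
    show "q z \<in> geom_simplex ?V \<and> {v. q z v \<noteq> 0} \<in> X" if "z \<in> ?\<Delta>" for z
      using qR [OF that] mem_realization_iff [OF X] by blast
    show "\<exists>d>0. \<forall>\<tau>\<in>star_closed X \<sigma>. \<forall>y\<in>geom_simplex \<tau>. \<forall>y'\<in>geom_simplex \<tau>.
        l1_dist ?V y y' < d \<longrightarrow> l1_dist {..n} (p y) (p y') < e" if e: "0 < e" for e
    proof -
      have "y = y'" if "y \<in> ?St" "y' \<in> ?St" "\<And>v. v \<in> ?V \<Longrightarrow> y v = y' v" for y y'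
      proof
        fix v
        have "y v = 0 \<and> y' v = 0" if "v \<notin> ?V"
          using that \<open>y \<in> ?St\<close> \<open>y' \<in> ?St\<close> star(2) unfolding geom_simplex_def by blast
        then show "y v = y' v" using that by metis
      qed
      then show ?thesis
        using l1_uniformly_continuous [OF St pc sf(1) _ e, of "{..n}"] by blast
    qed
    show "\<exists>d>0. \<forall>z\<in>?\<Delta>. \<forall>z'\<in>?\<Delta>. l1_dist {..n} z z' < d \<longrightarrow> l1_dist ?V (q z) (q z') < e" if e: "0 < e" for e
    proof -
      have "z = z'" if "z \<in> ?\<Delta>" "z' \<in> ?\<Delta>" "\<And>i. i \<in> {..n} \<Longrightarrow> z i = z' i" for z z'
        using that unfolding geom_simplex_def by (intro ext) (metis (mono_tags, lifting) mem_Collect_eq)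
      then show ?thesis
        using l1_uniformly_continuous [OF compact_geom_simplex qc, of "{..n}" e ?V] e by blast
    qed
    show "{v. q (p y) v \<noteq> 0} \<subseteq> \<tau>" if \<tau>: "\<tau> \<in> star_closed X \<sigma>" "y \<in> geom_simplex \<tau>" for \<tau> y
    proof -
      have ySt: "y \<in> ?St" using \<tau> by blast
      have "q (p y) = expand \<sigma> t' (contract \<sigma> t y)"
        using Lp [OF ySt] h(3) [OF contrU [OF ySt]] by (simp add: q_def)
      then show ?thesis
        using expand_contract_support [OF X refl \<sigma> \<tau> t(1) t'(2) t(2)] by simp
    qed
    show "\<exists>i\<le>n. p y i \<le> c - \<delta>" if \<tau>: "\<tau> \<in> star_closed X \<sigma>" "\<not> \<sigma> \<subseteq> \<tau>" "y \<in> geom_simplex \<tau>" for \<tau> y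
      unfolding \<delta>_def by (rule low_coordinate [OF _ c_def \<eta>1(1) \<eta>1(2)]) (use p\<Delta> \<tau> in blast)+
    show "\<exists>v\<in>\<sigma>. q z v = 0" if z: "z \<in> ?\<Delta>" "i \<le> n" "z i < d\<^sub>0" for z i
    proof -
      have "z \<in> ?K2" using z by force
      then show ?thesis
        unfolding q_def using expand_avoids [OF X refl \<sigma> _ t'(1)] t0(2) t'(3) by (meson order_trans)
    qed
    show "c - \<delta> < d\<^sub>0" "d\<^sub>0 < 1 / (real n + 1)" "0 < d\<^sub>0"
      using d0 by (auto simp: c_def)
  qed
qed

section \<open>Combinatorics of a triangulated manifold\<close>

definition restrict_star :: "'v set \<Rightarrow> ('v set bit_chain) \<Rightarrow> ('v set bit_chain)" where
  "restrict_star \<sigma> = linext (\<lambda>\<tau>. if \<sigma> \<subseteq> \<tau> then gen \<tau> else 0)"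

lemma lookup_restrict_star: "lookup (restrict_star \<sigma> c) \<tau> = (if \<sigma> \<subseteq> \<tau> then lookup c \<tau> else 0)"
proof -
  have "lookup (restrict_star \<sigma> c) \<tau> = (\<Sum>\<rho>\<in>keys c. if \<rho> = \<tau> \<and> \<sigma> \<subseteq> \<tau> then 1 else 0)"
    unfolding restrict_star_def linext_def lookup_sum
    by (intro sum.cong) (auto simp: lookup_single when_def)
  also have "\<dots> = (if \<sigma> \<subseteq> \<tau> then lookup c \<tau> else 0)"
    by (auto simp: in_keys_iff)
  finally show ?thesis .
qed

lemma keys_restrict_star: "keys (restrict_star \<sigma> c) = {\<tau> \<in> keys c. \<sigma> \<subseteq> \<tau>}"
  by (auto simp: in_keys_iff lookup_restrict_star split: if_splits)

lemma keys_add_restrict_star: "\<tau> \<in> keys (c + restrict_star \<sigma> c) \<Longrightarrow> \<tau> \<in> keys c \<and> \<not> \<sigma> \<subseteq> \<tau>"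
  by (auto simp: in_keys_iff lookup_add lookup_restrict_star split: if_splits)

lemma keys_set_bdE:
  assumes "\<rho> \<in> keys (set_bd E c)"
  obtains \<tau> v where "\<tau> \<in> keys c" "v \<in> \<tau>" "v \<in> E" "\<rho> = \<tau> - {v}"
  using assms keys_set_bd_subset [of E c] by blast

text \<open>The discarded simplices do not contain \<open>\<sigma>\<close>, so neither do their
  faces.\<close>

lemma keys_set_bd_restrict_star:
  assumes "\<rho> \<in> keys (set_bd UNIV (restrict_star \<sigma> c))" "\<sigma> \<subseteq> \<rho>"
  shows "\<rho> \<in> keys (set_bd UNIV c)"
proof (rule ccontr)
  let ?d = "c + restrict_star \<sigma> c"
  assume "\<rho> \<notin> keys (set_bd UNIV c)"
  then have "\<rho> \<in> keys (set_bd UNIV ?d)"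
    using assms(1) by (simp add: in_keys_bit_iff lookup_add)
  then obtain \<tau> v where "\<tau> \<in> keys ?d" "\<rho> = \<tau> - {v}"
    by (rule keys_set_bdE)
  then show False using keys_add_restrict_star assms(2) by blast
qed

lemma lookup_face_bd:
  assumes "finite \<tau>"
  shows "lookup (face_bd E \<tau>) \<rho> = (if \<exists>v\<in>\<tau> \<inter> E. \<rho> = \<tau> - {v} then 1 else 0)"
proof (cases "\<exists>v\<in>\<tau> \<inter> E. \<rho> = \<tau> - {v}")
  case True
  then obtain v where v: "v \<in> \<tau> \<inter> E" "\<rho> = \<tau> - {v}" by blast
  have "lookup (face_bd E \<tau>) \<rho> = (\<Sum>u\<in>\<tau> \<inter> E. if u = v then 1 else 0)"
    unfolding face_bd_def lookup_sum
    by (intro sum.cong) (use v in \<open>auto simp: lookup_single when_def\<close>)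
  also have "\<dots> = 1" using v assms by simp
  finally show ?thesis using True by simp
next
  case False
  then have "\<rho> \<notin> keys (face_bd E \<tau>)" using keys_face_bd_subset [of E \<tau>] by blast
  then show ?thesis using False by (simp add: in_keys_iff)
qed

lemma lookup_face_bd_codim1:
  assumes "finite \<tau>" "card \<tau> = Suc (card \<rho>)"
  shows "lookup (face_bd UNIV \<tau>) \<rho> = (if \<rho> \<subseteq> \<tau> then 1 else 0)"
proof -
  have "(\<exists>v\<in>\<tau>. \<rho> = \<tau> - {v}) \<longleftrightarrow> \<rho> \<subseteq> \<tau>"
  proof
    assume "\<rho> \<subseteq> \<tau>"
    then have "card (\<tau> - \<rho>) = 1" using assms by (simp add: card_Diff_subset finite_subset)
    then obtain v where "\<tau> - \<rho> = {v}" by (auto simp: card_1_singleton_iff)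
    then show "\<exists>v\<in>\<tau>. \<rho> = \<tau> - {v}" using \<open>\<rho> \<subseteq> \<tau>\<close> by blast
  qed blast
  then show ?thesis using assms(1) by (simp add: lookup_face_bd)
qed

lemma lookup_set_bd: "lookup (set_bd E c) \<rho> = (\<Sum>\<tau>\<in>keys c. lookup (face_bd E \<tau>) \<rho>)"
  by (simp add: set_bd_def linext_def lookup_sum)

text \<open>What is kept of the manifold. Its compactness is reflected in the finiteness of
  \<open>X\<close>.\<close>

locale triangulated_manifold =
  fixes X :: "'v set set" and n :: nat
  assumes complex: "finite_complex X"
    and nonempty: "X \<noteq> {}"
    and chart: "\<And>x. x \<in> realization X \<Longrightarrow> locally_euclidean_at n (realization X) x"
    and conn: "connected (realization X)"
begin

lemmas complexD = finite_complexD [OF complex]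

lemma ex_local_functional:
  assumes "\<sigma> \<in> X"
  obtains \<Lambda> where "local_functional X n \<sigma> \<Lambda>"
proof -
  have "barycentre \<sigma> \<in> realization X"
    using barycentre_in_geom_simplex complexD(3,4) [OF assms]
      geom_simplex_subset_realization [OF complex assms] by blast
  then show thesis
    using that locally_euclidean_local_functional [OF complex assms chart] by blast
qed

lemma local_functionalD:
  assumes "local_functional X n \<sigma> \<Lambda>" "keys c \<subseteq> {\<tau> \<in> X. \<sigma> \<subseteq> \<tau> \<and> card \<tau> = Suc k}"
    "\<forall>\<rho>\<in>keys (set_bd UNIV c). \<not> \<sigma> \<subseteq> \<rho>" "k = n \<Longrightarrow> \<Lambda> c = 0"
  obtains b where "keys b \<subseteq> {\<tau> \<in> X. card \<tau> = Suc (Suc k)}" "\<forall>\<rho>\<in>keys (c + set_bd UNIV b). \<not> \<sigma> \<subseteq> \<rho>"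
proof -
  have "keys c \<subseteq> {\<tau> \<in> star_closed X \<sigma>. card \<tau> = Suc k}"
    using assms(2) by (auto simp: star_closed_def Un_absorb2)
  then have "\<exists>b. keys b \<subseteq> {\<tau> \<in> X. card \<tau> = Suc (Suc k)} \<and> (\<forall>\<rho>\<in>keys (c + set_bd UNIV b). \<not> \<sigma> \<subseteq> \<rho>)"
    using assms(1,3,4) unfolding local_functional_def by simp
  then show thesis by (elim exE conjE) (rule that)
qed

lemma local_cycle_bounds_off_dim:
  assumes "\<sigma> \<in> X" "k \<noteq> n" "keys c \<subseteq> {\<tau> \<in> X. \<sigma> \<subseteq> \<tau> \<and> card \<tau> = Suc k}"
    "\<forall>\<rho>\<in>keys (set_bd UNIV c). \<not> \<sigma> \<subseteq> \<rho>"
  obtains b where "keys b \<subseteq> {\<tau> \<in> X. card \<tau> = Suc (Suc k)}" "\<forall>\<rho>\<in>keys (c + set_bd UNIV b). \<not> \<sigma> \<subseteq> \<rho>"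
proof -
  obtain \<Lambda> where "local_functional X n \<sigma> \<Lambda>" by (rule ex_local_functional [OF assms(1)])
  then show thesis by (rule local_functionalD [OF _ assms(3,4)]) (use assms(2) that in auto)
qed

text \<open>A simplex is by itself a local cycle. In a degree other than \<open>n\<close> it would
  be a boundary up to simplices not containing it, hence a face of a larger simplex.\<close>

lemma card_maximal_simplex:
  assumes \<sigma>: "\<sigma> \<in> X" and max: "\<And>\<tau>. \<tau> \<in> X \<Longrightarrow> \<sigma> \<subseteq> \<tau> \<Longrightarrow> \<tau> = \<sigma>"
  shows "card \<sigma> = Suc n"
proof (rule ccontr)
  assume no: "card \<sigma> \<noteq> Suc n"
  have "card \<sigma> > 0" using complexD(3,4) [OF \<sigma>] by (simp add: card_gt_0_iff)
  then obtain k where k: "card \<sigma> = Suc k" using gr0_implies_Suc by blast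
  have loc: "\<forall>\<rho>\<in>keys (set_bd UNIV (gen \<sigma>)). \<not> \<sigma> \<subseteq> \<rho>"
  proof
    fix \<rho> assume "\<rho> \<in> keys (set_bd UNIV (gen \<sigma>))"
    then show "\<not> \<sigma> \<subseteq> \<rho>" by (rule keys_set_bdE) auto
  qed
  have keys: "keys (gen \<sigma>) \<subseteq> {\<tau> \<in> X. \<sigma> \<subseteq> \<tau> \<and> card \<tau> = Suc k}"
    using \<sigma> k by simp
  have "k \<noteq> n" using no k by simp
  then obtain b where b: "keys b \<subseteq> {\<tau> \<in> X. card \<tau> = Suc (Suc k)}"
    "\<forall>\<rho>\<in>keys (gen \<sigma> + set_bd UNIV b). \<not> \<sigma> \<subseteq> \<rho>"
    by (rule local_cycle_bounds_off_dim [OF \<sigma> _ keys loc])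
  have "\<sigma> \<notin> keys (gen \<sigma> + set_bd UNIV b)" using b(2) by blast
  then have "\<sigma> \<in> keys (set_bd UNIV b)"
    by (auto simp: in_keys_iff lookup_add)
  then obtain \<tau> v where "\<tau> \<in> keys b" "v \<in> \<tau>" "\<sigma> = \<tau> - {v}"
    by (rule keys_set_bdE)
  then show False using b(1) max by blast
qed

lemma pure:
  assumes "\<sigma> \<in> X"
  obtains \<tau> where "\<tau> \<in> X" "\<sigma> \<subseteq> \<tau>" "card \<tau> = Suc n"
proof -
  obtain \<tau> where \<tau>: "\<tau> \<in> X" "\<sigma> \<subseteq> \<tau>" "\<forall>\<rho>\<in>X. \<tau> \<subseteq> \<rho> \<longrightarrow> \<tau> = \<rho>"
    using finite_has_maximal2 [OF complexD(1) assms] by auto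
  then show thesis using that card_maximal_simplex [of \<tau>] by blast
qed

lemma card_simplex_le: "\<sigma> \<in> X \<Longrightarrow> card \<sigma> \<le> Suc n"
  by (metis pure complexD(3) card_mono)

text \<open>No simplex has more than \<open>n + 1\<close> vertices, so a local
  \<open>n\<close>-cycle that bounds locally is 0 and \<open>\<Lambda>\<close> is injective on these
  cycles. Its values are bits: if it kills neither \<open>c\<close> nor \<open>d\<close>, it kills
  their sum.\<close>

lemma local_top_cycles:
  assumes \<sigma>: "\<sigma> \<in> X"
    and c: "keys c \<subseteq> {\<tau> \<in> X. \<sigma> \<subseteq> \<tau> \<and> card \<tau> = Suc n}" "\<forall>\<rho>\<in>keys (set_bd UNIV c). \<not> \<sigma> \<subseteq> \<rho>"
    and d: "keys d \<subseteq> {\<tau> \<in> X. \<sigma> \<subseteq> \<tau> \<and> card \<tau> = Suc n}" "\<forall>\<rho>\<in>keys (set_bd UNIV d). \<not> \<sigma> \<subseteq> \<rho>"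
  shows "c = 0 \<or> d = 0 \<or> c = d"
proof -
  obtain \<Lambda> where \<Lambda>: "local_functional X n \<sigma> \<Lambda>" by (rule ex_local_functional [OF \<sigma>])
  have zero: "c = 0" if c: "keys c \<subseteq> {\<tau> \<in> X. \<sigma> \<subseteq> \<tau> \<and> card \<tau> = Suc n}"
    "\<forall>\<rho>\<in>keys (set_bd UNIV c). \<not> \<sigma> \<subseteq> \<rho>" "\<Lambda> c = 0" for c
  proof -
    obtain b where b: "keys b \<subseteq> {\<tau> \<in> X. card \<tau> = Suc (Suc n)}" "\<forall>\<rho>\<in>keys (c + set_bd UNIV b). \<not> \<sigma> \<subseteq> \<rho>"
      by (rule local_functionalD [OF \<Lambda> c])
    have "keys b = {}"
    proof (rule ccontr)
      assume "keys b \<noteq> {}"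
      then obtain \<tau> where "\<tau> \<in> X" "card \<tau> = Suc (Suc n)" using b(1) by blast
      then show False using card_simplex_le [of \<tau>] by simp
    qed
    then have "b = 0" by simp
    then have "keys c = {}" using b(2) c(1) by fastforce
    then show "c = 0" by simp
  qed
  have cd: "keys (c + d) \<subseteq> {\<tau> \<in> X. \<sigma> \<subseteq> \<tau> \<and> card \<tau> = Suc n}"
    using c(1) d(1) by (rule keys_add_subset)
  have "keys (set_bd UNIV c + set_bd UNIV d) \<subseteq> {\<rho>. \<not> \<sigma> \<subseteq> \<rho>}"
    by (rule keys_add_subset) (use c d in auto)
  then have cd': "\<forall>\<rho>\<in>keys (set_bd UNIV (c + d)). \<not> \<sigma> \<subseteq> \<rho>" by auto
  have "\<Lambda> c = 0 \<or> \<Lambda> d = 0 \<or> \<Lambda> (c + d) = 0"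
    using \<Lambda> unfolding local_functional_def by (cases "\<Lambda> c"; cases "\<Lambda> d") auto
  then show ?thesis
    using zero [OF c] zero [OF d] zero [OF cd cd'] bit_chain_add_eq_0_iff by blast
qed

text \<open>Near the barycentre of \<open>\<rho>\<close> the realization would be a half space. The
  coordinates on \<open>\<tau>\<close> except one define an injective continuous map on an open set
  of Euclidean \<open>n\<close>-space, whose image is open by invariance of domain; yet the
  coordinate at the vertex opposite \<open>\<rho>\<close> is 0 at the barycentre and never
  negative.\<close>

lemma one_sided_face_absurd:
  assumes \<rho>: "\<rho> \<in> X" "card \<rho> = n" and \<tau>: "\<tau> \<in> X" "\<rho> \<subseteq> \<tau>" "card \<tau> = Suc n"
    and only: "\<And>\<tau>'. \<tau>' \<in> X \<Longrightarrow> \<rho> \<subseteq> \<tau>' \<Longrightarrow> \<tau>' \<subseteq> \<tau>"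
  shows False
proof -
  let ?R = "realization X" and ?x = "barycentre \<rho>" and ?E = "{w :: nat \<Rightarrow> real. \<forall>i\<ge>n. w i = 0}"
  have E: "Euclidean_space n = top_of_set ?E"
    by (simp add: Euclidean_space_def euclidean_product_topology)
  have fin: "finite \<tau>" "finite \<rho>" "\<rho> \<noteq> {}" using complexD(3,4) \<rho> \<tau> by blast+
  have "?x \<in> ?R"
    using barycentre_in_geom_simplex [OF fin(2,3)] geom_simplex_subset_realization [OF complex \<rho>(1)] by blast
  then obtain U W h g where U: "openin (top_of_set ?R) U" "?x \<in> U" and W: "openin (top_of_set ?E) W"
    and hg: "homeomorphism U W h g"
    using chart unfolding locally_euclidean_at_def by blast
  have h: "\<And>y. y \<in> U \<Longrightarrow> h y \<in> W" "\<And>y. y \<in> U \<Longrightarrow> g (h y) = y"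
    and g: "continuous_on W g" "\<And>w. w \<in> W \<Longrightarrow> g w \<in> U" "\<And>w. w \<in> W \<Longrightarrow> h (g w) = w"
    using hg unfolding homeomorphism_def by blast+
  \<comment> \<open>On the realization this is the open star of \<open>\<rho>\<close>: supports
    there contain \<open>\<rho>\<close>, and \<open>only\<close> confines them to
    \<open>\<tau>\<close>.\<close>
  define O' where "O' = (\<Inter>v\<in>\<rho>. {y :: 'v \<Rightarrow> real. y v \<noteq> 0})"
  have "open O'"
    unfolding O'_def
    by (intro open_INT fin ballI open_Collect_neq continuous_on_coordinate continuous_on_const)
  then have W': "openin (top_of_set ?E) (W \<inter> g -` O')"
    using continuous_openin_preimage_gen [OF g(1)] W openin_trans by blast
  obtain w where w: "w \<in> \<tau>" "w \<notin> \<rho>"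
  proof -
    have "\<rho> \<noteq> \<tau>" using \<rho> \<tau> by auto
    then show thesis using that \<tau>(2) by blast
  qed
  \<comment> \<open>The omitted coordinate, recoverable from the sum 1. It is taken in
    \<open>\<rho>\<close> so that the coordinate at \<open>w\<close>, where the contradiction
    arises, is kept.\<close>
  obtain v\<^sub>0 where v0: "v\<^sub>0 \<in> \<rho>" using fin by blast
  have "card (\<tau> - {v\<^sub>0}) = n" using v0 \<tau> fin by (simp add: card_Diff_singleton subset_iff)
  then obtain e where e: "bij_betw e {0..<n} (\<tau> - {v\<^sub>0})"
    using ex_bij_betw_nat_finite [of "\<tau> - {v\<^sub>0}"] fin by auto
  define f where "f u = (\<lambda>i. if i < n then g u (e i) else 0)" for u
  have supp: "{v. g u v \<noteq> 0} \<subseteq> \<tau>" "g u \<in> geom_simplex \<tau>" if u: "u \<in> W \<inter> g -` O'" for u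
  proof -
    have "g u \<in> ?R" using u g(2) openin_imp_subset [OF U(1)] by blast
    then have gu: "g u \<in> geom_simplex (vertices X)" "{v. g u v \<noteq> 0} \<in> X"
      using mem_realization_iff [OF complex] by blast+
    have "\<rho> \<subseteq> {v. g u v \<noteq> 0}" using u by (auto simp: O'_def)
    then show "{v. g u v \<noteq> 0} \<subseteq> \<tau>" using only gu(2) by blast
    then show "g u \<in> geom_simplex \<tau>"
      using geom_simplex_subset_iff [OF complexD(2) complexD(5) [OF \<tau>(1)]] gu(1) by blast
  qed
  have "inj_on f (W \<inter> g -` O')"
  proof (rule inj_onI)
    fix a b assume ab: "a \<in> W \<inter> g -` O'" "b \<in> W \<inter> g -` O'" "f a = f b"
    have eq: "g a v = g b v" if v: "v \<in> \<tau> - {v\<^sub>0}" for v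
    proof -
      have "v \<in> e ` {0..<n}" using e v unfolding bij_betw_def by blast
      then obtain i where "i < n" "v = e i" by auto
      then show ?thesis using fun_cong [OF ab(3), of i] by (simp add: f_def)
    qed
    have "v\<^sub>0 \<in> \<tau>" using v0 \<tau> by blast
    then have "(\<Sum>v\<in>\<tau>. g u v) = g u v\<^sub>0 + (\<Sum>v\<in>\<tau> - {v\<^sub>0}. g u v)" for u
      using fin by (simp add: sum.remove)
    moreover have "(\<Sum>v\<in>\<tau>. g a v) = (\<Sum>v\<in>\<tau>. g b v)"
      using supp(2) ab(1,2) by (simp add: geom_simplex_def)
    moreover have "(\<Sum>v\<in>\<tau> - {v\<^sub>0}. g a v) = (\<Sum>v\<in>\<tau> - {v\<^sub>0}. g b v)"
      using eq by (intro sum.cong) auto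
    ultimately have "g a v\<^sub>0 = g b v\<^sub>0" by simp
    moreover have "g a v = g b v" if "v \<notin> \<tau>" for v
    proof -
      have "v \<notin> {v. g a v \<noteq> 0}" "v \<notin> {v. g b v \<noteq> 0}"
        using supp(1) [OF ab(1)] supp(1) [OF ab(2)] that by blast+
      then show ?thesis by simp
    qed
    ultimately have "g a = g b" using eq by (metis DiffI ext singletonD)
    then show "a = b" using g(3) ab by (metis IntD1)
  qed
  moreover have "continuous_map (subtopology (Euclidean_space n) (W \<inter> g -` O')) (Euclidean_space n) f"
    unfolding cm_Euclidean_space_iff_continuous_on
  proof
    have "continuous_on (W \<inter> g -` O') f"
    proof (rule continuous_on_coordinatewise_then_product)
      fix i
      show "continuous_on (W \<inter> g -` O') (\<lambda>u. f u i)"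
        using continuous_on_product_then_coordinatewise [OF g(1), of "e i"]
        by (cases "i < n") (auto simp: f_def intro: continuous_on_subset)
    qed
    then show "continuous_on (topspace (subtopology (Euclidean_space n) (W \<inter> g -` O'))) f"
      by (rule continuous_on_subset) auto
    show "f \<in> topspace (subtopology (Euclidean_space n) (W \<inter> g -` O')) \<rightarrow> topspace (Euclidean_space n)"
      by (auto simp: f_def topspace_Euclidean_space)
  qed
  ultimately have im: "openin (top_of_set ?E) (f ` (W \<inter> g -` O'))"
    using invariance_of_domain_Euclidean_space [of n "W \<inter> g -` O'" f] W' unfolding E by blast
  have hx: "h ?x \<in> W \<inter> g -` O'"
    using h [OF U(2)] fin by (auto simp: O'_def barycentre_def)
  obtain j where j: "j < n" "e j = w"
  proof -
    have "w \<in> e ` {0..<n}" using e w v0 unfolding bij_betw_def by blast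
    then show thesis using that by auto
  qed
  obtain F d where d: "0 < d" "\<forall>u\<in>?E. (\<forall>i\<in>F. \<bar>u i - f (h ?x) i\<bar> < d) \<longrightarrow> u \<in> f ` (W \<inter> g -` O')"
    by (rule coordinate_neighbourhood [OF im imageI [OF hx]])
  have fj: "f (h ?x) j = 0" using j w h(2) [OF U(2)] by (simp add: f_def barycentre_def)
  \<comment> \<open>Openness of the image admits a slightly negative coordinate at
    \<open>w\<close>.\<close>
  let ?u = "(f (h ?x))(j := - (d / 2))"
  have "?u \<in> ?E" using j by (auto simp: f_def)
  moreover have "\<forall>i\<in>F. \<bar>?u i - f (h ?x) i\<bar> < d" using d fj by auto
  ultimately obtain u where u: "u \<in> W \<inter> g -` O'" "?u = f u" using d(2) by blast
  have "f u j = - (d / 2)" by (simp flip: u(2))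
  moreover have "0 \<le> f u j" using supp(2) [OF u(1)] j by (simp add: f_def geom_simplex_def)
  ultimately show False using d by simp
qed

definition top_simplices :: "'v set set" where
  "top_simplices = {\<tau> \<in> X. card \<tau> = Suc n}"

lemma finite_top_simplices: "finite top_simplices"
  using complexD(1) by (simp add: top_simplices_def)

text \<open>At most two cofaces because the local top cycles at \<open>\<rho>\<close> form a space of dimension at most 1; at
  least two because otherwise the realization would be a half space near the barycentre of \<open>\<rho>\<close>.\<close>

lemma top_cofaces:
  assumes \<rho>: "\<rho> \<in> X" "card \<rho> = n"
  shows "card {\<tau> \<in> top_simplices. \<rho> \<subseteq> \<tau>} = 2"
proof -
  let ?T = "{\<tau> \<in> top_simplices. \<rho> \<subseteq> \<tau>}"
  have fin: "finite ?T" using finite_top_simplices by simp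
  obtain \<tau> where \<tau>: "\<tau> \<in> ?T" using pure [OF \<rho>(1)] by (auto simp: top_simplices_def)
  have "\<exists>\<tau>'\<in>?T. \<tau>' \<noteq> \<tau>"
  proof (rule ccontr)
    assume "\<not> ?thesis"
    then have uniq: "\<tau>' = \<tau>" if "\<tau>' \<in> ?T" for \<tau>' using that by blast
    show False
    proof (rule one_sided_face_absurd [OF \<rho>, of \<tau>])
      fix \<tau>' assume \<tau>': "\<tau>' \<in> X" "\<rho> \<subseteq> \<tau>'"
      obtain \<mu> where "\<mu> \<in> X" "\<tau>' \<subseteq> \<mu>" "card \<mu> = Suc n" using pure [OF \<tau>'(1)] by blast
      then show "\<tau>' \<subseteq> \<tau>" using uniq [of \<mu>] \<tau>' by (auto simp: top_simplices_def)
    qed (use \<tau> in \<open>auto simp: top_simplices_def\<close>)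
  qed
  then obtain \<tau>' where \<tau>': "\<tau>' \<in> ?T" "\<tau>' \<noteq> \<tau>" by blast
  \<comment> \<open>Each of the two cofaces has \<open>\<rho>\<close> once in its boundary, so it
    cancels; the other faces have as many vertices as \<open>\<rho>\<close> and cannot contain
    it.\<close>
  have pair: "keys (gen \<alpha> + gen \<beta>) \<subseteq> {\<tau> \<in> X. \<rho> \<subseteq> \<tau> \<and> card \<tau> = Suc n}"
    "\<forall>\<rho>'\<in>keys (set_bd UNIV (gen \<alpha> + gen \<beta>)). \<not> \<rho> \<subseteq> \<rho>'" if \<alpha>\<beta>: "\<alpha> \<in> ?T" "\<beta> \<in> ?T" for \<alpha> \<beta>
  proof -
    show k: "keys (gen \<alpha> + gen \<beta>) \<subseteq> {\<tau> \<in> X. \<rho> \<subseteq> \<tau> \<and> card \<tau> = Suc n}"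
      by (rule keys_add_subset) (use \<alpha>\<beta> in \<open>auto simp: top_simplices_def\<close>)
    have one: "lookup (face_bd UNIV \<tau>) \<rho> = 1" if "\<tau> \<in> ?T" for \<tau>
      using that \<rho> complexD(3) [of \<tau>] lookup_face_bd_codim1 [of \<tau> \<rho>] by (simp add: top_simplices_def)
    show "\<forall>\<rho>'\<in>keys (set_bd UNIV (gen \<alpha> + gen \<beta>)). \<not> \<rho> \<subseteq> \<rho>'"
    proof
      fix \<rho>' assume \<rho>': "\<rho>' \<in> keys (set_bd UNIV (gen \<alpha> + gen \<beta>))"
      then obtain \<tau> v where tv: "\<tau> \<in> keys (gen \<alpha> + gen \<beta>)" "v \<in> \<tau>" "\<rho>' = \<tau> - {v}"
        by (rule keys_set_bdE)
      then have "card \<rho>' = n" "finite \<rho>'" using k complexD(3) by (auto simp: card_Diff_singleton)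
      moreover have "\<rho>' \<noteq> \<rho>"
        using \<rho>' one \<alpha>\<beta> by (auto simp: in_keys_iff lookup_add)
      ultimately show "\<not> \<rho> \<subseteq> \<rho>'" using \<rho> card_subset_eq by blast
    qed
  qed
  have "\<mu> = \<tau> \<or> \<mu> = \<tau>'" if \<mu>: "\<mu> \<in> ?T" for \<mu>
  proof -
    have gen_eq: "gen \<alpha> = gen \<beta> \<Longrightarrow> \<alpha> = \<beta>" for \<alpha> \<beta> :: "'v set"
      by (metis keys_single singleton_inject zero_neq_one)
    \<comment> \<open>A third coface \<open>\<mu>\<close> would give two distinct nonzero local
      cycles.\<close>
    have "gen \<tau> + gen \<tau>' = 0 \<or> gen \<tau> + gen \<mu> = 0 \<or> gen \<tau> + gen \<tau>' = gen \<tau> + gen \<mu>"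
      using local_top_cycles [OF \<rho>(1) pair [OF \<tau> \<tau>'(1)] pair [OF \<tau> \<mu>]] .
    then show ?thesis
      using \<tau>'(2) gen_eq unfolding bit_chain_add_eq_0_iff add_left_cancel by metis
  qed
  then have "?T = {\<tau>, \<tau>'}" using \<tau> \<tau>' by blast
  then show ?thesis using \<tau>'(2) by simp
qed

section \<open>Cycles in the top dimension\<close>

definition fundamental_cycle :: "'v set bit_chain" where
  "fundamental_cycle = (\<Sum>\<tau>\<in>top_simplices. gen \<tau>)"

lemma lookup_fundamental_cycle: "lookup fundamental_cycle \<tau> = (if \<tau> \<in> top_simplices then 1 else 0)"
proof -
  have "lookup fundamental_cycle \<tau> = (\<Sum>\<rho>\<in>top_simplices. if \<rho> = \<tau> then 1 else 0)"
    unfolding fundamental_cycle_def lookup_sum by (intro sum.cong) (auto simp: lookup_single when_def)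
  then show ?thesis using finite_top_simplices by simp
qed

lemma keys_fundamental_cycle: "keys fundamental_cycle = top_simplices"
  by (auto simp: in_keys_iff lookup_fundamental_cycle split: if_splits)

text \<open>A nonempty face of codimension one lies in exactly two \<open>n\<close>-simplices, so
  its coefficient is 2 = 0. The empty face is excepted because for \<open>n = 0\<close> it is the
  augmented face of every vertex.\<close>

lemma set_bd_fundamental_cycle: "keys (set_bd UNIV fundamental_cycle) \<subseteq> {{}}"
proof
  fix \<rho> assume \<rho>: "\<rho> \<in> keys (set_bd UNIV fundamental_cycle)"
  show "\<rho> \<in> {{}}"
  proof (rule ccontr)
    assume ne: "\<rho> \<notin> {{}}"
    obtain \<tau> v where tv: "\<tau> \<in> top_simplices" "v \<in> \<tau>" "\<rho> = \<tau> - {v}"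
      using \<rho> keys_fundamental_cycle by (metis keys_set_bdE)
    have \<rho>X: "\<rho> \<in> X" "card \<rho> = n"
      using tv ne complexD(6) [of \<tau> \<rho>] complexD(3) [of \<tau>] by (auto simp: top_simplices_def card_Diff_singleton)
    have "lookup (set_bd UNIV fundamental_cycle) \<rho> = (\<Sum>\<tau>\<in>top_simplices. if \<rho> \<subseteq> \<tau> then 1 else 0)"
      unfolding lookup_set_bd keys_fundamental_cycle
    proof (rule sum.cong)
      fix \<tau> assume \<tau>: "\<tau> \<in> top_simplices"
      then have t: "finite \<tau>" "card \<tau> = Suc (card \<rho>)"
        using complexD(3) \<rho>X by (auto simp: top_simplices_def)
      then show "lookup (face_bd UNIV \<tau>) \<rho> = (if \<rho> \<subseteq> \<tau> then 1 else 0)"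
        by (rule lookup_face_bd_codim1)
    qed simp
    also have "\<dots> = of_nat (card {\<tau> \<in> top_simplices. \<rho> \<subseteq> \<tau>})"
      using finite_top_simplices by (simp add: sum.If_cases Int_def)
    also have "\<dots> = 0" using top_cofaces [OF \<rho>X] by simp
    finally show False using \<rho> by (simp add: in_keys_iff)
  qed
qed

text \<open>The open stars of the vertices in \<open>A\<close> and those of the other vertices form
  two open sets covering the realization. A common point has an edge from \<open>A\<close> to its
  complement in its support.\<close>

lemma vertices_edge_connected:
  assumes A: "A \<subseteq> vertices X" "A \<noteq> {}"
    and closed: "\<And>v w. v \<in> A \<Longrightarrow> {v, w} \<in> X \<Longrightarrow> w \<in> A"
  shows "A = vertices X"
proof (rule ccontr)
  assume neq: "A \<noteq> vertices X"
  let ?R = "realization X"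
  define P where "P B = {y \<in> ?R. \<exists>v\<in>B. y v \<noteq> 0}" for B
  have openP: "openin (top_of_set ?R) (P B)" for B
  proof -
    have "open (\<Union>v\<in>B. {y :: 'v \<Rightarrow> real. y v \<noteq> 0})"
      by (intro open_UN ballI open_Collect_neq continuous_on_coordinate continuous_on_const)
    moreover have "P B = ?R \<inter> (\<Union>v\<in>B. {y. y v \<noteq> 0})" by (auto simp: P_def)
    ultimately show ?thesis by (auto simp: openin_open)
  qed
  have ne: "P B \<noteq> {}" if B: "B \<subseteq> vertices X" "B \<noteq> {}" for B
  proof -
    obtain v where v: "v \<in> B" using B by blast
    then obtain \<sigma> where "\<sigma> \<in> X" "v \<in> \<sigma>" using B by (auto simp: vertices_def)
    then have vX: "{v} \<in> X" using complexD(6) by blast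
    have "barycentre {v} \<in> ?R"
      using barycentre_in_geom_simplex [of "{v}"] geom_simplex_subset_realization [OF complex vX] by blast
    then have "barycentre {v} \<in> P B" using v by (auto simp: P_def barycentre_def)
    then show ?thesis by blast
  qed
  have cover: "?R \<subseteq> P A \<union> P (vertices X - A)"
  proof
    fix y assume y: "y \<in> ?R"
    then have "{v. y v \<noteq> 0} \<in> X" using mem_realization_iff [OF complex] by blast
    then obtain v where "y v \<noteq> 0" "v \<in> vertices X" using complexD(4,5) by blast
    then show "y \<in> P A \<union> P (vertices X - A)" using y by (auto simp: P_def)
  qed
  have disj: "P A \<inter> P (vertices X - A) = {}"
  proof (rule ccontr)
    assume "\<not> ?thesis"
    then obtain y v w where y: "y \<in> ?R" "v \<in> A" "w \<in> vertices X - A" "y v \<noteq> 0" "y w \<noteq> 0"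
      by (auto simp: P_def)
    then have "{v. y v \<noteq> 0} \<in> X" using mem_realization_iff [OF complex] by blast
    moreover have "{v, w} \<subseteq> {v. y v \<noteq> 0}" using y by blast
    ultimately have "{v, w} \<in> X" using complexD(6) by blast
    then show False using closed y by blast
  qed
  have "P (vertices X - A) \<noteq> {}" using neq A by (intro ne) auto
  then show False
    using conn ne [OF A] openP [of A] openP [of "vertices X - A"] cover disj
    unfolding connected_openin by blast
qed

text \<open>In the open star of each simplex \<open>z\<close> is 0 or agrees with the fundamental
  cycle. If it agrees at \<open>v\<close> and \<open>{v, w}\<close> is an edge, then an
  \<open>n\<close>-simplex containing this edge belongs to \<open>z\<close>, so \<open>z\<close> is
  not 0 at \<open>w\<close>; connectedness along edges does the rest.\<close>

lemma top_cycle_cases: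
  assumes z: "keys z \<subseteq> top_simplices" "keys (set_bd UNIV z) \<subseteq> {{}}"
  shows "z = 0 \<or> z = fundamental_cycle"
proof -
  have loc: "restrict_star \<sigma> z = 0 \<or> restrict_star \<sigma> z = restrict_star \<sigma> fundamental_cycle" if \<sigma>: "\<sigma> \<in> X" for \<sigma>
  proof -
    have k: "keys (restrict_star \<sigma> c) \<subseteq> {\<tau> \<in> X. \<sigma> \<subseteq> \<tau> \<and> card \<tau> = Suc n}"
      if "keys c \<subseteq> top_simplices" for c
      using that by (auto simp: keys_restrict_star top_simplices_def)
    have l: "\<forall>\<rho>\<in>keys (set_bd UNIV (restrict_star \<sigma> c)). \<not> \<sigma> \<subseteq> \<rho>"
      if c: "keys (set_bd UNIV c) \<subseteq> {{}}" for c
    proof (intro ballI notI)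
      fix \<rho> assume "\<rho> \<in> keys (set_bd UNIV (restrict_star \<sigma> c))" "\<sigma> \<subseteq> \<rho>"
      then have "\<rho> = {}" using keys_set_bd_restrict_star c by blast
      then show False using complexD(4) [OF \<sigma>] \<open>\<sigma> \<subseteq> \<rho>\<close> by simp
    qed
    obtain \<tau> where "\<tau> \<in> X" "\<sigma> \<subseteq> \<tau>" "card \<tau> = Suc n" using pure [OF \<sigma>] by blast
    then have "\<tau> \<in> keys (restrict_star \<sigma> fundamental_cycle)"
      by (simp add: keys_restrict_star keys_fundamental_cycle top_simplices_def)
    then have "restrict_star \<sigma> fundamental_cycle \<noteq> 0" by auto
    then show ?thesis
      using local_top_cycles [OF \<sigma> k [OF z(1)] l [OF z(2)] k l [OF set_bd_fundamental_cycle]]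
        keys_fundamental_cycle by blast
  qed
  define A where "A = {v \<in> vertices X. restrict_star {v} z \<noteq> 0}"
  have vX: "{v} \<in> X" if "v \<in> \<sigma>" "\<sigma> \<in> X" for v \<sigma> using complexD(6) [OF that(2)] that(1) by blast
  show ?thesis
  proof (cases "A = {}")
    case True
    have "keys z = {}"
    proof (rule ccontr)
      assume "keys z \<noteq> {}"
      then obtain \<tau> v where \<tau>: "\<tau> \<in> keys z" "\<tau> \<in> X" "v \<in> \<tau>"
        using z(1) complexD(4) unfolding top_simplices_def by blast
      then have "\<tau> \<in> keys (restrict_star {v} z)" by (simp add: keys_restrict_star)
      then have "v \<in> A" using complexD(5) \<tau> by (auto simp: A_def)
      then show False using True by blast
    qed
    then show ?thesis by simp
  next
    case False
    have "w \<in> A" if v: "v \<in> A" and vw: "{v, w} \<in> X" for v w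
    proof -
      obtain \<tau> where \<tau>: "\<tau> \<in> X" "{v, w} \<subseteq> \<tau>" "card \<tau> = Suc n" using pure [OF vw] by blast
      have "restrict_star {v} z = restrict_star {v} fundamental_cycle"
        using loc [OF vX [OF _ vw, of v]] v by (auto simp: A_def)
      moreover have "\<tau> \<in> keys (restrict_star {v} fundamental_cycle)"
        using \<tau> by (simp add: keys_restrict_star keys_fundamental_cycle top_simplices_def)
      ultimately have "\<tau> \<in> keys (restrict_star {v} z)" by simp
      then have "\<tau> \<in> keys z" by (simp only: keys_restrict_star mem_Collect_eq)
      then have "\<tau> \<in> keys (restrict_star {w} z)" using \<tau> by (simp add: keys_restrict_star)
      then show "w \<in> A" using complexD(5) [OF vw] by (auto simp: A_def)
    qed
    moreover have "A \<subseteq> vertices X" by (auto simp: A_def)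
    ultimately have AV: "A = vertices X"
      by (intro vertices_edge_connected False)
    have "keys z = top_simplices"
    proof
      show "top_simplices \<subseteq> keys z"
      proof
        fix \<tau> assume \<tau>: "\<tau> \<in> top_simplices"
        then obtain v where v: "v \<in> \<tau>" "\<tau> \<in> X" using complexD(4) by (auto simp: top_simplices_def)
        then have "v \<in> A" using AV complexD(5) by blast
        then have "restrict_star {v} z = restrict_star {v} fundamental_cycle"
          using loc [OF vX [OF v]] by (auto simp: A_def)
        moreover have "\<tau> \<in> keys (restrict_star {v} fundamental_cycle)"
          using \<tau> v by (simp add: keys_restrict_star keys_fundamental_cycle)
        ultimately have "\<tau> \<in> keys (restrict_star {v} z)" by simp
        then show "\<tau> \<in> keys z" by (simp only: keys_restrict_star mem_Collect_eq)
      qed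
    qed (rule z(1))
    then have "lookup z \<tau> = lookup fundamental_cycle \<tau>" for \<tau>
      using in_keys_bit_iff [of \<tau> z] in_keys_iff [of \<tau> z] by (simp add: lookup_fundamental_cycle)
    then show ?thesis by (simp add: poly_mapping_eqI)
  qed
qed

text \<open>Surjectivity of \<open>H\<^sub>k(X - v) \<rightarrow> H\<^sub>k(X)\<close> on cycles:
  the part of \<open>z\<close> around \<open>v\<close> is a local cycle, hence a boundary up to
  simplices avoiding \<open>v\<close>.\<close>

lemma cycle_off_vertex:
  assumes k: "k \<noteq> n" and v: "v \<in> vertices X"
    and z: "keys z \<subseteq> {\<tau> \<in> X. card \<tau> = Suc k}" "keys (set_bd UNIV z) \<subseteq> {{}}"
  obtains b where "keys b \<subseteq> {\<tau> \<in> X. card \<tau> = Suc (Suc k)}" "\<And>\<tau>. \<tau> \<in> keys (z + set_bd UNIV b) \<Longrightarrow> v \<notin> \<tau>"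
proof -
  obtain \<sigma> where "\<sigma> \<in> X" "v \<in> \<sigma>" using v by (auto simp: vertices_def)
  then have vX: "{v} \<in> X" using complexD(6) by blast
  let ?c = "restrict_star {v} z"
  have keys: "keys ?c \<subseteq> {\<tau> \<in> X. {v} \<subseteq> \<tau> \<and> card \<tau> = Suc k}"
    using z(1) by (auto simp: keys_restrict_star)
  have loc: "\<forall>\<rho>\<in>keys (set_bd UNIV ?c). \<not> {v} \<subseteq> \<rho>"
    using keys_set_bd_restrict_star [of _ "{v}" z] z(2) by blast
  obtain b where b: "keys b \<subseteq> {\<tau> \<in> X. card \<tau> = Suc (Suc k)}"
    "\<forall>\<rho>\<in>keys (?c + set_bd UNIV b). \<not> {v} \<subseteq> \<rho>"
    by (rule local_cycle_bounds_off_dim [OF vX k keys loc])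
  have "v \<notin> \<tau>" if \<tau>: "\<tau> \<in> keys (z + set_bd UNIV b)" for \<tau>
  proof -
    have "keys ((z + ?c) + (?c + set_bd UNIV b)) \<subseteq> {\<tau>. v \<notin> \<tau>}"
      by (rule keys_add_subset) (use keys_add_restrict_star [of _ z "{v}"] b(2) in auto)
    moreover have "(z + ?c) + (?c + set_bd UNIV b) = z + set_bd UNIV b"
      by (simp add: add.assoc)
    ultimately show ?thesis using \<tau> by auto
  qed
  then show thesis using that b(1) by blast
qed

end

lemma triangulated_manifoldI:
  assumes M: "closed_connected_manifold n M" and X: "triangulates X M"
  shows "triangulated_manifold X n"
proof
  show fc: "finite_complex X" using X by (simp add: triangulates_def)
  have hom: "top_of_set (realization X) homeomorphic_space M"
    using X by (simp add: triangulates_def euclidean_product_topology)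
  have "connected_space (top_of_set (realization X))"
    using homeomorphic_connected_space [OF hom] M by (simp add: closed_connected_manifold_def)
  then show "connected (realization X)" by (simp add: connectedin_def flip: connectedin_iff_connected)
  have "realization X \<noteq> {}"
    using homeomorphic_empty_space [OF hom] M by (auto simp: closed_connected_manifold_def)
  then show "X \<noteq> {}" by (auto simp: realization_def)
  show "locally_euclidean_at n (realization X) x" if "x \<in> realization X" for x
    using locally_euclidean_at_realization [OF M X that] .
qed

section \<open>Horizontal homology groups\<close>

text \<open>By default sums of bits are rewritten to exclusive disjunctions, which defeats additive reasoning.\<close>

declare add_bit_eq_xor [simp del]

lemma bit_add_self [simp]: "(x :: bit) + x = 0"
  by (cases x) auto

lemma bit_add_self_left [simp]: "(x :: bit) + (x + y) = y"
  by (simp flip: add.assoc)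

lemma bit_add_eq_1: "(x :: bit) + y = 1 \<Longrightarrow> x = 1 \<or> y = 1"
  by (cases x) auto

abbreviation bit_function_group :: "('s \<Rightarrow> bit) set \<Rightarrow> ('s \<Rightarrow> bit) monoid" where
  "bit_function_group S \<equiv> \<lparr>carrier = S, monoid.mult = (\<lambda>c d \<sigma>. c \<sigma> + d \<sigma>), one = (\<lambda>\<sigma>. 0)\<rparr>"

text \<open>Every function is its own inverse under addition, so these two closure properties
  already give a subgroup.\<close>

definition additive_set :: "('s \<Rightarrow> bit) set \<Rightarrow> bool" where
  "additive_set S \<longleftrightarrow> (\<lambda>\<sigma>. 0) \<in> S \<and> (\<forall>c\<in>S. \<forall>d\<in>S. (\<lambda>\<sigma>. c \<sigma> + d \<sigma>) \<in> S)"

lemma comm_group_bit_function_group: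
  assumes "additive_set S"
  shows "comm_group (bit_function_group S)"
proof (rule comm_groupI)
  fix c assume "c \<in> carrier (bit_function_group S)"
  then show "\<exists>d\<in>carrier (bit_function_group S). d \<otimes>\<^bsub>bit_function_group S\<^esub> c = \<one>\<^bsub>bit_function_group S\<^esub>"
    by (intro bexI [of _ c]) auto
qed (use assms in \<open>auto simp: additive_set_def ac_simps\<close>)

lemma subgroup_bit_function_group:
  assumes "additive_set S" "additive_set H" "H \<subseteq> S"
  shows "subgroup H (bit_function_group S)"
proof -
  interpret comm_group "bit_function_group S" by (rule comm_group_bit_function_group) fact
  show ?thesis
  proof (rule subgroupI)
    fix c assume c: "c \<in> H"
    have "inv\<^bsub>bit_function_group S\<^esub> c = c"
      by (rule inv_equality) (use c assms in auto)
    then show "inv\<^bsub>bit_function_group S\<^esub> c \<in> H" using c by simp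
  qed (use assms in \<open>auto simp: additive_set_def\<close>)
qed

lemma additive_hor_chains: "additive_set (carrier (hor_chains X \<epsilon> k w))"
  by (auto simp: additive_set_def hor_chains_def dest!: bit_add_eq_1)

lemma hor_diff_zero [simp]: "hor_diff X \<epsilon> (\<lambda>\<sigma>. 0) = (\<lambda>\<tau>. 0)"
  by (simp add: hor_diff_def)

lemma hor_diff_add: "hor_diff X \<epsilon> (\<lambda>\<sigma>. c \<sigma> + d \<sigma>) = (\<lambda>\<tau>. hor_diff X \<epsilon> c \<tau> + hor_diff X \<epsilon> d \<tau>)"
  unfolding hor_diff_def sum.distrib [symmetric] by (intro ext sum.cong) auto

lemma additive_hor_cycles: "additive_set (hor_cycles X \<epsilon> k w)"
  using additive_hor_chains [of X \<epsilon> k w]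
  by (auto simp: additive_set_def hor_cycles_def hor_diff_add)

lemma additive_hor_boundaries: "additive_set (hor_boundaries X \<epsilon> k w)"
  unfolding additive_set_def hor_boundaries_def
proof (intro conjI ballI)
  show "(\<lambda>\<sigma>. 0) \<in> hor_diff X \<epsilon> ` carrier (hor_chains X \<epsilon> (Suc k) w)"
    using additive_hor_chains [of X \<epsilon> "Suc k" w]
    by (intro image_eqI [of _ _ "\<lambda>\<sigma>. 0"]) (auto simp: additive_set_def)
  fix c d assume "c \<in> hor_diff X \<epsilon> ` carrier (hor_chains X \<epsilon> (Suc k) w)"
    "d \<in> hor_diff X \<epsilon> ` carrier (hor_chains X \<epsilon> (Suc k) w)"
  then obtain c' d' where "c = hor_diff X \<epsilon> c'" "c' \<in> carrier (hor_chains X \<epsilon> (Suc k) w)"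
    "d = hor_diff X \<epsilon> d'" "d' \<in> carrier (hor_chains X \<epsilon> (Suc k) w)"
    by blast
  then show "(\<lambda>\<sigma>. c \<sigma> + d \<sigma>) \<in> hor_diff X \<epsilon> ` carrier (hor_chains X \<epsilon> (Suc k) w)"
    using additive_hor_chains [of X \<epsilon> "Suc k" w]
    by (intro image_eqI [of _ _ "\<lambda>\<sigma>. c' \<sigma> + d' \<sigma>"]) (auto simp: additive_set_def hor_diff_add)
qed

text \<open>The bridge from the defined differential to the combinatorial one. They differ only at
  the empty face, which \<open>set_bd\<close> keeps.\<close>

lemma hor_diff_lookup:
  assumes X: "finite_complex X" and c: "keys c \<subseteq> X"
  shows "hor_diff X \<epsilon> (lookup c) = (\<lambda>\<tau>. if \<tau> = {} then 0 else lookup (set_bd \<epsilon> c) \<tau>)"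
proof
  fix \<tau>
  have "(\<Sum>\<sigma>\<in>X. \<Sum>v\<in>\<sigma> \<inter> \<epsilon>. if \<tau> = \<sigma> - {v} then lookup c \<sigma> else 0) =
      (\<Sum>\<sigma>\<in>keys c. \<Sum>v\<in>\<sigma> \<inter> \<epsilon>. if \<tau> = \<sigma> - {v} then lookup c \<sigma> else 0)"
    by (rule sum.mono_neutral_right)
       (use finite_complexD(1) [OF X] c in \<open>auto simp: in_keys_iff intro!: sum.neutral\<close>)
  also have "\<dots> = (\<Sum>\<sigma>\<in>keys c. lookup (face_bd \<epsilon> \<sigma>) \<tau>)"
    unfolding face_bd_def lookup_sum
    by (intro sum.cong) (auto simp: lookup_single when_def in_keys_bit_iff)
  finally show "hor_diff X \<epsilon> (lookup c) \<tau> = (if \<tau> = {} then 0 else lookup (set_bd \<epsilon> c) \<tau>)"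
    by (auto simp: hor_diff_def lookup_set_bd)
qed

lemma hor_chain_lookup:
  assumes X: "finite_complex X" and c: "c \<in> carrier (hor_chains X \<epsilon> k w)"
  obtains p where "c = lookup p" "keys p \<subseteq> {\<sigma> \<in> X. card \<sigma> = Suc k \<and> card (\<sigma> - \<epsilon>) = w}"
proof -
  have sub: "{\<sigma>. c \<sigma> \<noteq> 0} \<subseteq> {\<sigma> \<in> X. card \<sigma> = Suc k \<and> card (\<sigma> - \<epsilon>) = w}"
    using c by (auto simp: hor_chains_def)
  then have "finite {\<sigma>. c \<sigma> \<noteq> 0}" using finite_complexD(1) [OF X] by (auto intro: finite_subset)
  then have "c = lookup (Abs_poly_mapping c)" by simp
  moreover have "keys (Abs_poly_mapping c) \<subseteq> {\<sigma> \<in> X. card \<sigma> = Suc k \<and> card (\<sigma> - \<epsilon>) = w}"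
    using sub \<open>finite {\<sigma>. c \<sigma> \<noteq> 0}\<close> by (auto simp: in_keys_iff)
  ultimately show thesis using that by blast
qed

lemma lookup_hor_chain:
  assumes "keys p \<subseteq> {\<sigma> \<in> X. card \<sigma> = Suc k \<and> card (\<sigma> - \<epsilon>) = w}"
  shows "lookup p \<in> carrier (hor_chains X \<epsilon> k w)"
  using assms by (auto simp: hor_chains_def subset_iff in_keys_iff)

lemma hor_diff_chain:
  assumes X: "finite_complex X" and p: "keys p \<subseteq> {\<sigma> \<in> X. card \<sigma> = Suc (Suc k) \<and> card (\<sigma> - \<epsilon>) = w}"
  shows "hor_diff X \<epsilon> (lookup p) = lookup (set_bd \<epsilon> p)"
    and "keys (set_bd \<epsilon> p) \<subseteq> {\<sigma> \<in> X. card \<sigma> = Suc k \<and> card (\<sigma> - \<epsilon>) = w}"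
proof -
  show k: "keys (set_bd \<epsilon> p) \<subseteq> {\<sigma> \<in> X. card \<sigma> = Suc k \<and> card (\<sigma> - \<epsilon>) = w}"
  proof
    fix \<rho> assume "\<rho> \<in> keys (set_bd \<epsilon> p)"
    then obtain \<tau> v where tv: "\<tau> \<in> keys p" "v \<in> \<tau>" "v \<in> \<epsilon>" "\<rho> = \<tau> - {v}"
      by (rule keys_set_bdE)
    then have \<tau>: "\<tau> \<in> X" "card \<tau> = Suc (Suc k)" "card (\<tau> - \<epsilon>) = w" using p by auto
    then have c: "card \<rho> = Suc k" using tv finite_complexD(3) [OF X] by (simp add: card_Diff_singleton)
    then have "\<rho> \<noteq> {}" by auto
    moreover have "\<rho> \<subseteq> \<tau>" using tv by blast
    ultimately have "\<rho> \<in> X" using finite_complexD(6) [OF X \<tau>(1)] by metis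
    moreover have "\<rho> - \<epsilon> = \<tau> - \<epsilon>" using tv by blast
    ultimately show "\<rho> \<in> {\<sigma> \<in> X. card \<sigma> = Suc k \<and> card (\<sigma> - \<epsilon>) = w}" using c \<tau> by simp
  qed
  have "{} \<notin> keys (set_bd \<epsilon> p)" using k by auto
  then have "lookup (set_bd \<epsilon> p) {} = 0" by (simp add: in_keys_iff)
  moreover have "keys p \<subseteq> X" using p by blast
  ultimately show "hor_diff X \<epsilon> (lookup p) = lookup (set_bd \<epsilon> p)"
    by (auto simp: hor_diff_lookup [OF X] fun_eq_iff)
qed

lemma hor_boundaries_subset_cycles:
  assumes X: "finite_complex X"
  shows "hor_boundaries X \<epsilon> k w \<subseteq> hor_cycles X \<epsilon> k w"
proof
  fix c assume "c \<in> hor_boundaries X \<epsilon> k w"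
  then obtain b where b: "b \<in> carrier (hor_chains X \<epsilon> (Suc k) w)" "c = hor_diff X \<epsilon> b"
    by (auto simp: hor_boundaries_def)
  obtain p where p: "b = lookup p" "keys p \<subseteq> {\<sigma> \<in> X. card \<sigma> = Suc (Suc k) \<and> card (\<sigma> - \<epsilon>) = w}"
    using hor_chain_lookup [OF X b(1)] by blast
  have c: "c = lookup (set_bd \<epsilon> p)" using hor_diff_chain(1) [OF X p(2)] b p by simp
  have k: "keys (set_bd \<epsilon> p) \<subseteq> {\<sigma> \<in> X. card \<sigma> = Suc k \<and> card (\<sigma> - \<epsilon>) = w}"
    using hor_diff_chain(2) [OF X p(2)] .
  have "set_bd \<epsilon> (set_bd \<epsilon> p) = 0"
    by (rule set_bd_set_bd) (use p(2) finite_complexD(3) [OF X] in blast)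
  moreover have "keys (set_bd \<epsilon> p) \<subseteq> X" using k by blast
  ultimately have "hor_diff X \<epsilon> c = (\<lambda>\<tau>. 0)"
    unfolding c by (auto simp: hor_diff_lookup [OF X] fun_eq_iff)
  then show "c \<in> hor_cycles X \<epsilon> k w"
    using lookup_hor_chain [OF k] by (simp add: hor_cycles_def c)
qed

lemma hor_homology_eq:
  "hor_homology X \<epsilon> k w = bit_function_group (hor_cycles X \<epsilon> k w) Mod hor_boundaries X \<epsilon> k w"
  by (simp add: hor_homology_def hor_chains_def)

lemma comm_group_hor_homology:
  assumes "finite_complex X"
  shows "comm_group (hor_homology X \<epsilon> k w)"
proof -
  interpret comm_group "bit_function_group (hor_cycles X \<epsilon> k w)"
    by (rule comm_group_bit_function_group [OF additive_hor_cycles])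
  show ?thesis
    unfolding hor_homology_eq
    by (intro abelian_FactGroup subgroup_bit_function_group additive_hor_cycles additive_hor_boundaries
        hor_boundaries_subset_cycles assms)
qed

lemma hor_class_eq: "hor_class X \<epsilon> k w c = (\<lambda>b \<sigma>. b \<sigma> + c \<sigma>) ` hor_boundaries X \<epsilon> k w"
  by (auto simp: hor_class_def r_coset_def hor_chains_def)

lemma carrier_hor_homology: "carrier (hor_homology X \<epsilon> k w) = hor_class X \<epsilon> k w ` hor_cycles X \<epsilon> k w"
  by (auto simp: hor_homology_eq carrier_FactGroup hor_class_eq r_coset_def)

lemma one_hor_homology: "\<one>\<^bsub>hor_homology X \<epsilon> k w\<^esub> = hor_boundaries X \<epsilon> k w"
  by (simp add: hor_homology_eq)

lemma hor_class_zero: "hor_class X \<epsilon> k w (\<lambda>\<sigma>. 0) = \<one>\<^bsub>hor_homology X \<epsilon> k w\<^esub>"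
  by (simp add: hor_class_eq one_hor_homology)

lemma hor_class_add_boundary:
  assumes "b \<in> hor_boundaries X \<epsilon> k w"
  shows "hor_class X \<epsilon> k w (\<lambda>\<sigma>. b \<sigma> + c \<sigma>) = hor_class X \<epsilon> k w c"
proof -
  have add: "(\<lambda>\<sigma>. b \<sigma> + b' \<sigma>) \<in> hor_boundaries X \<epsilon> k w" if "b' \<in> hor_boundaries X \<epsilon> k w" for b'
    using additive_hor_boundaries [of X \<epsilon> k w] assms that by (auto simp: additive_set_def)
  show ?thesis
    unfolding hor_class_eq
  proof (intro equalityI image_subsetI)
    fix b' assume b': "b' \<in> hor_boundaries X \<epsilon> k w"
    show "(\<lambda>\<sigma>. b' \<sigma> + (b \<sigma> + c \<sigma>)) \<in> (\<lambda>b \<sigma>. b \<sigma> + c \<sigma>) ` hor_boundaries X \<epsilon> k w"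
      by (rule image_eqI [OF _ add [OF b']]) (simp add: ac_simps)
    show "(\<lambda>\<sigma>. b' \<sigma> + c \<sigma>) \<in> (\<lambda>b' \<sigma>. b' \<sigma> + (b \<sigma> + c \<sigma>)) ` hor_boundaries X \<epsilon> k w"
      by (rule image_eqI [OF _ add [OF b']]) (simp add: ac_simps)
  qed
qed

lemma self_in_hor_class: "c \<in> hor_class X \<epsilon> k w c"
  using additive_hor_boundaries [of X \<epsilon> k w]
  by (auto simp: hor_class_eq additive_set_def intro!: image_eqI [of _ _ "\<lambda>\<sigma>. 0"])

section \<open>All-black homology and the deletion of a vertex\<close>

lemma positive_weight_chains:
  assumes X: "finite_complex X" and w: "w \<noteq> 0"
  shows "carrier (hor_chains X (vertices X) k w) = {\<lambda>\<sigma>. 0}"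
proof -
  have "\<sigma> - vertices X = {}" if "\<sigma> \<in> X" for \<sigma>
    using finite_complexD(5) [OF X that] by blast
  then have "card (\<sigma> - vertices X) = 0" if "\<sigma> \<in> X" for \<sigma>
    using that by (metis card.empty)
  then have "c \<sigma> = 0" if "c \<in> carrier (hor_chains X (vertices X) k w)" for c \<sigma>
    using that w unfolding hor_chains_def by auto
  then show ?thesis by (auto simp: hor_chains_def fun_eq_iff)
qed

lemma carrier_hor_homology_trivial:
  assumes "hor_cycles X \<epsilon> k w = {\<lambda>\<sigma>. 0}"
  shows "carrier (hor_homology X \<epsilon> k w) = {\<one>\<^bsub>hor_homology X \<epsilon> k w\<^esub>}"
  by (simp add: carrier_hor_homology assms hor_class_zero)

lemma positive_weight_homology:
  assumes "finite_complex X" "w \<noteq> 0"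
  shows "carrier (hor_homology X (vertices X) k w) = {\<one>\<^bsub>hor_homology X (vertices X) k w\<^esub>}"
  by (rule carrier_hor_homology_trivial)
     (auto simp: hor_cycles_def positive_weight_chains [OF assms])

lemma set_bd_cong_colour:
  assumes "\<And>\<sigma>. \<sigma> \<in> keys c \<Longrightarrow> \<sigma> \<inter> E = \<sigma> \<inter> E'"
  shows "set_bd E c = set_bd E' c"
  unfolding set_bd_def by (rule linext_cong) (use assms in \<open>simp add: face_bd_def\<close>)

lemma set_bd_vertices:
  assumes "finite_complex X" "keys c \<subseteq> X"
  shows "set_bd (vertices X) c = set_bd UNIV c"
  by (rule set_bd_cong_colour) (use assms finite_complexD(5) [OF assms(1)] in blast)

lemma weight_zero_iff:
  assumes X: "finite_complex X" and "\<sigma> \<in> X"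
  shows "card (\<sigma> - (vertices X - {v})) = 0 \<longleftrightarrow> v \<notin> \<sigma>" and "card (\<sigma> - vertices X) = 0"
  using finite_complexD(3,5) [OF assms] by (auto simp: card_eq_0_iff)

text \<open>In weight 0 the colouring with only \<open>v\<close> white gives the chains of the deletion of \<open>v\<close>, included in
  the chains of \<open>X\<close>.\<close>

lemma deletion_chain_iff:
  assumes X: "finite_complex X"
  shows "c \<in> carrier (hor_chains X (vertices X - {v}) k 0) \<longleftrightarrow>
    c \<in> carrier (hor_chains X (vertices X) k 0) \<and> (\<forall>\<sigma>. v \<in> \<sigma> \<longrightarrow> c \<sigma> = 0)"
  using weight_zero_iff [OF X] by (fastforce simp: hor_chains_def)

lemma deletion_diff:
  assumes X: "finite_complex X" and c: "c \<in> carrier (hor_chains X (vertices X - {v}) k 0)"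
  shows "hor_diff X (vertices X - {v}) c = hor_diff X (vertices X) c"
proof -
  obtain p where p: "c = lookup p"
    "keys p \<subseteq> {\<sigma> \<in> X. card \<sigma> = Suc k \<and> card (\<sigma> - (vertices X - {v})) = 0}"
    using hor_chain_lookup [OF X c] by blast
  have "set_bd (vertices X - {v}) p = set_bd (vertices X) p"
    by (rule set_bd_cong_colour) (use p(2) weight_zero_iff(1) [OF X] in blast)
  moreover have "keys p \<subseteq> X" using p(2) by blast
  ultimately show ?thesis by (simp add: p(1) hor_diff_lookup [OF X] cong: if_cong)
qed

lemma deletion_cycle_iff:
  assumes X: "finite_complex X"
  shows "c \<in> hor_cycles X (vertices X - {v}) k 0 \<longleftrightarrow>
    c \<in> hor_cycles X (vertices X) k 0 \<and> (\<forall>\<sigma>. v \<in> \<sigma> \<longrightarrow> c \<sigma> = 0)"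
  using deletion_chain_iff [OF X] deletion_diff [OF X] unfolding hor_cycles_def by auto

lemma deletion_boundaries:
  assumes X: "finite_complex X"
  shows "hor_boundaries X (vertices X - {v}) k 0 \<subseteq> hor_boundaries X (vertices X) k 0"
proof
  fix c assume "c \<in> hor_boundaries X (vertices X - {v}) k 0"
  then obtain b where b: "b \<in> carrier (hor_chains X (vertices X - {v}) (Suc k) 0)"
    "c = hor_diff X (vertices X - {v}) b"
    unfolding hor_boundaries_def by blast
  then have "c = hor_diff X (vertices X) b" "b \<in> carrier (hor_chains X (vertices X) (Suc k) 0)"
    using deletion_diff [OF X b(1)] deletion_chain_iff [OF X] by auto
  then show "c \<in> hor_boundaries X (vertices X) k 0"
    unfolding hor_boundaries_def by blast
qed

text \<open>No representative has a simplex through \<open>v\<close>, so the truncation in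
  \<open>hor_map\<close> changes nothing; and boundaries in the deletion are boundaries in
  \<open>X\<close>. Hence \<open>the_elem\<close> is applied to a singleton and the map is induced
  by inclusion.\<close>

lemma hor_map_deletion:
  assumes X: "finite_complex X" and v: "v \<in> vertices X" and c: "c \<in> hor_cycles X (vertices X - {v}) k 0"
  shows "hor_map X (vertices X - {v}) v k 0 (hor_class X (vertices X - {v}) k 0 c) = hor_class X (vertices X) k 0 c"
proof -
  let ?\<epsilon> = "vertices X - {v}"
  have V: "insert v ?\<epsilon> = vertices X" using v by blast
  have "hor_class X (vertices X) k 0 (\<lambda>\<sigma>. if v \<in> \<sigma> then 0 else c' \<sigma>) = hor_class X (vertices X) k 0 c"
    if c': "c' \<in> hor_class X ?\<epsilon> k 0 c" for c'
  proof -
    obtain b where b: "b \<in> hor_boundaries X ?\<epsilon> k 0" "c' = (\<lambda>\<sigma>. b \<sigma> + c \<sigma>)"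
      using c' unfolding hor_class_eq by blast
    have "b \<in> hor_cycles X ?\<epsilon> k 0" using b hor_boundaries_subset_cycles [OF X] by blast
    then have "c' \<sigma> = 0" if "v \<in> \<sigma>" for \<sigma>
      using that c b(2) deletion_cycle_iff [OF X] by auto
    then have "(\<lambda>\<sigma>. if v \<in> \<sigma> then 0 else c' \<sigma>) = c'" by auto
    then show ?thesis
      using hor_class_add_boundary [of b X "vertices X" k 0 c] b deletion_boundaries [OF X, of v k] by auto
  qed
  moreover have "c \<in> hor_class X ?\<epsilon> k 0 c" by (rule self_in_hor_class)
  ultimately have "(\<lambda>c. hor_class X (vertices X) k 0 (\<lambda>\<sigma>. if v \<in> \<sigma> then 0 else c \<sigma>)) ` hor_class X ?\<epsilon> k 0 c
      = {hor_class X (vertices X) k 0 c}" by blast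
  then show ?thesis unfolding hor_map_def V by simp
qed

lemma hor_map_one:
  assumes "finite_complex X" "v \<in> vertices X"
  shows "hor_map X (vertices X - {v}) v k 0 \<one>\<^bsub>hor_homology X (vertices X - {v}) k 0\<^esub> =
    \<one>\<^bsub>hor_homology X (vertices X) k 0\<^esub>"
proof -
  have "(\<lambda>\<sigma>. 0) \<in> hor_cycles X (vertices X - {v}) k 0"
    using additive_hor_cycles unfolding additive_set_def by blast
  from hor_map_deletion [OF assms this] show ?thesis
    unfolding hor_class_zero .
qed

text \<open>In weight 0 this is the inclusion of the deletion. In positive weight every simplex of a
  chain contains \<open>v\<close>, the only white vertex, so the truncation gives 0.\<close>

lemma hor_map_closed:
  assumes X: "finite_complex X" and v: "v \<in> vertices X"
    and \<xi>: "\<xi> \<in> carrier (hor_homology X (vertices X - {v}) k w)"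
  shows "hor_map X (vertices X - {v}) v k w \<xi> \<in> carrier (hor_homology X (vertices X) k w)"
proof (cases "w = 0")
  case True
  then obtain c where "c \<in> hor_cycles X (vertices X - {v}) k 0" "\<xi> = hor_class X (vertices X - {v}) k 0 c"
    using \<xi> by (auto simp: carrier_hor_homology)
  then show ?thesis
    using True hor_map_deletion [OF X v] deletion_cycle_iff [OF X] by (auto simp: carrier_hor_homology)
next
  case False
  let ?\<epsilon> = "vertices X - {v}"
  have V: "insert v ?\<epsilon> = vertices X" using v by blast
  obtain c where c: "c \<in> hor_cycles X ?\<epsilon> k w" "\<xi> = hor_class X ?\<epsilon> k w c"
    using \<xi> by (auto simp: carrier_hor_homology)
  have "hor_class X (vertices X) k w (\<lambda>\<sigma>. if v \<in> \<sigma> then 0 else c' \<sigma>) = \<one>\<^bsub>hor_homology X (vertices X) k w\<^esub>"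
    if c': "c' \<in> \<xi>" for c'
  proof -
    obtain b where "b \<in> hor_boundaries X ?\<epsilon> k w" "c' = (\<lambda>\<sigma>. b \<sigma> + c \<sigma>)"
      using c' unfolding c(2) hor_class_eq by blast
    then have "c' \<in> carrier (hor_chains X ?\<epsilon> k w)"
      using c(1) hor_boundaries_subset_cycles [OF X] additive_hor_chains [of X ?\<epsilon> k w]
      unfolding hor_cycles_def additive_set_def by blast
    then have "c' \<sigma> = 0" if "v \<notin> \<sigma>" for \<sigma>
      using that False weight_zero_iff(1) [OF X, of \<sigma> v] by (auto simp: hor_chains_def)
    then have "(\<lambda>\<sigma>. if v \<in> \<sigma> then 0 else c' \<sigma>) = (\<lambda>\<sigma>. 0)" by auto
    then show ?thesis by (simp add: hor_class_zero)
  qed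
  moreover have "c \<in> \<xi>" using c self_in_hor_class by blast
  ultimately have "(\<lambda>c. hor_class X (vertices X) k w (\<lambda>\<sigma>. if v \<in> \<sigma> then 0 else c \<sigma>)) ` \<xi>
      = {\<one>\<^bsub>hor_homology X (vertices X) k w\<^esub>}" by blast
  then show ?thesis
    unfolding hor_map_def V using positive_weight_homology [OF X False] by simp
qed

section \<open>The uber complex in top degree\<close>

lemma Mod_carrier_trivial:
  assumes "group G"
  shows "carrier (G Mod carrier G) = {carrier G}" and "carrier G <#>\<^bsub>G\<^esub> carrier G = carrier G"
proof -
  interpret group G by fact
  have "carrier G #>\<^bsub>G\<^esub> x = carrier G" if "x \<in> carrier G" for x
    using coset_join2 [OF that subgroup_self that] .
  moreover have "\<one>\<^bsub>G\<^esub> \<in> carrier G" by simp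
  ultimately show "carrier (G Mod carrier G) = {carrier G}"
    unfolding carrier_FactGroup by blast
  show "carrier G <#>\<^bsub>G\<^esub> carrier G = carrier G"
    using subgroup_mult_id [OF subgroup_self] .
qed

lemma iso_F_at_trivial:
  assumes "carrier Q = {q}" "q \<otimes>\<^bsub>Q\<^esub> q = q" "(k, w) \<noteq> (a, b)"
  shows "Q \<cong> F_at a b k w"
proof (rule is_isoI, rule isoI)
  show "(\<lambda>_. 0) \<in> hom Q (F_at a b k w)"
    using assms by (auto simp: hom_def F_at_def)
  show "bij_betw (\<lambda>_. 0) (carrier Q) (carrier (F_at a b k w))"
    using assms by (auto simp: bij_betw_def F_at_def)
qed

lemma two_element_group:
  assumes "group Q" and Q: "carrier Q = {\<one>\<^bsub>Q\<^esub>, x}" and x: "x \<noteq> \<one>\<^bsub>Q\<^esub>"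
  shows "Q \<cong> F_at a b a b" and "carrier Q = generate Q {x}"
proof -
  interpret group Q by fact
  have xQ: "x \<in> carrier Q" using Q by simp
  have "x \<otimes>\<^bsub>Q\<^esub> x \<noteq> x" using x xQ by (simp add: r_cancel_one)
  then have xx: "x \<otimes>\<^bsub>Q\<^esub> x = \<one>\<^bsub>Q\<^esub>" using m_closed [OF xQ xQ] Q by blast
  show "Q \<cong> F_at a b a b"
  proof (rule is_isoI, rule isoI)
    let ?h = "\<lambda>y. if y = \<one>\<^bsub>Q\<^esub> then 0 else 1 :: bit"
    show "?h \<in> hom Q (F_at a b a b)"
      using x xx l_one [OF xQ] r_one [OF xQ] l_one [OF one_closed]
      unfolding hom_def F_at_def Q by auto
    have "UNIV = {0, 1 :: bit}" by (auto intro: bit.exhaust)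
    then show "bij_betw ?h (carrier Q) (carrier (F_at a b a b))"
      using x unfolding bij_betw_def F_at_def Q by (auto simp: inj_on_def)
  qed
  have "generate Q {x} \<subseteq> carrier Q"
    using generate_incl [of "{x}"] xQ by simp
  moreover have "carrier Q \<subseteq> generate Q {x}"
    unfolding Q by (auto intro: generate.one generate.incl)
  ultimately show "carrier Q = generate Q {x}" by blast
qed

section \<open>The last terms of the uber complex\<close>

lemma group_uber_complex: "finite_complex X \<Longrightarrow> group (uber_complex X j k w)"
  unfolding uber_complex_def by (intro sum_group comm_group.axioms(2) comm_group_hor_homology)

lemma finite_colourings: "finite_complex X \<Longrightarrow> finite (colourings X j)"
  using finite_complexD(2) [of X] by (auto simp: colourings_def)

text \<open>There are finitely many colourings, so the finite support condition in the direct sum is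
  automatic.\<close>

lemma carrier_uber_complex:
  assumes "finite_complex X"
  shows "carrier (uber_complex X j k w) = (\<Pi>\<^sub>E \<epsilon>\<in>colourings X j. carrier (hor_homology X \<epsilon> k w))"
  unfolding uber_complex_def
  using finite_colourings [OF assms, of j] comm_group.axioms(2) [OF comm_group_hor_homology [OF assms]]
  by (subst carrier_sum_group) auto

lemma colourings_top:
  assumes "finite_complex X"
  shows "colourings X (card (vertices X)) = {vertices X}"
    and "colourings X (Suc (card (vertices X))) = {}"
proof -
  note fin = finite_complexD(2) [OF assms]
  show "colourings X (card (vertices X)) = {vertices X}"
    using card_subset_eq [OF fin] by (auto simp: colourings_def)
  show "colourings X (Suc (card (vertices X))) = {}"
  proof -
    have "\<not> (\<epsilon> \<subseteq> vertices X \<and> card \<epsilon> = Suc (card (vertices X)))" for \<epsilon>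
      using card_mono [OF fin, of \<epsilon>] by auto
    then show ?thesis unfolding colourings_def by blast
  qed
qed

lemma carrier_uber_complex_top:
  fixes X :: "'v set set"
  assumes "finite_complex X"
  shows "carrier (uber_complex X (card (vertices X)) k w) =
    (\<lambda>\<xi>. \<lambda>\<epsilon>\<in>{vertices X}. \<xi>) ` carrier (hor_homology X (vertices X) k w)"
proof -
  have PiE_point: "(\<Pi>\<^sub>E \<epsilon>\<in>{a}. S \<epsilon>) = (\<lambda>\<xi>. \<lambda>\<epsilon>\<in>{a}. \<xi>) ` S a" for a and S :: "'v set \<Rightarrow> 'v mod2_chain set set"
  proof (intro equalityI subsetI)
    fix f assume f: "f \<in> (\<Pi>\<^sub>E \<epsilon>\<in>{a}. S \<epsilon>)"
    then have "f = (\<lambda>\<epsilon>\<in>{a}. f a)"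
      by (intro extensionalityI [of _ "{a}"]) (auto simp: PiE_iff)
    moreover have "f a \<in> S a" using f by (simp add: PiE_iff)
    ultimately show "f \<in> (\<lambda>\<xi>. \<lambda>\<epsilon>\<in>{a}. \<xi>) ` S a" by (rule image_eqI)
  next
    fix f assume "f \<in> (\<lambda>\<xi>. \<lambda>\<epsilon>\<in>{a}. \<xi>) ` S a"
    then show "f \<in> (\<Pi>\<^sub>E \<epsilon>\<in>{a}. S \<epsilon>)" by (elim imageE) (simp add: PiE_iff)
  qed
  show ?thesis
    unfolding carrier_uber_complex [OF assms] colourings_top(1) [OF assms] by (rule PiE_point)
qed

text \<open>No colouring has more black vertices than \<open>X\<close> has vertices, so the next
  term is trivial.\<close>

lemma uber_cocycles_top:
  assumes "finite_complex X"
  shows "uber_cocycles X (card (vertices X)) k w = carrier (uber_complex X (card (vertices X)) k w)"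
  by (auto simp: uber_cocycles_def kernel_def uber_diff_def uber_complex_def colourings_top [OF assms])

lemma uber_homology_top:
  assumes "finite_complex X"
  shows "uber_homology X (card (vertices X)) k w =
    uber_complex X (card (vertices X)) k w Mod uber_coboundaries X (card (vertices X)) k w"
  by (simp add: uber_homology_def uber_cocycles_top [OF assms])

lemma deletion_colouring:
  assumes "finite_complex X" "card (vertices X) = Suc j" "v \<in> vertices X"
  shows "vertices X - {v} \<in> colourings X j"
  using assms finite_complexD(2) [OF assms(1)] by (auto simp: colourings_def card_Diff_singleton)

lemma uber_diff_top:
  assumes X: "finite_complex X" and j: "card (vertices X) = Suc j" and x: "x \<in> carrier (uber_complex X j k w)"
  shows "uber_diff X j k w x = (\<lambda>\<epsilon>\<in>{vertices X}. \<Otimes>\<^bsub>hor_homology X (vertices X) k w\<^esub>v\<in>vertices X.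
      hor_map X (vertices X - {v}) v k w (x (vertices X - {v})))"
    and "v \<in> vertices X \<Longrightarrow> hor_map X (vertices X - {v}) v k w (x (vertices X - {v}))
      \<in> carrier (hor_homology X (vertices X) k w)"
    and "uber_diff X j k w x \<in> carrier (uber_complex X (Suc j) k w)"
proof -
  interpret comm_group "hor_homology X (vertices X) k w" by (rule comm_group_hor_homology [OF X])
  have top: "colourings X (Suc j) = {vertices X}" using colourings_top(1) [OF X] j by simp
  then show eq: "uber_diff X j k w x = (\<lambda>\<epsilon>\<in>{vertices X}. \<Otimes>\<^bsub>hor_homology X (vertices X) k w\<^esub>v\<in>vertices X.
      hor_map X (vertices X - {v}) v k w (x (vertices X - {v})))"
    by (simp add: uber_diff_def top restrict_def fun_eq_iff)
  show cl: "hor_map X (vertices X - {v}) v k w (x (vertices X - {v})) \<in> carrier (hor_homology X (vertices X) k w)"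
    if v: "v \<in> vertices X" for v
    by (rule hor_map_closed [OF X v])
       (use x deletion_colouring [OF X j v] in \<open>auto simp: carrier_uber_complex [OF X]\<close>)
  have "(\<Otimes>\<^bsub>hor_homology X (vertices X) k w\<^esub>v\<in>vertices X.
      hor_map X (vertices X - {v}) v k w (x (vertices X - {v}))) \<in> carrier (hor_homology X (vertices X) k w)"
    by (rule finprod_closed) (use cl in auto)
  then show "uber_diff X j k w x \<in> carrier (uber_complex X (Suc j) k w)"
    by (simp add: eq carrier_uber_complex [OF X] top)
qed

section \<open>The cokernel of the deletion maps for a triangulated manifold\<close>

context triangulated_manifold
begin

lemma ex_vertex: "\<exists>v. v \<in> vertices X"
  using nonempty complexD(4,5) by blast

lemma card_vertices_Suc:
  obtains j where "card (vertices X) = Suc j"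
  using ex_vertex complexD(2) by (metis card_0_eq empty_iff not0_implies_Suc)

lemma cycle_lookup:
  assumes "c \<in> hor_cycles X (vertices X) k 0"
  obtains p where "c = lookup p" "keys p \<subseteq> {\<sigma> \<in> X. card \<sigma> = Suc k}" "keys (set_bd UNIV p) \<subseteq> {{}}"
proof -
  obtain p where p: "c = lookup p" "keys p \<subseteq> {\<sigma> \<in> X. card \<sigma> = Suc k \<and> card (\<sigma> - vertices X) = 0}"
    using hor_chain_lookup [OF complex] assms unfolding hor_cycles_def by blast
  have pX: "keys p \<subseteq> X" using p(2) by blast
  have "hor_diff X (vertices X) c = (\<lambda>\<tau>. 0)" using assms by (simp add: hor_cycles_def)
  then have "lookup (set_bd UNIV p) \<tau> = 0" if "\<tau> \<noteq> {}" for \<tau>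
  proof -
    have "hor_diff X (vertices X) c \<tau> = lookup (set_bd UNIV p) \<tau>"
      using that by (simp add: p(1) hor_diff_lookup [OF complex pX] set_bd_vertices [OF complex pX])
    then show ?thesis using \<open>hor_diff X (vertices X) c = (\<lambda>\<tau>. 0)\<close> by simp
  qed
  then have "keys (set_bd UNIV p) \<subseteq> {{}}" by (auto simp: in_keys_iff)
  then show thesis using that p by blast
qed

lemma homology_from_deletion:
  assumes k: "k \<noteq> n" and v: "v \<in> vertices X" and \<xi>: "\<xi> \<in> carrier (hor_homology X (vertices X) k 0)"
  obtains c where "c \<in> hor_cycles X (vertices X - {v}) k 0" "\<xi> = hor_class X (vertices X) k 0 c"
proof -
  obtain z where z: "z \<in> hor_cycles X (vertices X) k 0" "\<xi> = hor_class X (vertices X) k 0 z"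
    using \<xi> by (auto simp: carrier_hor_homology)
  obtain p where p: "z = lookup p" "keys p \<subseteq> {\<sigma> \<in> X. card \<sigma> = Suc k}" "keys (set_bd UNIV p) \<subseteq> {{}}"
    using cycle_lookup [OF z(1)] by blast
  obtain b where b: "keys b \<subseteq> {\<tau> \<in> X. card \<tau> = Suc (Suc k)}"
    "\<And>\<tau>. \<tau> \<in> keys (p + set_bd UNIV b) \<Longrightarrow> v \<notin> \<tau>"
    using cycle_off_vertex [OF k v p(2,3)] by blast
  have bw: "keys b \<subseteq> {\<sigma> \<in> X. card \<sigma> = Suc (Suc k) \<and> card (\<sigma> - vertices X) = 0}"
    using b(1) weight_zero_iff(2) [OF complex] by blast
  have bX: "keys b \<subseteq> X" using b(1) by blast
  have bd: "hor_diff X (vertices X) (lookup b) = lookup (set_bd UNIV b)"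
    using hor_diff_chain(1) [OF complex bw] set_bd_vertices [OF complex bX] by simp
  then have bb: "lookup (set_bd UNIV b) \<in> hor_boundaries X (vertices X) k 0"
    using lookup_hor_chain [OF bw] unfolding hor_boundaries_def by (metis image_eqI)
  define c where "c = (\<lambda>\<sigma>. lookup (set_bd UNIV b) \<sigma> + z \<sigma>)"
  have "c \<in> hor_cycles X (vertices X) k 0"
    using additive_hor_cycles [of X "vertices X" k 0] z(1) bb hor_boundaries_subset_cycles [OF complex]
    unfolding additive_set_def c_def by blast
  moreover have "c \<sigma> = 0" if "v \<in> \<sigma>" for \<sigma>
  proof -
    have "\<sigma> \<notin> keys (p + set_bd UNIV b)" using b(2) that by blast
    then show ?thesis by (simp add: c_def p(1) in_keys_iff lookup_add ac_simps)
  qed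
  ultimately have "c \<in> hor_cycles X (vertices X - {v}) k 0"
    using deletion_cycle_iff [OF complex] by blast
  moreover have "\<xi> = hor_class X (vertices X) k 0 c"
    using hor_class_add_boundary [OF bb] by (simp add: z(2) c_def)
  ultimately show thesis using that by blast
qed

text \<open>One vertex \<open>v\<close> is enough: in weight 0 each class has a representative
  avoiding \<open>v\<close>, so it is hit from the colouring in which only \<open>v\<close> is
  white, with units in all other components. In positive weight the target is trivial.\<close>

lemma coboundaries_top:
  assumes kw: "(k, w) \<noteq> (n, 0)"
  shows "uber_coboundaries X (card (vertices X)) k w = carrier (uber_complex X (card (vertices X)) k w)"
proof -
  obtain v where v: "v \<in> vertices X" using ex_vertex by blast
  obtain j where j: "card (vertices X) = Suc j" by (rule card_vertices_Suc)
  let ?H = "\<lambda>\<epsilon>. hor_homology X \<epsilon> k w" and ?V = "vertices X"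
  interpret comm_group "?H ?V" by (rule comm_group_hor_homology [OF complex])
  have one: "\<one>\<^bsub>?H \<epsilon>\<^esub> \<in> carrier (?H \<epsilon>)" for \<epsilon>
    using comm_group_hor_homology [OF complex] by (meson comm_group.axioms(2) group.is_monoid monoid.one_closed)
  have top: "colourings X (Suc j) = {?V}" using colourings_top(1) [OF complex] j by simp
  have "y \<in> uber_diff X j k w ` carrier (uber_complex X j k w)"
    if y: "y \<in> carrier (uber_complex X (Suc j) k w)" for y
  proof (cases "w = 0")
    case True
    then have k: "k \<noteq> n" using kw by simp
    have yV: "y ?V \<in> carrier (?H ?V)" "y = (\<lambda>\<epsilon>\<in>{?V}. y ?V)"
      using y unfolding j [symmetric] carrier_uber_complex_top [OF complex] by auto
    obtain c where c: "c \<in> hor_cycles X (?V - {v}) k 0" "y ?V = hor_class X ?V k 0 c"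
      using homology_from_deletion [OF k v] yV(1) True by blast
    define x where "x = (\<lambda>\<epsilon>\<in>colourings X j. if \<epsilon> = ?V - {v} then hor_class X \<epsilon> k w c else \<one>\<^bsub>?H \<epsilon>\<^esub>)"
    have x: "x \<in> carrier (uber_complex X j k w)"
      using c(1) True one by (auto simp: x_def carrier_uber_complex [OF complex] carrier_hor_homology)
    have xu: "hor_map X (?V - {u}) u k w (x (?V - {u})) = (if u = v then y ?V else \<one>\<^bsub>?H ?V\<^esub>)"
      if u: "u \<in> ?V" for u
    proof (cases "u = v")
      case True
      then show ?thesis
        using c \<open>w = 0\<close> hor_map_deletion [OF complex v c(1)] deletion_colouring [OF complex j v] by (simp add: x_def)
    next
      case False
      then have "?V - {u} \<noteq> ?V - {v}" using u by blast
      then have "x (?V - {u}) = \<one>\<^bsub>?H (?V - {u})\<^esub>"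
        using deletion_colouring [OF complex j u] by (simp add: x_def)
      then show ?thesis
        using hor_map_one [OF complex u, of k] False \<open>w = 0\<close> by simp
    qed
    have "(\<Otimes>\<^bsub>?H ?V\<^esub>u\<in>?V. hor_map X (?V - {u}) u k w (x (?V - {u}))) =
        (\<Otimes>\<^bsub>?H ?V\<^esub>u\<in>?V. if v = u then y ?V else \<one>\<^bsub>?H ?V\<^esub>)"
      by (rule finprod_cong) (use xu yV in \<open>auto simp: simp_implies_def\<close>)
    also have "\<dots> = y ?V"
      using finprod_singleton [OF v complexD(2), of "\<lambda>_. y ?V"] yV(1) by simp
    finally have "uber_diff X j k w x = y"
      using uber_diff_top(1) [OF complex j x] yV(2) by simp
    then show ?thesis using x by blast
  next
    case False
    define x where "x = (\<lambda>\<epsilon>\<in>colourings X j. \<one>\<^bsub>?H \<epsilon>\<^esub>)"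
    have x: "x \<in> carrier (uber_complex X j k w)"
      using one by (auto simp: x_def carrier_uber_complex [OF complex])
    have "carrier (uber_complex X (Suc j) k w) = {\<lambda>\<epsilon>\<in>{?V}. \<one>\<^bsub>?H ?V\<^esub>}"
      by (simp add: carrier_uber_complex_top [OF complex] positive_weight_homology [OF complex False]
          flip: j)
    then have "uber_diff X j k w x = y" using uber_diff_top(3) [OF complex j x] y by simp
    then show ?thesis using x by blast
  qed
  moreover have "uber_diff X j k w ` carrier (uber_complex X j k w) \<subseteq> carrier (uber_complex X (Suc j) k w)"
    using uber_diff_top(3) [OF complex j] by blast
  ultimately show ?thesis by (auto simp: uber_coboundaries_def j)
qed

lemma lookup_fundamental_cycle_in_cycles: "lookup fundamental_cycle \<in> hor_cycles X (vertices X) n 0"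
proof -
  have k: "keys fundamental_cycle \<subseteq> {\<sigma> \<in> X. card \<sigma> = Suc n \<and> card (\<sigma> - vertices X) = 0}"
    using weight_zero_iff(2) [OF complex] by (auto simp: keys_fundamental_cycle top_simplices_def)
  have kX: "keys fundamental_cycle \<subseteq> X" using k by blast
  have "lookup (set_bd UNIV fundamental_cycle) \<tau> = 0" if "\<tau> \<noteq> {}" for \<tau>
  proof -
    have "\<tau> \<notin> keys (set_bd UNIV fundamental_cycle)" using set_bd_fundamental_cycle that by blast
    then show ?thesis by (simp add: in_keys_iff)
  qed
  then have "hor_diff X (vertices X) (lookup fundamental_cycle) = (\<lambda>\<tau>. 0)"
    by (auto simp: hor_diff_lookup [OF complex kX] set_bd_vertices [OF complex kX])
  then show ?thesis using lookup_hor_chain [OF k] by (simp add: hor_cycles_def)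
qed

lemma hor_boundaries_top: "hor_boundaries X \<epsilon> n w = {\<lambda>\<sigma>. 0}"
proof -
  have "c \<sigma> = 0" if "c \<in> carrier (hor_chains X \<epsilon> (Suc n) w)" for c \<sigma>
    using that card_simplex_le [of \<sigma>] by (auto simp: hor_chains_def)
  then have "carrier (hor_chains X \<epsilon> (Suc n) w) = {\<lambda>\<sigma>. 0}"
    by (auto simp: hor_chains_def fun_eq_iff)
  then show ?thesis by (simp add: hor_boundaries_def)
qed

lemma hor_cycles_top: "hor_cycles X (vertices X) n 0 = {\<lambda>\<sigma>. 0, lookup fundamental_cycle}"
proof -
  have "c = (\<lambda>\<sigma>. 0) \<or> c = lookup fundamental_cycle" if c: "c \<in> hor_cycles X (vertices X) n 0" for c
  proof -
    obtain p where p: "c = lookup p" "keys p \<subseteq> {\<sigma> \<in> X. card \<sigma> = Suc n}" "keys (set_bd UNIV p) \<subseteq> {{}}"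
      using cycle_lookup [OF c] by blast
    then show ?thesis using top_cycle_cases [of p] by (auto simp: top_simplices_def)
  qed
  moreover have "(\<lambda>\<sigma>. 0) \<in> hor_cycles X (vertices X) n 0"
    using additive_hor_cycles unfolding additive_set_def by blast
  ultimately show ?thesis using lookup_fundamental_cycle_in_cycles by blast
qed

text \<open>Some \<open>n\<close>-simplex contains \<open>v\<close>, so the fundamental cycle does
  not survive in the deletion.\<close>

lemma hor_cycles_deletion_top:
  assumes "v \<in> vertices X"
  shows "hor_cycles X (vertices X - {v}) n 0 = {\<lambda>\<sigma>. 0}"
proof -
  obtain \<sigma> where \<sigma>: "\<sigma> \<in> X" "v \<in> \<sigma>" using assms by (auto simp: vertices_def)
  obtain \<tau> where "\<tau> \<in> X" "\<sigma> \<subseteq> \<tau>" "card \<tau> = Suc n" using pure [OF \<sigma>(1)] by blast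
  then have "v \<in> \<tau>" "lookup fundamental_cycle \<tau> \<noteq> 0"
    using \<sigma> by (auto simp: lookup_fundamental_cycle top_simplices_def)
  then show ?thesis
    using deletion_cycle_iff [OF complex, of _ v n] hor_cycles_top by auto
qed

lemma hor_class_top: "hor_class X \<epsilon> n w c = {c}"
  by (simp add: hor_class_eq hor_boundaries_top)

text \<open>Without boundaries in degree \<open>n\<close> the two classes are singletons. Purity
  verifies the condition for the sum of all \<open>n\<close>-simplices, and any simplex of
  \<open>X\<close> refutes it for 0.\<close>

lemma fundamental_class_eq: "fundamental_class X n = {lookup fundamental_cycle}"
  unfolding fundamental_class_def
proof (rule the_equality)
  show "{lookup fundamental_cycle} \<in> carrier (hor_homology X (vertices X) n 0) \<and>
      (\<forall>\<sigma>\<in>X. \<forall>z\<in>{lookup fundamental_cycle}. \<exists>\<tau>\<in>X. \<sigma> \<subseteq> \<tau> \<and> z \<tau> \<noteq> 0)"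
  proof (intro conjI ballI)
    fix \<sigma> z assume \<sigma>: "\<sigma> \<in> X" and z: "z \<in> {lookup fundamental_cycle}"
    obtain \<tau> where "\<tau> \<in> X" "\<sigma> \<subseteq> \<tau>" "card \<tau> = Suc n" using pure [OF \<sigma>] by blast
    then show "\<exists>\<tau>\<in>X. \<sigma> \<subseteq> \<tau> \<and> z \<tau> \<noteq> 0"
      using z by (auto simp: lookup_fundamental_cycle top_simplices_def)
  qed (simp add: carrier_hor_homology hor_class_top hor_cycles_top)
  fix \<zeta> assume \<zeta>: "\<zeta> \<in> carrier (hor_homology X (vertices X) n 0) \<and>
      (\<forall>\<sigma>\<in>X. \<forall>z\<in>\<zeta>. \<exists>\<tau>\<in>X. \<sigma> \<subseteq> \<tau> \<and> z \<tau> \<noteq> 0)"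
  then have "\<zeta> \<noteq> {\<lambda>\<sigma>. 0}" using nonempty by auto
  then show "\<zeta> = {lookup fundamental_cycle}"
    using \<zeta> by (auto simp: carrier_hor_homology hor_class_top hor_cycles_top)
qed

text \<open>The sources \<open>H\<^sub>n(X - v)\<close> vanish, since the nonzero
  \<open>n\<close>-cycle meets every vertex.\<close>

lemma coboundaries_top_fundamental:
  "uber_coboundaries X (card (vertices X)) n 0 = {\<one>\<^bsub>uber_complex X (card (vertices X)) n 0\<^esub>}"
proof -
  obtain j where j: "card (vertices X) = Suc j" by (rule card_vertices_Suc)
  let ?H = "\<lambda>\<epsilon>. hor_homology X \<epsilon> n 0" and ?V = "vertices X"
  interpret comm_group "?H ?V" by (rule comm_group_hor_homology [OF complex])
  have top: "colourings X (Suc j) = {?V}" using colourings_top(1) [OF complex] j by simp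
  have "uber_diff X j n 0 x = \<one>\<^bsub>uber_complex X (Suc j) n 0\<^esub>" if x: "x \<in> carrier (uber_complex X j n 0)" for x
  proof -
    have "hor_map X (?V - {v}) v n 0 (x (?V - {v})) = \<one>\<^bsub>?H ?V\<^esub>" if v: "v \<in> ?V" for v
    proof -
      have "x (?V - {v}) \<in> carrier (?H (?V - {v}))"
        using x deletion_colouring [OF complex j v] by (auto simp: carrier_uber_complex [OF complex])
      then have "x (?V - {v}) = \<one>\<^bsub>?H (?V - {v})\<^esub>"
        by (simp add: carrier_hor_homology_trivial [OF hor_cycles_deletion_top [OF v]])
      then show ?thesis
        using hor_map_one [OF complex v, of n] by simp
    qed
    then have "(\<Otimes>\<^bsub>?H ?V\<^esub>v\<in>?V. hor_map X (?V - {v}) v n 0 (x (?V - {v}))) = \<one>\<^bsub>?H ?V\<^esub>"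
      by (rule finprod_one_eqI)
    then show ?thesis
      using uber_diff_top(1) [OF complex j x] by (auto simp: uber_complex_def top intro!: restrict_ext)
  qed
  moreover have "\<one>\<^bsub>uber_complex X j n 0\<^esub> \<in> carrier (uber_complex X j n 0)"
    using group_uber_complex [OF complex] by (meson group.is_monoid monoid.one_closed)
  ultimately show ?thesis by (auto simp: uber_coboundaries_def j)
qed

theorem uber_homology_top_degree:
  shows "bigraded_iso (uber_homology X (card (vertices X))) (F_at n 0)"
    and "carrier (uber_homology X (card (vertices X)) n 0) =
      generate (uber_homology X (card (vertices X)) n 0)
        {uber_class X (card (vertices X)) n 0 (\<lambda>\<epsilon>\<in>colourings X (card (vertices X)). fundamental_class X n)}"
proof -
  let ?m = "card (vertices X)" and ?V = "vertices X"
  let ?G = "uber_complex X ?m n 0" and ?Q = "uber_homology X ?m n 0"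
  let ?f = "\<lambda>\<epsilon>\<in>colourings X ?m. fundamental_class X n"
  interpret G: group ?G by (rule group_uber_complex [OF complex])
  have Q: "?Q = ?G Mod {\<one>\<^bsub>?G\<^esub>}"
    by (simp add: uber_homology_top [OF complex] coboundaries_top_fundamental)
  have normal: "{\<one>\<^bsub>?G\<^esub>} \<lhd> ?G" by (rule G.one_is_normal)
  have group: "group ?Q" unfolding Q by (rule normal.factorgroup_is_group [OF normal])
  have one: "\<one>\<^bsub>?G\<^esub> = (\<lambda>\<epsilon>\<in>{?V}. {\<lambda>\<sigma>. 0})"
    by (auto simp: uber_complex_def colourings_top [OF complex] one_hor_homology hor_boundaries_top)
  have f: "?f = (\<lambda>\<epsilon>\<in>{?V}. {lookup fundamental_cycle})"
    by (simp add: colourings_top [OF complex] fundamental_class_eq)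
  \<comment> \<open>The only coboundary is the unit, so in bidegree \<open>(n, 0)\<close> the
    homology is this group of two elements, each wrapped in a singleton coset.\<close>
  have carrier: "carrier ?G = {\<one>\<^bsub>?G\<^esub>, ?f}"
    unfolding carrier_uber_complex_top [OF complex] one f
    by (simp add: carrier_hor_homology hor_class_top hor_cycles_top)
  obtain \<sigma> where "\<sigma> \<in> X" using nonempty by blast
  then obtain \<tau> where "\<tau> \<in> X" "card \<tau> = Suc n" by (rule pure)
  then have "\<tau> \<in> top_simplices" by (simp add: top_simplices_def)
  then have "lookup fundamental_cycle \<tau> \<noteq> 0" by (simp add: lookup_fundamental_cycle)
  then have "lookup fundamental_cycle \<noteq> (\<lambda>\<sigma>. 0)" by metis
  then have neq: "?f \<noteq> \<one>\<^bsub>?G\<^esub>"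
    unfolding one f by (metis restrict_apply singletonI singleton_inject)
  have coset: "{\<one>\<^bsub>?G\<^esub>} #>\<^bsub>?G\<^esub> x = {x}" if "x \<in> carrier ?G" for x
    using that by (auto simp: r_coset_def)
  have fG: "?f \<in> carrier ?G" using carrier by blast
  have class_f: "uber_class X ?m n 0 ?f = {?f}"
    using coset [OF fG] by (simp add: uber_class_def coboundaries_top_fundamental)
  have "carrier ?Q = {{\<one>\<^bsub>?G\<^esub>}, {?f}}"
    unfolding Q carrier_FactGroup carrier using coset [OF fG] coset [OF G.one_closed] by auto
  moreover have "\<one>\<^bsub>?Q\<^esub> = {\<one>\<^bsub>?G\<^esub>}" by (simp add: Q)
  ultimately have two: "carrier ?Q = {\<one>\<^bsub>?Q\<^esub>, {?f}}" "{?f} \<noteq> \<one>\<^bsub>?Q\<^esub>"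
    using neq by auto
  show "carrier ?Q = generate ?Q {uber_class X ?m n 0 ?f}"
    unfolding class_f using two_element_group(2) [OF group two] .
  have "uber_homology X ?m k w \<cong> F_at n 0 k w" if kw: "(k, w) \<noteq> (n, 0)" for k w
  proof -
    let ?C = "uber_complex X ?m k w"
    have "group ?C" by (rule group_uber_complex [OF complex])
    then show ?thesis
      unfolding uber_homology_top [OF complex] coboundaries_top [OF kw]
      by (intro iso_F_at_trivial [of _ "carrier ?C"] kw) (simp_all add: Mod_carrier_trivial)
  qed
  moreover have "?Q \<cong> F_at n 0 n 0"
    by (rule two_element_group(1) [OF group two])
  ultimately show "bigraded_iso (uber_homology X ?m) (F_at n 0)"
    unfolding bigraded_iso_def by (metis prod.inject)
qed

end

theorem theorem7p10:
  fixes X :: "'v set set" and M :: "'a topology" and m n :: nat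
  assumes "closed_connected_manifold n M"
    and "triangulates X M"
    and "card (vertices X) = m"
  shows "bigraded_iso (uber_homology X m) (F_at n 0) \<and>
    carrier (uber_homology X m n 0) =
      generate (uber_homology X m n 0)
        {uber_class X m n 0 (\<lambda>\<epsilon>\<in>colourings X m. fundamental_class X n)}"
proof -
  interpret triangulated_manifold X n
    by (rule triangulated_manifoldI [OF assms(1,2)])
  show ?thesis
    using uber_homology_top_degree unfolding assms(3) by (intro conjI)
qed

end
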